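(* Consider the quantized Riemannian gradient descent algorithm described in the context. Let $0<\eta\le\frac{\cos(D)}{\gamma}$ and let $\epsilon>0$ be the target accuracy. Then the algorithm needs at most $$b=O\left(nd\,\frac{1}{\cos(D)\,\delta\,\eta}\,\log\Big(\frac{n}{\cos(D)\,\delta\,\eta}\Big)\,\log\Big(\frac{D}{\epsilon}\Big)\right)$$ bits of communication in total to estimate the leading eigenvector $x^*$ with accuracy $\epsilon$ measured in intrinsic distance, i.e. to produce an iterate $x^{(T)}$ with $\mathrm{dist}(x^{(T)},x^* )\le\epsilon$.
   Context: Setting. A data matrix $M\in\mathbb{R}^{m\times d}$ is partitioned row-wise among $n$ machines; machine $i$ holds $M_i$. Put $A_i=M_i^TM_i$, $A=M^TM=\sum_{i=1}^nA_i$, $f_i(x)=-x^TA_ix$ and $f(x)=-x^TAx=\sum_{i=1}^n f_i(x)$ on the unit sphere $\mathbb{S}^{d-1}\subset\mathbb{R}^d$. Let $\lambda_1\ge\lambda_2\ge\dots$ be the eigenvalues of $A$, assume $\delta=\lambda_1-\lambda_2>0$, and put $\mu=\delta/2$. Let $\gamma_i=2\lambda_{\max}(A_i)$ and $\gamma=n\max_i\gamma_i$. Let $x^{(0)}\in\mathbb{S}^{d-1}$ be known to all machines, let $x^*\in\{v_1,-v_1\}$ be the unit leading eigenvector of $A$ closest to $x^{(0)}$, and let $0<D<\pi/2$ satisfy $\mathrm{dist}(x^{(0)},x^* )\le D$. Sphere notation. $T_x\mathbb{S}^{d-1}=x^\perp$; $\mathrm{grad}f(x)=(I-xx^T)\nabla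 f(x)$; $\mathrm{dist}(p,q)=\arccos\langle p,q\rangle$; $\exp_p(v)=\cos(\|v\|)p+\sin(\|v\|)v/\|v\|$ (with $\exp_p(0)=p$); $\Gamma_{x^{(t)}}^{x^{(t+1)}}$ is parallel transport from $T_{x^{(t)}}\mathbb{S}^{d-1}$ to $T_{x^{(t+1)}}\mathbb{S}^{d-1}$ along the geodesic joining the two points. Quantization. $Q:\mathbb{R}^{d-1}\times\mathbb{R}^{d-1}\times\mathbb{R}_+\times\mathbb{R}_+\to\mathbb{R}^{d-1}$ is a fixed (deterministic lattice) quantization function: for $y,w>0$ there are an encoder $\mathrm{enc}_{w,y}:\mathbb{R}^{d-1}\to\{0,1\}^b$ and a decoder $\mathrm{dec}_{w,y}:\{0,1\}^b\times\mathbb{R}^{d-1}\to\mathbb{R}^{d-1}$ such that whenever $\|x-x'\|\le y$, $\mathrm{dec}_{w,y}(\mathrm{enc}_{w,y}(x),x')=Q(x,x',y,w)$ and $\|Q(x,x',y,w)-x\|\le w$; if $y/w>1$ the number of bits used by each machine to communicate the vector is $b=O(d\log(y/w))$. The decoded vector is the lattice point closest to $x$, so it is the same for all admissible $x'$. $Q_x$ denotes $Q$ applied in $T_x\mathbb{S}^{d-1}$, identified with $\mathbb{R}^{d-1}$ by a linear isometry. Parameters. $\sigma=1-\cos(D)\mu\eta$ if $\cos(D)\mu\eta\le\frac12$ and $\sigma=\frac12$ otherwise; $K=\frac{2}{\sqrt\sigma}$; $\theta=\frac{\sqrt\sigma(1-\sqrt\sigma)}{4}$; $\sqrt\xi=\theta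 K+\sqrt\sigma$; $R^{(t)}=\gamma K(\sqrt\xi)^tD$. A master machine $i_0$ is fixed. Algorithm. Initialization at $x^{(0)}$: each machine $i$ encodes its gradient and the master decodes $q_i^{(0)}=Q_{x^{(0)}}\big(\mathrm{grad}f_i(x^{(0)}),\mathrm{grad}f_{i_0}(x^{(0)}),2\gamma\pi,\frac{\theta R^{(0)}}{2n}\big)$; the master sums $r^{(0)}=\sum_{i=1}^nq_i^{(0)}$, encodes the sum, and each machine $i$ decodes $q^{(0)}=Q_{x^{(0)}}\big(r^{(0)},\mathrm{grad}f_i(x^{(0)}),\frac{\theta R^{(0)}}{2}+2\gamma\pi,\frac{\theta R^{(0)}}{2}\big)$. For $t\ge0$: $x^{(t+1)}=\exp_{x^{(t)}}(-\eta q^{(t)})$; the master decodes $q_i^{(t+1)}=Q_{x^{(t+1)}}\big(\mathrm{grad}f_i(x^{(t+1)}),\Gamma_{x^{(t)}}^{x^{(t+1)}}q_i^{(t)},\frac{R^{(t+1)}}{n},\frac{\theta R^{(t+1)}}{2n}\big)$ for each $i$ and sums $r^{(t+1)}=\sum_{i=1}^nq_i^{(t+1)}$; it encodes the sum and each machine decodes $q^{(t+1)}=Q_{x^{(t+1)}}\big(r^{(t+1)},\Gamma_{x^{(t)}}^{x^{(t+1)}}q^{(t)},(1+\frac\theta2)R^{(t+1)},\frac{\theta R^{(t+1)}}{2}\big)$. The total communication is the number of bits sent for all encodings (machines to master and master to machines) over all rounds. $O(\cdot)$ hides an absolute constant, in the usual asymptotic regime where the logarithms are bounded below by a positive constant (so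 $\epsilon<D$).
   Formalization: The bound is proved under the added condition κ·log(1/D) ≤ (1/(cos(D)δη))·log(n/(cos(D)δη))·log(D/ε), with the O-constant depending on κ>0; without it the first round, costing order nd·log(1/D) bits, makes the claim false as D→0 with D/ε fixed. *)

theory Defs
  imports
    "Jordan_Normal_Form.Char_Poly"
    "Jordan_Normal_Form.DL_Submatrix"
begin

text \<open>
  The constant hidden in the communication bound must not depend on the dimension \<open>d\<close>, so \<open>d\<close>
  has to be quantified inside the statement. Vectors and matrices are therefore those of
  \<open>Jordan_Normal_Form\<close>, with explicit carriers \<open>carrier_vec d\<close> and \<open>carrier_mat m d\<close>.
\<close>

section \<open>The round sphere\<close>

definition vnorm :: "real vec \<Rightarrow> real" where
  "vnorm v = sqrt (v \<bullet> v)"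

definition unit_sphere :: "nat \<Rightarrow> real vec set" where
  "unit_sphere d = {x \<in> carrier_vec d. vnorm x = 1}"

definition sph_dist :: "real vec \<Rightarrow> real vec \<Rightarrow> real" where
  "sph_dist p q = arccos (p \<bullet> q)"

text \<open>Since \<open>sin 0 / 0 = 0\<close>, this gives \<open>sph_exp p 0 = p\<close>.\<close>

definition sph_exp :: "real vec \<Rightarrow> real vec \<Rightarrow> real vec" where
  "sph_exp p v = cos (vnorm v) \<cdot>\<^sub>v p + (sin (vnorm v) / vnorm v) \<cdot>\<^sub>v v"

text \<open>\<open>(I - x x\<^sup>T) v\<close>\<close>

definition tangent_proj :: "real vec \<Rightarrow> real vec \<Rightarrow> real vec" where
  "tangent_proj x v = v - (x \<bullet> v) \<cdot>\<^sub>v x"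

definition euclid_grad :: "nat \<Rightarrow> (real vec \<Rightarrow> real) \<Rightarrow> real vec \<Rightarrow> real vec" where
  "euclid_grad d f x =
     vec d (\<lambda>k. THE D. ((\<lambda>s. f (x + s \<cdot>\<^sub>v unit_vec d k)) has_real_derivative D) (at 0))"

definition riem_grad :: "nat \<Rightarrow> (real vec \<Rightarrow> real) \<Rightarrow> real vec \<Rightarrow> real vec" where
  "riem_grad d f x = tangent_proj x (euclid_grad d f x)"

text \<open>
  \<open>V\<close> is a tangent field along the curve \<open>c\<close>, and its covariant derivative, that is the tangential
  part of its ordinary derivative \<open>W\<close>, vanishes.
\<close>

definition parallel_along :: "nat \<Rightarrow> (real \<Rightarrow> real vec) \<Rightarrow> (real \<Rightarrow> real vec) \<Rightarrow> bool" where
  "parallel_along d c V \<longleftrightarrow>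
     (\<forall>s\<in>{0..1}. V s \<in> carrier_vec d \<and> c s \<bullet> V s = 0 \<and>
        (\<exists>W\<in>carrier_vec d.
           (\<forall>k<d. ((\<lambda>u. V u $ k) has_real_derivative W $ k) (at s within {0..1})) \<and>
           tangent_proj (c s) W = 0\<^sub>v d))"

text \<open>
  Here \<open>v\<close> is the initial velocity of the minimizing geodesic from \<open>x\<close> to \<open>y\<close>; it is unique as soon
  as \<open>y \<noteq> - x\<close>, and the description is unspecified for antipodal points.
\<close>

definition parallel_transport :: "nat \<Rightarrow> real vec \<Rightarrow> real vec \<Rightarrow> real vec \<Rightarrow> real vec" where
  "parallel_transport d x y u =
     (THE w. \<exists>v V. v \<in> carrier_vec d \<and> x \<bullet> v = 0 \<and> vnorm v = sph_dist x y \<and> sph_exp x v = y \<and>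
        parallel_along d (\<lambda>s. sph_exp x (s \<cdot>\<^sub>v v)) V \<and> V 0 = u \<and> V 1 = w)"


section \<open>Distributed data\<close>

text \<open>\<open>part r\<close> is the machine that holds row \<open>r\<close> of the data matrix.\<close>

definition local_data :: "real mat \<Rightarrow> (nat \<Rightarrow> nat) \<Rightarrow> nat \<Rightarrow> real mat" where
  "local_data M part i = submatrix M {r. part r = i} UNIV"

definition gram :: "real mat \<Rightarrow> real mat" where
  "gram M = M\<^sup>T * M"

definition pca_cost :: "real mat \<Rightarrow> real vec \<Rightarrow> real" where
  "pca_cost A x = - (x \<bullet> (A *\<^sub>v x))"

text \<open>The list of all eigenvalues, repeated with multiplicity, in non-increasing order.\<close>

definition eigenvalues_desc :: "real mat \<Rightarrow> real list \<Rightarrow> bool" where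
  "eigenvalues_desc A es \<longleftrightarrow>
     char_poly A = (\<Prod>e\<leftarrow>es. [:- e, 1:]) \<and> sorted_wrt (\<ge>) es"

definition lambda_max :: "real mat \<Rightarrow> real" where
  "lambda_max A = Max {e. eigenvalue A e}"

definition smoothness :: "real mat \<Rightarrow> (nat \<Rightarrow> nat) \<Rightarrow> nat \<Rightarrow> real" where
  "smoothness M part n =
     real n * Max ((\<lambda>i. 2 * lambda_max (gram (local_data M part i))) ` {..<n})"


section \<open>Quantization\<close>

definition full_lattice :: "nat \<Rightarrow> real vec set \<Rightarrow> bool" where
  "full_lattice k L \<longleftrightarrow>
     (\<exists>B\<in>carrier_mat k k. det B \<noteq> 0 \<and>
        L = {B *\<^sub>v z | z. z \<in> carrier_vec k \<and> (\<forall>i<k. z $ i \<in> \<int>)})"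

text \<open>
  \<open>N\<close> is the nearest-point map of the lattice, with a fixed rule for breaking ties; as it does not
  see the reference vector \<open>x'\<close>, the decoded vector is the same for all admissible references.
  The constant \<open>c\<close> is the one hidden in the bit count \<open>O(d log (y/w))\<close>. The logarithm is cut off
  from below at \<open>1\<close>: without a cut-off no scheme could meet the bound as \<open>y/w\<close> tends to \<open>1\<close>.
\<close>

definition lattice_quantizer ::
  "nat \<Rightarrow> real \<Rightarrow> (real vec \<Rightarrow> real vec \<Rightarrow> real \<Rightarrow> real \<Rightarrow> real vec)
    \<Rightarrow> (real \<Rightarrow> real \<Rightarrow> real vec \<Rightarrow> bool list)
    \<Rightarrow> (real \<Rightarrow> real \<Rightarrow> bool list \<Rightarrow> real vec \<Rightarrow> real vec)
    \<Rightarrow> (real \<Rightarrow> real \<Rightarrow> nat) \<Rightarrow> bool" where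
  "lattice_quantizer d c Q enc dec bits \<longleftrightarrow>
     (\<forall>y>0. \<forall>w>0.
        (\<forall>x\<in>carrier_vec (d - 1). length (enc w y x) = bits y w) \<and>
        (\<forall>x\<in>carrier_vec (d - 1). \<forall>x'\<in>carrier_vec (d - 1). vnorm (x - x') \<le> y \<longrightarrow>
           dec w y (enc w y x) x' = Q x x' y w \<and> vnorm (Q x x' y w - x) \<le> w) \<and>
        (\<exists>L N. full_lattice (d - 1) L \<and>
           (\<forall>x\<in>carrier_vec (d - 1).
              N x \<in> L \<and> (\<forall>p\<in>L. vnorm (x - N x) \<le> vnorm (x - p)) \<and>
              (\<forall>x'\<in>carrier_vec (d - 1). vnorm (x - x') \<le> y \<longrightarrow> Q x x' y w = N x))) \<and>
        (y / w > 1 \<longrightarrow> real (bits y w) \<le> c * real d * max 1 (ln (y / w))))"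

text \<open>
  For every point \<open>x\<close> of the sphere the columns of \<open>U x\<close> are an orthonormal basis of the tangent space
  at \<open>x\<close>, so that \<open>U x\<close> is a linear isometry from \<open>\<real>\<^sup>d\<^sup>-\<^sup>1\<close> onto it, with inverse \<open>(U x)\<^sup>T\<close>.
\<close>

definition tangent_frames :: "nat \<Rightarrow> (real vec \<Rightarrow> real mat) \<Rightarrow> bool" where
  "tangent_frames d U \<longleftrightarrow>
     (\<forall>x\<in>unit_sphere d. U x \<in> carrier_mat d (d - 1) \<and>
        (U x)\<^sup>T * U x = 1\<^sub>m (d - 1) \<and> (U x)\<^sup>T *\<^sub>v x = 0\<^sub>v (d - 1))"

definition tangent_quant ::
  "(real vec \<Rightarrow> real mat) \<Rightarrow> (real vec \<Rightarrow> real vec \<Rightarrow> real \<Rightarrow> real \<Rightarrow> real vec)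
    \<Rightarrow> real vec \<Rightarrow> real vec \<Rightarrow> real vec \<Rightarrow> real \<Rightarrow> real \<Rightarrow> real vec" where
  "tangent_quant U Q x v v' y w = U x *\<^sub>v Q ((U x)\<^sup>T *\<^sub>v v) ((U x)\<^sup>T *\<^sub>v v') y w"


section \<open>Parameters and algorithm\<close>

definition sigma_par :: "real \<Rightarrow> real \<Rightarrow> real \<Rightarrow> real" where
  "sigma_par D \<mu> \<eta> = (if cos D * \<mu> * \<eta> \<le> 1/2 then 1 - cos D * \<mu> * \<eta> else 1/2)"

definition K_par :: "real \<Rightarrow> real" where
  "K_par \<sigma> = 2 / sqrt \<sigma>"

definition theta_par :: "real \<Rightarrow> real" where
  "theta_par \<sigma> = sqrt \<sigma> * (1 - sqrt \<sigma>) / 4"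

definition sqrt_xi_par :: "real \<Rightarrow> real" where
  "sqrt_xi_par \<sigma> = theta_par \<sigma> * K_par \<sigma> + sqrt \<sigma>"

definition R_par :: "real \<Rightarrow> real \<Rightarrow> real \<Rightarrow> nat \<Rightarrow> real" where
  "R_par \<gamma> \<sigma> D t = \<gamma> * K_par \<sigma> * sqrt_xi_par \<sigma> ^ t * D"

text \<open>
  Input radii \<open>y\<close> of the quantizer in round \<open>t\<close>, for the messages to the master and from the master.
  The matching accuracies \<open>w\<close> are \<open>\<theta> R\<^sup>(\<^sup>t\<^sup>) / (2 n)\<close> and \<open>\<theta> R\<^sup>(\<^sup>t\<^sup>) / 2\<close> in all rounds.
\<close>

definition y_up :: "nat \<Rightarrow> real \<Rightarrow> (nat \<Rightarrow> real) \<Rightarrow> nat \<Rightarrow> real" where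
  "y_up n \<gamma> R t = (if t = 0 then 2 * \<gamma> * pi else R t / real n)"

definition w_up :: "nat \<Rightarrow> real \<Rightarrow> (nat \<Rightarrow> real) \<Rightarrow> nat \<Rightarrow> real" where
  "w_up n \<theta> R t = \<theta> * R t / (2 * real n)"

definition y_down :: "real \<Rightarrow> real \<Rightarrow> (nat \<Rightarrow> real) \<Rightarrow> nat \<Rightarrow> real" where
  "y_down \<gamma> \<theta> R t = (if t = 0 then \<theta> * R t / 2 + 2 * \<gamma> * pi else (1 + \<theta> / 2) * R t)"

definition w_down :: "real \<Rightarrow> (nat \<Rightarrow> real) \<Rightarrow> nat \<Rightarrow> real" where
  "w_down \<theta> R t = \<theta> * R t / 2"

text \<open>
  \<open>f i\<close> is the cost of machine \<open>i\<close> and \<open>QT\<close> the quantization in the tangent spaces. In round \<open>0\<close> every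
  machine decodes \<open>q 0\<close> with the help of its own gradient; all results have to be the same vector.
\<close>

definition qrgd_run ::
  "nat \<Rightarrow> nat \<Rightarrow> nat \<Rightarrow> (nat \<Rightarrow> real vec \<Rightarrow> real)
    \<Rightarrow> (real vec \<Rightarrow> real vec \<Rightarrow> real vec \<Rightarrow> real \<Rightarrow> real \<Rightarrow> real vec)
    \<Rightarrow> real \<Rightarrow> real \<Rightarrow> real \<Rightarrow> (nat \<Rightarrow> real) \<Rightarrow> real vec
    \<Rightarrow> (nat \<Rightarrow> real vec) \<Rightarrow> (nat \<Rightarrow> nat \<Rightarrow> real vec) \<Rightarrow> (nat \<Rightarrow> real vec) \<Rightarrow> (nat \<Rightarrow> real vec) \<Rightarrow> bool" where
  "qrgd_run d n i0 f QT \<gamma> \<eta> \<theta> R x0 x qi r q \<longleftrightarrow>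
     x 0 = x0 \<and>
     (\<forall>i<n. qi 0 i =
        QT (x 0) (riem_grad d (f i) (x 0)) (riem_grad d (f i0) (x 0)) (y_up n \<gamma> R 0) (w_up n \<theta> R 0)) \<and>
     (\<forall>i<n. q 0 =
        QT (x 0) (r 0) (riem_grad d (f i) (x 0)) (y_down \<gamma> \<theta> R 0) (w_down \<theta> R 0)) \<and>
     (\<forall>t. r t = vec d (\<lambda>k. \<Sum>i<n. qi t i $ k)) \<and>
     (\<forall>t. x (Suc t) = sph_exp (x t) ((- \<eta>) \<cdot>\<^sub>v q t)) \<and>
     (\<forall>t. \<forall>i<n. qi (Suc t) i =
        QT (x (Suc t)) (riem_grad d (f i) (x (Suc t)))
          (parallel_transport d (x t) (x (Suc t)) (qi t i))
          (y_up n \<gamma> R (Suc t)) (w_up n \<theta> R (Suc t))) \<and>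
     (\<forall>t. q (Suc t) =
        QT (x (Suc t)) (r (Suc t))
          (parallel_transport d (x t) (x (Suc t)) (q t))
          (y_down \<gamma> \<theta> R (Suc t)) (w_down \<theta> R (Suc t)))"

text \<open>
  Bits sent until \<open>x T\<close> is available: in each of the rounds \<open>0, \<dots>, T - 1\<close> every machine sends one
  encoded vector to the master and receives one from it.

  Round \<open>0\<close> has \<open>y/w\<close> of order \<open>n / ((1 - sqrt \<sigma>) D)\<close> and hence costs about \<open>n d log (1/D)\<close> bits
  beyond the price of a later round. A total that does not mention \<open>log (1/D)\<close> by itself can thus only
  hold uniformly in the regime where \<open>log (1/D)\<close> is at most a constant times that total per coordinate
  and machine; this holds whenever \<open>D\<close> is bounded away from \<open>0\<close>, or \<open>\<epsilon>\<close> is small relative to \<open>D\<close>.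
\<close>

definition total_bits ::
  "nat \<Rightarrow> (real \<Rightarrow> real \<Rightarrow> nat) \<Rightarrow> real \<Rightarrow> real \<Rightarrow> (nat \<Rightarrow> real) \<Rightarrow> nat \<Rightarrow> nat" where
  "total_bits n bits \<gamma> \<theta> R T =
     (\<Sum>t<T. n * bits (y_up n \<gamma> R t) (w_up n \<theta> R t) + n * bits (y_down \<gamma> \<theta> R t) (w_down \<theta> R t))"

end

theory Submission
  imports Defs
begin

text \<open>
  On the sphere the cost has quadratic growth and is weakly quasi-convex within distance \<open>D\<close> of the
  minimizer, so an exact gradient step contracts the distance to it by \<open>sqrt \<sigma>\<close>. As the exponential
  map is nonexpansive in the relevant range, a gradient error of at most \<open>\<theta> R t\<close> adds no more than
  \<open>\<eta> \<theta> R t\<close> to the distance, and the parameters are tuned so that the distance still decays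
  geometrically, by the factor \<open>(1 + sqrt \<sigma>) / 2\<close>. The gradients are Lipschitz with respect to parallel
  transport, so the transported messages of one round are admissible references for decoding in the
  next. Finally \<open>1 - sqrt \<sigma>\<close> and \<open>\<theta>\<close> are of order \<open>cos D \<delta> \<eta>\<close>, which gives the number of rounds
  and the number of bits per round.
\<close>

section \<open>Inner products and symmetric matrices\<close>

text \<open>The radii close up through one inequality. Consecutive iterates lie within
  \<open>\<xi> ^ t * D\<close> of the target, hence at most \<open>2 * \<xi> ^ t * D\<close> apart,
  and a \<open>\<gamma>\<close>-Lipschitz gradient changes by at most \<open>s * R t\<close> between
  them; the factor \<open>K = 2 / s\<close> inside \<open>R\<close> is there for this identity.
  Adding the old error \<open>\<theta> * R t\<close> stays below
  \<open>R (Suc t) = \<xi> * R t\<close>, because \<open>\<theta> + s \<le> \<xi>\<close>. So the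
  ratio of decoding radius to accuracy is of order \<open>1 / \<theta>\<close> for every
  \<open>t > 0\<close>. In round 0 there is no earlier message, the radius is a crude gradient
  bound, and the ratio gains a factor \<open>1 / D\<close>; its logarithm is the only cost not
  proportional to the number of rounds. The geometry is reduced to explicit formulas:
  nonexpansiveness of the exponential map rests on the convexity of \<open>cos (sqrt s)\<close>, and
  parallel transport gets a closed form. Of the spectrum only Rayleigh bounds enter, for the local
  matrices and for the compression of \<open>A\<close> to the complement of its leading eigenvector;
  the latter is matched with \<open>es ! 1\<close> through characteristic polynomials.\<close>

lemma sp_add_left: "dim_vec u = dim_vec w \<Longrightarrow> dim_vec v = dim_vec w \<Longrightarrow> (u + v) \<bullet> w = u \<bullet> w + v \<bullet> (w :: real vec)"
  by (simp add: scalar_prod_def sum.distrib algebra_simps)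

lemma sp_add_right: "dim_vec u = dim_vec w \<Longrightarrow> dim_vec v = dim_vec w \<Longrightarrow> w \<bullet> (u + v) = w \<bullet> u + w \<bullet> (v :: real vec)"
  by (simp add: scalar_prod_def sum.distrib algebra_simps)

lemma sp_diff_left: "dim_vec u = dim_vec w \<Longrightarrow> dim_vec v = dim_vec w \<Longrightarrow> (u - v) \<bullet> w = u \<bullet> w - v \<bullet> (w :: real vec)"
  by (simp add: scalar_prod_def sum_subtractf algebra_simps)

lemma sp_diff_right: "dim_vec u = dim_vec w \<Longrightarrow> dim_vec v = dim_vec w \<Longrightarrow> w \<bullet> (u - v) = w \<bullet> u - w \<bullet> (v :: real vec)"
  by (simp add: scalar_prod_def sum_subtractf algebra_simps)

lemma sp_smult_left: "dim_vec u = dim_vec w \<Longrightarrow> (a \<cdot>\<^sub>v u) \<bullet> w = a * (u \<bullet> (w :: real vec))"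
  by (simp add: scalar_prod_def sum_distrib_left algebra_simps)

lemma sp_smult_right: "dim_vec u = dim_vec w \<Longrightarrow> w \<bullet> (a \<cdot>\<^sub>v u) = a * (w \<bullet> (u :: real vec))"
  by (simp add: scalar_prod_def sum_distrib_left algebra_simps)

lemma sp_uminus_left: "dim_vec u = dim_vec w \<Longrightarrow> (- u) \<bullet> w = - (u \<bullet> (w :: real vec))"
  by (simp add: scalar_prod_def sum_negf)

lemma sp_uminus_right: "dim_vec u = dim_vec w \<Longrightarrow> w \<bullet> (- u) = - (w \<bullet> (u :: real vec))"
  by (simp add: scalar_prod_def sum_negf)

lemmas sp_simps = sp_add_left sp_add_right sp_diff_left sp_diff_right
  sp_smult_left sp_smult_right sp_uminus_left sp_uminus_right

lemma sp_comm: "dim_vec u = dim_vec v \<Longrightarrow> u \<bullet> v = v \<bullet> (u :: real vec)"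
  by (simp add: scalar_prod_def mult.commute)

lemma sp_self_nonneg: "0 \<le> v \<bullet> (v :: real vec)"
  by (simp add: scalar_prod_def sum_nonneg)

lemma sp_self_eq_0: "v \<in> carrier_vec d \<Longrightarrow> v \<bullet> v = (0 :: real) \<longleftrightarrow> v = 0\<^sub>v d"
  by (auto simp: scalar_prod_def sum_nonneg_eq_0_iff intro!: eq_vecI)

lemma vnorm_nonneg [simp]: "0 \<le> vnorm v"
  by (simp add: vnorm_def sp_self_nonneg)

lemma vnorm_sq: "(vnorm v)\<^sup>2 = v \<bullet> v"
  by (simp add: vnorm_def sp_self_nonneg)

lemma vnorm_eq_0: "v \<in> carrier_vec d \<Longrightarrow> vnorm v = 0 \<longleftrightarrow> v = 0\<^sub>v d"
  by (simp add: vnorm_def sp_self_eq_0)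

lemma vnorm_le_iff: "0 \<le> c \<Longrightarrow> vnorm v \<le> c \<longleftrightarrow> v \<bullet> v \<le> c\<^sup>2"
  by (metis vnorm_sq vnorm_nonneg abs_le_square_iff abs_of_nonneg)

lemma vnorm_smult: "vnorm (a \<cdot>\<^sub>v v) = \<bar>a\<bar> * vnorm v"
proof -
  have "(a \<cdot>\<^sub>v v) \<bullet> (a \<cdot>\<^sub>v v) = a\<^sup>2 * (v \<bullet> v)"
    by (simp add: sp_simps power2_eq_square)
  then show ?thesis by (simp add: vnorm_def real_sqrt_mult)
qed

lemma vnorm_uminus [simp]: "vnorm (- v) = vnorm v"
  by (simp add: vnorm_def sp_simps)

text \<open>The minimum over \<open>t\<close> is attained at \<open>- b / c\<close>; for
  \<open>c = 0\<close> a nonnegative affine function must be constant. Bare coefficients are used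
  because Cauchy-Schwarz is derived from it twice, for the inner product and for semidefinite
  forms.\<close>

lemma nonneg_quadratic_imp_discriminant:
  fixes a b c :: real
  assumes "\<And>t. 0 \<le> a + 2 * b * t + c * t\<^sup>2" and "0 \<le> c"
  shows "b\<^sup>2 \<le> a * c"
proof (cases "c = 0")
  case True
  have "b = 0"
  proof (rule ccontr)
    assume "b \<noteq> 0"
    with assms(1)[of "- (a + 1) / (2 * b)"] True show False by (simp add: field_simps)
  qed
  then show ?thesis using True by simp
next
  case False
  then have c: "c > 0" using assms by simp
  have "0 \<le> a + 2 * b * (- b / c) + c * (- b / c)\<^sup>2" by (rule assms)
  also have "\<dots> = a - b\<^sup>2 / c" using c by (simp add: field_simps power2_eq_square)
  finally show ?thesis using c by (simp add: field_simps)
qed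

lemma cauchy_schwarz_sq:
  fixes u v :: "real vec"
  assumes "dim_vec u = dim_vec v"
  shows "(u \<bullet> v)\<^sup>2 \<le> (u \<bullet> u) * (v \<bullet> v)"
proof (rule nonneg_quadratic_imp_discriminant)
  fix t :: real
  have "0 \<le> (u + t \<cdot>\<^sub>v v) \<bullet> (u + t \<cdot>\<^sub>v v)" by (rule sp_self_nonneg)
  also have "\<dots> = u \<bullet> u + 2 * (u \<bullet> v) * t + (v \<bullet> v) * t\<^sup>2"
    using assms sp_comm[of u v] by (simp add: sp_simps algebra_simps power2_eq_square)
  finally show "0 \<le> u \<bullet> u + 2 * (u \<bullet> v) * t + (v \<bullet> v) * t\<^sup>2" .
qed (rule sp_self_nonneg)

lemma cauchy_schwarz: "dim_vec u = dim_vec v \<Longrightarrow> \<bar>u \<bullet> v\<bar> \<le> vnorm u * vnorm v"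
  using cauchy_schwarz_sq[of u v]
  by (metis abs_le_square_iff vnorm_sq power_mult_distrib abs_of_nonneg vnorm_nonneg mult_nonneg_nonneg)

lemma vnorm_triangle:
  assumes "dim_vec u = dim_vec v"
  shows "vnorm (u + v) \<le> vnorm u + vnorm v"
proof -
  have "(u + v) \<bullet> (u + v) = (vnorm u)\<^sup>2 + 2 * (u \<bullet> v) + (vnorm v)\<^sup>2"
    using assms sp_comm[of u v] by (simp add: sp_simps vnorm_sq)
  also have "\<dots> \<le> (vnorm u + vnorm v)\<^sup>2"
    using cauchy_schwarz[OF assms] by (simp add: power2_sum)
  finally show ?thesis by (simp add: vnorm_le_iff)
qed

lemma vnorm_diff_comm:
  assumes "dim_vec u = dim_vec v" shows "vnorm (u - v) = vnorm (v - u)"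
proof -
  have "u - v = - (v - u)" using assms by (intro eq_vecI) auto
  then show ?thesis by simp
qed

lemma vnorm_triangle_diff:
  assumes "dim_vec u = dim_vec v" "dim_vec w = dim_vec v"
  shows "vnorm (u - w) \<le> vnorm (u - v) + vnorm (v - w)"
proof -
  have "u - w = (u - v) + (v - w)" using assms by (intro eq_vecI) auto
  then show ?thesis using vnorm_triangle[of "u - v" "v - w"] assms by simp
qed

section \<open>Finite sums of vectors\<close>

definition vec_sum :: "nat \<Rightarrow> nat \<Rightarrow> (nat \<Rightarrow> real vec) \<Rightarrow> real vec" where
  "vec_sum d n h = vec d (\<lambda>k. \<Sum>i<n. h i $ k)"

lemma vec_sum_carrier [simp]: "vec_sum d n h \<in> carrier_vec d"
  by (simp add: vec_sum_def)

lemma dim_vec_sum [simp]: "dim_vec (vec_sum d n h) = d"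
  by (simp add: vec_sum_def)

lemma vec_sum_0: "vec_sum d 0 h = 0\<^sub>v d"
  by (auto simp: vec_sum_def intro!: eq_vecI)

lemma vec_sum_Suc: "h n \<in> carrier_vec d \<Longrightarrow> vec_sum d (Suc n) h = vec_sum d n h + h n"
  by (auto simp: vec_sum_def intro!: eq_vecI)

lemma vec_sum_diff:
  "(\<And>i. i < n \<Longrightarrow> h i \<in> carrier_vec d) \<Longrightarrow> (\<And>i. i < n \<Longrightarrow> h' i \<in> carrier_vec d) \<Longrightarrow>
    vec_sum d n h - vec_sum d n h' = vec_sum d n (\<lambda>i. h i - h' i)"
  by (rule eq_vecI) (simp_all add: vec_sum_def sum_subtractf[symmetric] carrier_vecD[of _ d])

lemma sp_vec_sum:
  "(\<And>i. i < n \<Longrightarrow> h i \<in> carrier_vec d) \<Longrightarrow> u \<in> carrier_vec d \<Longrightarrow> u \<bullet> vec_sum d n h = (\<Sum>i<n. u \<bullet> h i)"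
  by (induction n) (simp_all add: vec_sum_0 vec_sum_Suc sp_simps)

lemma vnorm_vec_sum_le:
  "(\<And>i. i < n \<Longrightarrow> h i \<in> carrier_vec d) \<Longrightarrow> vnorm (vec_sum d n h) \<le> (\<Sum>i<n. vnorm (h i))"
proof (induction n)
  case 0
  then show ?case by (simp add: vec_sum_0 vnorm_def)
next
  case (Suc n)
  have "vnorm (vec_sum d n h + h n) \<le> vnorm (vec_sum d n h) + vnorm (h n)"
    by (rule vnorm_triangle) (use Suc.prems[of n] in simp)
  then show ?case using Suc by (simp add: vec_sum_Suc)
qed

section \<open>Semidefinite forms and the largest eigenvalue\<close>

definition psd :: "nat \<Rightarrow> real mat \<Rightarrow> bool" where
  "psd d B \<longleftrightarrow> B \<in> carrier_mat d d \<and> B\<^sup>T = B \<and> (\<forall>x\<in>carrier_vec d. 0 \<le> x \<bullet> (B *\<^sub>v x))"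

lemma symmetric_mat_adjoint:
  fixes B :: "real mat"
  assumes "B \<in> carrier_mat d d" "B\<^sup>T = B" "x \<in> carrier_vec d" "y \<in> carrier_vec d"
  shows "y \<bullet> (B *\<^sub>v x) = x \<bullet> (B *\<^sub>v y)"
  using transpose_vec_mult_scalar[of B d d x y] assms sp_comm[of "B *\<^sub>v y" x]
  by simp

lemma mat_vec_smult: "B \<in> carrier_mat m d \<Longrightarrow> x \<in> carrier_vec d \<Longrightarrow> B *\<^sub>v (a \<cdot>\<^sub>v x) = a \<cdot>\<^sub>v (B *\<^sub>v (x :: real vec))"
  by (rule mult_mat_vec)

lemma mat_vec_add: "B \<in> carrier_mat m d \<Longrightarrow> x \<in> carrier_vec d \<Longrightarrow> y \<in> carrier_vec d \<Longrightarrow> B *\<^sub>v (x + y) = B *\<^sub>v x + B *\<^sub>v (y :: real vec)"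
  by (rule mult_add_distrib_mat_vec)

lemma mat_vec_diff: "B \<in> carrier_mat m d \<Longrightarrow> x \<in> carrier_vec d \<Longrightarrow> y \<in> carrier_vec d \<Longrightarrow> B *\<^sub>v (x - y) = B *\<^sub>v x - B *\<^sub>v (y :: real vec)"
  by (rule mult_minus_distrib_mat_vec)

lemma psd_cauchy_schwarz:
  assumes B: "psd d B" and xy: "x \<in> carrier_vec d" "y \<in> carrier_vec d"
  shows "(y \<bullet> (B *\<^sub>v x))\<^sup>2 \<le> (x \<bullet> (B *\<^sub>v x)) * (y \<bullet> (B *\<^sub>v y))"
proof (rule nonneg_quadratic_imp_discriminant)
  have Bc: "B \<in> carrier_mat d d" "B\<^sup>T = B" using B by (auto simp: psd_def)
  fix t :: real
  have "0 \<le> (x + t \<cdot>\<^sub>v y) \<bullet> (B *\<^sub>v (x + t \<cdot>\<^sub>v y))" using B xy by (simp add: psd_def)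
  also have "B *\<^sub>v (x + t \<cdot>\<^sub>v y) = B *\<^sub>v x + t \<cdot>\<^sub>v (B *\<^sub>v y)"
    using xy Bc by (simp add: mat_vec_add[of _ d d] mat_vec_smult[of _ d d])
  also have "(x + t \<cdot>\<^sub>v y) \<bullet> (B *\<^sub>v x + t \<cdot>\<^sub>v (B *\<^sub>v y)) =
     x \<bullet> (B *\<^sub>v x) + 2 * (y \<bullet> (B *\<^sub>v x)) * t + (y \<bullet> (B *\<^sub>v y)) * t\<^sup>2"
    using symmetric_mat_adjoint[of B d x y] Bc xy xy[THEN carrier_vecD]
    by (simp add: sp_simps algebra_simps power2_eq_square)
  finally show "0 \<le> x \<bullet> (B *\<^sub>v x) + 2 * (y \<bullet> (B *\<^sub>v x)) * t + (y \<bullet> (B *\<^sub>v y)) * t\<^sup>2" .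
  show "0 \<le> y \<bullet> (B *\<^sub>v y)" using B xy by (simp add: psd_def)
qed

text \<open>Cauchy-Schwarz for the form of \<open>B\<close>, applied to \<open>x\<close> and
  \<open>z = B x\<close>, bounds the square of \<open>z \<bullet> z\<close> by
  \<open>c * (x \<bullet> z) * (z \<bullet> z)\<close>, and one factor cancels. This is
  \<open>B^2 \<le> c B\<close> in the sense of forms, obtained without diagonalizing
  \<open>B\<close>.\<close>

lemma psd_mat_vec_sq_le:
  assumes B: "psd d B" and c: "\<And>y. y \<in> carrier_vec d \<Longrightarrow> y \<bullet> (B *\<^sub>v y) \<le> c * (y \<bullet> y)"
    and x: "x \<in> carrier_vec d" and "0 \<le> c"
  shows "(B *\<^sub>v x) \<bullet> (B *\<^sub>v x) \<le> c * (x \<bullet> (B *\<^sub>v x))"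
proof -
  have Bc: "B \<in> carrier_mat d d" using B by (auto simp: psd_def)
  define z where "z = B *\<^sub>v x"
  have z: "z \<in> carrier_vec d" using Bc x by (simp add: z_def)
  have xp: "0 \<le> x \<bullet> z" using B x by (simp add: psd_def z_def)
  have "(z \<bullet> z)\<^sup>2 \<le> (x \<bullet> z) * (z \<bullet> (B *\<^sub>v z))"
    using psd_cauchy_schwarz[OF B x z] by (simp add: z_def)
  also have "\<dots> \<le> (x \<bullet> z) * (c * (z \<bullet> z))" by (intro mult_left_mono c z xp)
  finally have *: "(z \<bullet> z) * (z \<bullet> z) \<le> (c * (x \<bullet> z)) * (z \<bullet> z)"
    by (simp add: power2_eq_square algebra_simps)
  show ?thesis
  proof (cases "z \<bullet> z = 0")
    case True
    then show ?thesis using xp \<open>0 \<le> c\<close> by (simp add: z_def[symmetric])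
  next
    case False
    then have "z \<bullet> z > 0" using sp_self_nonneg[of z] by simp
    then show ?thesis using * by (simp add: z_def[symmetric])
  qed
qed

lemma mat_vec_bounded:
  fixes B :: "real mat"
  assumes B: "B \<in> carrier_mat m d"
  obtains c where "c > 0" "\<And>x. x \<in> carrier_vec d \<Longrightarrow> (B *\<^sub>v x) \<bullet> (B *\<^sub>v x) \<le> c * (x \<bullet> x)"
proof -
  \<comment> \<open>The squared Frobenius norm; 1 is added to it below so that the constant is
    positive for the zero matrix too.\<close>
  define c where "c = (\<Sum>i<m. row B i \<bullet> row B i)"
  have c0: "0 \<le> c" by (simp add: c_def sum_nonneg sp_self_nonneg)
  have "(B *\<^sub>v x) \<bullet> (B *\<^sub>v x) \<le> (c + 1) * (x \<bullet> x)" if x: "x \<in> carrier_vec d" for x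
  proof -
    have "(B *\<^sub>v x) \<bullet> (B *\<^sub>v x) = (\<Sum>i<m. (row B i \<bullet> x)\<^sup>2)"
      using B by (simp add: scalar_prod_def[of "B *\<^sub>v x"] power2_eq_square lessThan_atLeast0)
    also have "\<dots> \<le> (\<Sum>i<m. (row B i \<bullet> row B i) * (x \<bullet> x))"
      by (intro sum_mono cauchy_schwarz_sq) (use B x in simp)
    also have "\<dots> = c * (x \<bullet> x)" by (simp add: c_def sum_distrib_right)
    also have "\<dots> \<le> (c + 1) * (x \<bullet> x)" using sp_self_nonneg[of x] by (simp add: algebra_simps)
    finally show ?thesis .
  qed
  then show thesis using that[of "c + 1"] c0 by simp
qed

text \<open>
  The optimal constant \<open>t\<close> makes \<open>t I - B\<close> positive semidefinite. Were it invertible, it would be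
  bounded below by a positive multiple of the identity, and \<open>t\<close> could be lowered. This avoids the
  spectral theorem.
\<close>

lemma rayleigh_max_eigenvalue:
  fixes B :: "real mat"
  assumes B: "B \<in> carrier_mat d d" "B\<^sup>T = B" and d: "0 < d"
  obtains e where "eigenvalue B e" "\<And>x. x \<in> carrier_vec d \<Longrightarrow> x \<bullet> (B *\<^sub>v x) \<le> e * (x \<bullet> x)"
proof -
  define S where "S = {t. \<forall>x\<in>carrier_vec d. x \<bullet> (B *\<^sub>v x) \<le> t * (x \<bullet> x)}"
  obtain c where c: "c > 0" "\<And>x. x \<in> carrier_vec d \<Longrightarrow> (B *\<^sub>v x) \<bullet> (B *\<^sub>v x) \<le> c * (x \<bullet> x)"
    using mat_vec_bounded[OF B(1)] by blast
  \<comment> \<open>Any crude upper bound of the form shows that \<open>S\<close> is inhabited;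
    expanding the squared norm of \<open>x - B x\<close> gives one.\<close>
  have "1 + c \<in> S"
    unfolding S_def
  proof (intro CollectI ballI)
    fix x :: "real vec" assume x: "x \<in> carrier_vec d"
    have "0 \<le> (x - B *\<^sub>v x) \<bullet> (x - B *\<^sub>v x)" by (rule sp_self_nonneg)
    also have "\<dots> = x \<bullet> x - 2 * (x \<bullet> (B *\<^sub>v x)) + (B *\<^sub>v x) \<bullet> (B *\<^sub>v x)"
      using x B carrier_matD[of B d d] sp_comm[of "B *\<^sub>v x" x] by (simp add: sp_simps)
    finally have "2 * (x \<bullet> (B *\<^sub>v x)) \<le> x \<bullet> x + c * (x \<bullet> x)" using c(2)[OF x] by simp
    moreover have "0 \<le> x \<bullet> x + c * (x \<bullet> x)" using sp_self_nonneg[of x] c(1) by simp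
    ultimately show "x \<bullet> (B *\<^sub>v x) \<le> (1 + c) * (x \<bullet> x)" by (simp add: distrib_right)
  qed
  then have ne: "S \<noteq> {}" by auto
  have lower: "unit_vec d 0 \<bullet> (B *\<^sub>v unit_vec d 0) \<le> t" if "t \<in> S" for t
  proof -
    have "unit_vec d 0 \<bullet> (B *\<^sub>v unit_vec d 0) \<le> t * (unit_vec d 0 \<bullet> unit_vec d 0)"
      using that by (simp add: S_def)
    then show ?thesis using d by simp
  qed
  have bdd: "bdd_below S" using lower by (meson bdd_belowI)
  define t where "t = Inf S"
  have tS: "t \<in> S"
    unfolding S_def
  proof (intro CollectI ballI)
    fix x :: "real vec" assume x: "x \<in> carrier_vec d"
    show "x \<bullet> (B *\<^sub>v x) \<le> t * (x \<bullet> x)"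
    proof (cases "x \<bullet> x = 0")
      case True
      then have "x = 0\<^sub>v d" using x by (simp add: sp_self_eq_0)
      then show ?thesis using B by simp
    next
      case False
      then have xx: "x \<bullet> x > 0" using sp_self_nonneg[of x] by simp
      have "(x \<bullet> (B *\<^sub>v x)) / (x \<bullet> x) \<le> t"
        unfolding t_def
      proof (rule cInf_greatest[OF ne])
        fix s assume "s \<in> S"
        then have "x \<bullet> (B *\<^sub>v x) \<le> s * (x \<bullet> x)" using x by (simp add: S_def)
        then show "(x \<bullet> (B *\<^sub>v x)) / (x \<bullet> x) \<le> s" using xx by (simp add: field_simps)
      qed
      then show ?thesis using xx by (simp add: field_simps)
    qed
  qed
  define N where "N = t \<cdot>\<^sub>m 1\<^sub>m d - B"
  have Nc: "N \<in> carrier_mat d d" using B by (intro carrier_matI) (auto simp: N_def)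
  have Nv: "N *\<^sub>v x = t \<cdot>\<^sub>v x - B *\<^sub>v x" if "x \<in> carrier_vec d" for x
  proof -
    have "(t \<cdot>\<^sub>m 1\<^sub>m d) *\<^sub>v x = t \<cdot>\<^sub>v x"
      using that by (intro eq_vecI) (auto simp: row_smult row_one)
    then show ?thesis using that B by (simp add: N_def minus_mult_distrib_mat_vec[of _ d d])
  qed
  have Nq: "x \<bullet> (N *\<^sub>v x) = t * (x \<bullet> x) - x \<bullet> (B *\<^sub>v x)" if "x \<in> carrier_vec d" for x
    using that B carrier_matD[of B d d] by (simp add: Nv sp_simps)
  have Nsym: "N\<^sup>T = N"
  proof (rule eq_matI)
    fix i j assume "i < dim_row N" "j < dim_col N"
    then have ij: "i < d" "j < d" using Nc by auto
    have "B $$ (j, i) = B\<^sup>T $$ (i, j)" using ij B(1) by simp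
    then have "B $$ (j, i) = B $$ (i, j)" using B(2) by simp
    then show "N\<^sup>T $$ (i, j) = N $$ (i, j)" using ij B(1) by (auto simp: N_def)
  qed (use Nc in auto)
  have Npsd: "psd d N" using Nc Nsym tS by (auto simp: psd_def S_def Nq)
  have "det N = 0"
  proof (rule ccontr)
    assume "det N \<noteq> 0"
    then obtain P where P: "P \<in> carrier_mat d d" "P * N = 1\<^sub>m d"
      using det_non_zero_imp_unit[OF Nc] by (auto simp: Units_def ring_mat_def)
    obtain p where p: "p > 0" "\<And>x. x \<in> carrier_vec d \<Longrightarrow> (P *\<^sub>v x) \<bullet> (P *\<^sub>v x) \<le> p * (x \<bullet> x)"
      using mat_vec_bounded[OF P(1)] by blast
    define q where "q = \<bar>t\<bar> + 1 + c"
    have q: "q > 0" using c by (simp add: q_def)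
    have qb: "x \<bullet> (N *\<^sub>v x) \<le> q * (x \<bullet> x)" if x: "x \<in> carrier_vec d" for x
    proof -
      have "0 \<le> (x + B *\<^sub>v x) \<bullet> (x + B *\<^sub>v x)" by (rule sp_self_nonneg)
      also have "\<dots> = x \<bullet> x + 2 * (x \<bullet> (B *\<^sub>v x)) + (B *\<^sub>v x) \<bullet> (B *\<^sub>v x)"
        using x B carrier_matD[of B d d] sp_comm[of "B *\<^sub>v x" x] by (simp add: sp_simps)
      finally have 1: "- 2 * (x \<bullet> (B *\<^sub>v x)) \<le> x \<bullet> x + c * (x \<bullet> x)" using c(2)[OF x] by simp
      have 2: "0 \<le> x \<bullet> x + c * (x \<bullet> x)" using sp_self_nonneg[of x] c(1) by simp
      have 3: "t * (x \<bullet> x) \<le> \<bar>t\<bar> * (x \<bullet> x)"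
        by (rule mult_right_mono) (auto simp: sp_self_nonneg)
      show ?thesis using 1 2 3 by (simp add: Nq[OF x] q_def distrib_right)
    qed
    \<comment> \<open>As \<open>P\<close> inverts \<open>N\<close>, \<open>x \<bullet> x\<close> is
      at most \<open>p\<close> times the squared norm of \<open>N x\<close>, and that is at most
      \<open>q\<close> times the form of \<open>N\<close> by \<open>psd_mat_vec_sq_le\<close>. So
      \<open>N\<close> dominates \<open>1 / (p * q)\<close> times the identity.\<close>
    have "t - 1 / (p * q) \<in> S"
      unfolding S_def
    proof (intro CollectI ballI)
      fix x :: "real vec" assume x: "x \<in> carrier_vec d"
      have Nx: "N *\<^sub>v x \<in> carrier_vec d" using Nc x by simp
      have "P *\<^sub>v (N *\<^sub>v x) = x"
        using P x Nc by (metis assoc_mult_mat_vec one_mult_mat_vec)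
      then have "x \<bullet> x \<le> p * ((N *\<^sub>v x) \<bullet> (N *\<^sub>v x))" using p(2)[OF Nx] by simp
      also have "\<dots> \<le> p * (q * (x \<bullet> (N *\<^sub>v x)))"
        using psd_mat_vec_sq_le[OF Npsd qb x] p q by (intro mult_left_mono) auto
      finally have "x \<bullet> x \<le> (p * q) * (t * (x \<bullet> x) - x \<bullet> (B *\<^sub>v x))"
        by (simp add: Nq[OF x] algebra_simps)
      then have "(x \<bullet> x) / (p * q) \<le> t * (x \<bullet> x) - x \<bullet> (B *\<^sub>v x)"
        using p q by (simp add: divide_le_eq mult.commute)
      then show "x \<bullet> (B *\<^sub>v x) \<le> (t - 1 / (p * q)) * (x \<bullet> x)"
        by (simp add: left_diff_distrib)
    qed
    then have "t \<le> t - 1 / (p * q)" unfolding t_def by (intro cInf_lower bdd)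
    then show False using p q by (simp add: field_simps)
  qed
  moreover have "char_matrix B t = (- 1) \<cdot>\<^sub>m N"
    using B by (intro eq_matI) (auto simp: char_matrix_def N_def)
  ultimately have "det (char_matrix B t) = 0" by simp
  then have "eigenvalue B t" using eigenvalue_det[OF B(1)] by simp
  then show thesis using that tS by (auto simp: S_def)
qed

lemma finite_eigenvalues:
  fixes B :: "real mat"
  assumes B: "B \<in> carrier_mat d d"
  shows "finite {e. eigenvalue B e}"
proof -
  have "char_poly B \<noteq> 0" using degree_monic_char_poly[OF B] by auto
  then show ?thesis using poly_roots_finite[of "char_poly B"] eigenvalue_root_char_poly[OF B] by simp
qed

lemma rayleigh_le_lambda_max:
  assumes B: "B \<in> carrier_mat d d" "B\<^sup>T = B" and d: "0 < d" and x: "x \<in> carrier_vec d"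
  shows "x \<bullet> (B *\<^sub>v x) \<le> lambda_max B * (x \<bullet> x)"
proof -
  obtain e where e: "eigenvalue B e" "\<And>x. x \<in> carrier_vec d \<Longrightarrow> x \<bullet> (B *\<^sub>v x) \<le> e * (x \<bullet> x)"
    using rayleigh_max_eigenvalue[OF B d] by blast
  have "e \<le> lambda_max B"
    unfolding lambda_max_def using e(1) finite_eigenvalues[OF B(1)] by simp
  then show ?thesis using e(2)[OF x] mult_right_mono[OF _ sp_self_nonneg] by (meson order_trans)
qed

section \<open>Geometry of the sphere\<close>

lemma sinc_antimono:
  fixes r s :: real
  assumes "0 < r" "r \<le> s" "s \<le> pi"
  shows "sin s / s \<le> sin r / r"
proof (rule DERIV_nonpos_imp_nonincreasing[where f = "\<lambda>t. sin t / t", OF assms(2)])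
  fix t assume t: "r \<le> t" "t \<le> s"
  define k :: "real \<Rightarrow> real" where "k = (\<lambda>t. t * cos t - sin t)"
  have "k t \<le> k 0"
  proof (rule DERIV_nonpos_imp_nonincreasing[where f = k])
    show "0 \<le> t" using t assms by simp
    fix u assume u: "0 \<le> u" "u \<le> t"
    have "(k has_real_derivative - (u * sin u)) (at u)"
      unfolding k_def by (auto intro!: derivative_eq_intros)
    moreover have "- (u * sin u) \<le> 0" using u t assms sin_ge_zero[of u] by simp
    ultimately show "\<exists>y. (k has_real_derivative y) (at u) \<and> y \<le> 0" by blast
  qed
  then have "(cos t * t - sin t) / (t * t) \<le> 0"
    by (intro divide_nonpos_nonneg) (auto simp: k_def mult.commute)
  moreover have "((\<lambda>t. sin t / t) has_real_derivative (cos t * t - sin t) / (t * t)) (at t)"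
    using t assms by (auto intro!: derivative_eq_intros)
  ultimately show "\<exists>y. ((\<lambda>t. sin t / t) has_real_derivative y) (at t) \<and> y \<le> 0" by blast
qed

text \<open>By \<open>sinc_antimono\<close> the quotient \<open>sin r / r\<close> is smallest at
  \<open>pi / 2\<close>, where it equals \<open>2 / pi\<close>. The rounded constant 1/2 is the
  origin of the factor 1/4 in the quadratic growth of the cost.\<close>

lemma half_le_sin:
  fixes r :: real
  assumes "0 \<le> r" "r \<le> pi / 2"
  shows "r / 2 \<le> sin r"
proof (cases "r = 0")
  case False
  then have "1 / (pi / 2) \<le> sin r / r"
    using sinc_antimono[of r "pi / 2"] assms by simp
  moreover have "1 / 2 \<le> 1 / (pi / 2)" using pi_less_4 by (simp add: field_simps)
  ultimately have "1 / 2 \<le> sin r / r" by linarith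
  then show ?thesis using False assms by (simp add: field_simps)
qed simp

text \<open>Convexity of \<open>cos (sqrt s)\<close>: its derivative is
  \<open>- sin r / (2 * r)\<close> at \<open>r = sqrt s\<close>, which increases by
  \<open>sinc_antimono\<close>. The mean value theorem on the two subintervals compares the slopes
  and asks only for continuity at 0, where \<open>sqrt\<close> is not differentiable.\<close>

lemma cos_sqrt_convex:
  fixes s0 s s1 :: real
  assumes "0 \<le> s0" "s0 \<le> s" "s \<le> s1" "s1 \<le> pi\<^sup>2"
  shows "(s1 - s0) * cos (sqrt s) \<le> (s1 - s) * cos (sqrt s0) + (s - s0) * cos (sqrt s1)"
proof (cases "s0 = s \<or> s = s1")
  case True
  then show ?thesis by (auto simp: algebra_simps)
next
  case False
  then have lt: "s0 < s" "s < s1" using assms by auto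
  define h where "h = (\<lambda>s. cos (sqrt s))"
  define h' where "h' = (\<lambda>s. - (sin (sqrt s) / sqrt s) / 2)"
  have der: "(h has_real_derivative h' t) (at t)" if "0 < t" for t
    unfolding h_def h'_def using that
    by (auto intro!: derivative_eq_intros simp: field_simps)
  have cont: "continuous_on X h" for X unfolding h_def by (intro continuous_intros)
  have diff: "h differentiable (at t)" if "0 < t" for t
    using der[OF that] real_differentiable_def by blast
  obtain l0 z0 where z0: "s0 < z0" "z0 < s" "DERIV h z0 :> l0" "h s - h s0 = (s - s0) * l0"
    using MVT[OF lt(1) cont] diff assms by (metis order_le_less_trans)
  obtain l1 z1 where z1: "s < z1" "z1 < s1" "DERIV h z1 :> l1" "h s1 - h s = (s1 - s) * l1"
    using MVT[OF lt(2) cont] diff assms lt by (metis order_le_less_trans less_trans)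
  have l: "l0 = h' z0" "l1 = h' z1"
    using DERIV_unique[OF z0(3) der] DERIV_unique[OF z1(3) der] z0 z1 assms by auto
  have "sqrt z1 \<le> pi" using z1 assms by (intro real_le_lsqrt) auto
  then have "l0 \<le> l1"
    unfolding l h'_def using sinc_antimono[of "sqrt z0" "sqrt z1"] z0 z1 assms by simp
  then have "(s1 - s) * ((s - s0) * l0) \<le> (s - s0) * ((s1 - s) * l1)"
    using lt by (simp add: mult.left_commute)
  then have "(s1 - s) * (h s - h s0) \<le> (s - s0) * (h s1 - h s)" using z0 z1 by simp
  then show ?thesis by (simp add: h_def algebra_simps)
qed

text \<open>
  Both sides agree for \<open>c = 1\<close> and \<open>c = -1\<close>; the left one is convex and the right one affine in \<open>c\<close>.
\<close>

lemma cos_law_comparison: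
  fixes a b c :: real
  assumes ab: "0 \<le> a" "0 \<le> b" "a + b \<le> pi" and c: "\<bar>c\<bar> \<le> 1"
  shows "cos (sqrt (a\<^sup>2 + b\<^sup>2 - 2 * a * b * c)) \<le> cos a * cos b + c * (sin a * sin b)"
proof (cases "a = 0 \<or> b = 0")
  case True
  then show ?thesis using ab by auto
next
  case False
  then have pos: "0 < a * b" using ab by simp
  define s where "s = a\<^sup>2 + b\<^sup>2 - 2 * a * b * c"
  have s0: "s - (a - b)\<^sup>2 = 2 * (a * b) * (1 - c)" and s1: "(a + b)\<^sup>2 - s = 2 * (a * b) * (1 + c)"
    by (simp_all add: s_def power2_eq_square algebra_simps)
  have "0 \<le> s - (a - b)\<^sup>2" "0 \<le> (a + b)\<^sup>2 - s"
    unfolding s0 s1 using pos c by (auto intro!: mult_nonneg_nonneg)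
  moreover have "(a + b)\<^sup>2 \<le> pi\<^sup>2" using ab by (intro power_mono) auto
  ultimately have "((a + b)\<^sup>2 - (a - b)\<^sup>2) * cos (sqrt s) \<le>
      ((a + b)\<^sup>2 - s) * cos (sqrt ((a - b)\<^sup>2)) + (s - (a - b)\<^sup>2) * cos (sqrt ((a + b)\<^sup>2))"
    by (intro cos_sqrt_convex) auto
  also have "(a + b)\<^sup>2 - (a - b)\<^sup>2 = 2 * (a * b) * 2"
    by (simp add: power2_eq_square algebra_simps)
  also have "cos (sqrt ((a - b)\<^sup>2)) = cos a * cos b + sin a * sin b"
    by (simp add: cos_diff)
  also have "cos (sqrt ((a + b)\<^sup>2)) = cos a * cos b - sin a * sin b"
    by (simp add: cos_add)
  finally have "2 * (a * b) * (2 * cos (sqrt s)) \<le>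
      2 * (a * b) * (2 * (cos a * cos b + c * (sin a * sin b)))"
    unfolding s0 s1 by (simp add: algebra_simps)
  then have "2 * cos (sqrt s) \<le> 2 * (cos a * cos b + c * (sin a * sin b))"
    by (rule mult_left_le_imp_le) (use pos in simp)
  then show ?thesis by (simp add: s_def)
qed

section \<open>Distance, exponential map and logarithm\<close>

lemma unit_sphere_iff: "x \<in> unit_sphere d \<longleftrightarrow> x \<in> carrier_vec d \<and> x \<bullet> x = 1"
  by (auto simp: unit_sphere_def vnorm_def)

lemma unit_sphereD: "x \<in> unit_sphere d \<Longrightarrow> x \<in> carrier_vec d" "x \<in> unit_sphere d \<Longrightarrow> dim_vec x = d"
  "x \<in> unit_sphere d \<Longrightarrow> x \<bullet> x = 1"
  by (auto simp: unit_sphere_iff)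

lemma unit_sphere_sp_bound:
  assumes "x \<in> unit_sphere d" "y \<in> unit_sphere d"
  shows "\<bar>x \<bullet> y\<bar> \<le> 1"
  using cauchy_schwarz[of x y] assms by (auto simp: unit_sphere_def)

lemma sph_dist_bounds:
  assumes "x \<in> unit_sphere d" "y \<in> unit_sphere d"
  shows "0 \<le> sph_dist x y" "sph_dist x y \<le> pi" "cos (sph_dist x y) = x \<bullet> y"
  using unit_sphere_sp_bound[OF assms] arccos[of "x \<bullet> y"] by (auto simp: sph_dist_def)

lemma sph_dist_comm: "x \<in> unit_sphere d \<Longrightarrow> y \<in> unit_sphere d \<Longrightarrow> sph_dist x y = sph_dist y x"
  by (simp add: sph_dist_def sp_comm[of x y] unit_sphereD)

text \<open>Angles are compared through their cosines, which is faithful only up to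
  \<open>pi\<close>; hence the guarded premise. For larger \<open>r\<close> the diameter of the
  sphere settles the claim.\<close>

lemma sph_dist_le:
  assumes "x \<in> unit_sphere d" "y \<in> unit_sphere d" "0 \<le> r" "r \<le> pi \<Longrightarrow> cos r \<le> x \<bullet> y"
  shows "sph_dist x y \<le> r"
proof (cases "r \<le> pi")
  case True
  then have "arccos (x \<bullet> y) \<le> arccos (cos r)"
    using assms(4) unit_sphere_sp_bound[OF assms(1,2)] by (intro arccos_le_arccos) auto
  then show ?thesis using True assms by (simp add: sph_dist_def arccos_cos)
next
  case False
  then show ?thesis using sph_dist_bounds(2)[OF assms(1,2)] by simp
qed

text \<open>The parts of \<open>p\<close> and \<open>r\<close> orthogonal to \<open>q\<close> have
  lengths \<open>sin a\<close> and \<open>sin b\<close>. Cauchy-Schwarz for them gives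
  \<open>p \<bullet> r \<ge> cos a * cos b - sin a * sin b\<close>, which is
  \<open>cos (a + b)\<close>.\<close>

lemma sph_dist_triangle:
  assumes p: "p \<in> unit_sphere d" and q: "q \<in> unit_sphere d" and r: "r \<in> unit_sphere d"
  shows "sph_dist p r \<le> sph_dist p q + sph_dist q r"
proof (rule sph_dist_le[OF p r])
  define a b where "a = sph_dist p q" and "b = sph_dist q r"
  note dims = unit_sphereD(2)[OF p] unit_sphereD(2)[OF q] unit_sphereD(2)[OF r]
  have a: "0 \<le> a" "a \<le> pi" "p \<bullet> q = cos a" and b: "0 \<le> b" "b \<le> pi" "q \<bullet> r = cos b"
    using sph_dist_bounds[OF p q] sph_dist_bounds[OF q r] by (auto simp: a_def b_def)
  show "0 \<le> sph_dist p q + sph_dist q r" using a b by (simp add: a_def b_def)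
  define u v where "u = p - cos a \<cdot>\<^sub>v q" and "v = r - cos b \<cdot>\<^sub>v q"
  have uu: "u \<bullet> u = (sin a)\<^sup>2" and vv: "v \<bullet> v = (sin b)\<^sup>2" and uv: "u \<bullet> v = p \<bullet> r - cos a * cos b"
    using p q r a b dims sp_comm[of q p] sp_comm[of r q]
    by (auto simp: u_def v_def sp_simps unit_sphereD sin_squared_eq power2_eq_square algebra_simps)
  have "\<bar>u \<bullet> v\<bar> \<le> vnorm u * vnorm v" by (rule cauchy_schwarz) (simp add: u_def v_def dims)
  also have "\<dots> = sin a * sin b" using a b by (simp add: vnorm_def uu vv sin_ge_zero)
  finally show "cos (sph_dist p q + sph_dist q r) \<le> p \<bullet> r"
    by (simp add: uv cos_add a_def[symmetric] b_def[symmetric])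
qed

lemma sph_exp_carrier:
  "x \<in> carrier_vec d \<Longrightarrow> u \<in> carrier_vec d \<Longrightarrow> sph_exp x u \<in> carrier_vec d"
  by (simp add: sph_exp_def)

text \<open>The spherical law of cosines; the quotient is the cosine of the angle at
  \<open>x\<close>. If one of the vectors is zero, both the quotient and the product of the sines
  are 0, so no case distinction is required.\<close>

lemma sp_sph_exp:
  assumes x: "x \<in> unit_sphere d" and u: "u \<in> carrier_vec d" "x \<bullet> u = 0"
    and v: "v \<in> carrier_vec d" "x \<bullet> v = 0"
  shows "sph_exp x u \<bullet> sph_exp x v =
    cos (vnorm u) * cos (vnorm v) + (u \<bullet> v) / (vnorm u * vnorm v) * (sin (vnorm u) * sin (vnorm v))"
  using assms unit_sphereD(2,3)[OF x] u(1)[THEN carrier_vecD] v(1)[THEN carrier_vecD] sp_comm[of u x]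
  by (simp add: sph_exp_def sp_simps mult_ac)

lemma sph_exp_unit_sphere:
  assumes x: "x \<in> unit_sphere d" and u: "u \<in> carrier_vec d" "x \<bullet> u = 0"
  shows "sph_exp x u \<in> unit_sphere d"
proof -
  have "sph_exp x u \<bullet> sph_exp x u = 1"
  proof (cases "vnorm u = 0")
    case True
    then show ?thesis using sp_sph_exp[OF x u u] by simp
  next
    case False
    then have "(u \<bullet> u) / (vnorm u * vnorm u) = 1" by (simp add: vnorm_sq[symmetric] power2_eq_square)
    then have "sph_exp x u \<bullet> sph_exp x u = cos (vnorm u) * cos (vnorm u) + sin (vnorm u) * sin (vnorm u)"
      by (simp only: sp_sph_exp[OF x u u] mult_1)
    then show ?thesis by (simp only: sin_cos_squared_add3)
  qed
  then show ?thesis using x u by (simp add: unit_sphere_iff sph_exp_carrier)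
qed

text \<open>Comparison in positive curvature: in a spherical triangle with apex \<open>x\<close> the
  third side is at most the Euclidean one for the same two sides and angle. The bound on the lengths
  is the range of \<open>cos_law_comparison\<close>.\<close>

lemma sph_exp_nonexpansive:
  assumes x: "x \<in> unit_sphere d" and u: "u \<in> carrier_vec d" "x \<bullet> u = 0"
    and v: "v \<in> carrier_vec d" "x \<bullet> v = 0" and le: "vnorm u + vnorm v \<le> pi"
  shows "sph_dist (sph_exp x u) (sph_exp x v) \<le> vnorm (u - v)"
proof (rule sph_dist_le)
  define a b where "a = vnorm u" and "b = vnorm v"
  have dims: "dim_vec u = dim_vec v" using u v by simp
  define c where "c = (u \<bullet> v) / (a * b)"
  have cs: "\<bar>u \<bullet> v\<bar> \<le> a * b" using cauchy_schwarz[OF dims] by (simp add: a_def b_def)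
  have ab: "0 \<le> a * b" by (simp add: a_def b_def)
  then have c1: "\<bar>c\<bar> \<le> 1" using cs by (cases "a * b = 0") (auto simp: c_def abs_divide divide_le_eq abs_mult[symmetric])
  have uv: "u \<bullet> v = a * b * c" using cs by (cases "a * b = 0") (auto simp: c_def)
  have "(u - v) \<bullet> (u - v) = a\<^sup>2 + b\<^sup>2 - 2 * a * b * c"
    using dims sp_comm[of v u] by (simp add: sp_simps a_def b_def vnorm_sq uv[unfolded a_def b_def])
  then have "cos (vnorm (u - v)) \<le> cos a * cos b + c * (sin a * sin b)"
    using cos_law_comparison[of a b c] c1 le by (simp add: vnorm_def[of "u - v"] a_def b_def)
  then show "cos (vnorm (u - v)) \<le> sph_exp x u \<bullet> sph_exp x v"
    by (simp add: sp_sph_exp[OF x u v] c_def a_def b_def)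
qed (use assms in \<open>auto intro: sph_exp_unit_sphere\<close>)

text \<open>Below length \<open>pi\<close> the sine in the exponential is positive and can be
  divided out; at length 0 both sides vanish. The right-hand side sees \<open>v\<close> only through
  its length and the endpoint, so the initial velocity of a minimizing geodesic is unique.\<close>

lemma sph_log_unique:
  assumes x: "x \<in> unit_sphere d" and v: "v \<in> carrier_vec d" and "vnorm v < pi"
  shows "v = (vnorm v / sin (vnorm v)) \<cdot>\<^sub>v (sph_exp x v - cos (vnorm v) \<cdot>\<^sub>v x)"
proof (cases "vnorm v = 0")
  case True
  then have "v = 0\<^sub>v d" using v vnorm_eq_0 by blast
  then show ?thesis using True x by (intro eq_vecI) (auto simp: unit_sphereD sph_exp_def)
next
  case False
  then have "vnorm v > 0" using vnorm_nonneg[of v] by linarith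
  then have "sin (vnorm v) > 0" using assms(3) by (intro sin_gt_zero) auto
  then show ?thesis using v x False
    by (intro eq_vecI) (auto simp: sph_exp_def unit_sphereD)
qed

lemma sph_log_exists:
  assumes x: "x \<in> unit_sphere d" and y: "y \<in> unit_sphere d" and ne: "sph_dist x y < pi"
  obtains v where "v \<in> carrier_vec d" "x \<bullet> v = 0" "vnorm v = sph_dist x y" "sph_exp x v = y"
proof -
  define a where "a = sph_dist x y"
  have a: "0 \<le> a" "a < pi" "x \<bullet> y = cos a" using sph_dist_bounds[OF x y] ne by (auto simp: a_def)
  note dims = unit_sphereD(2)[OF x] unit_sphereD(2)[OF y]
  define w where "w = y - cos a \<cdot>\<^sub>v x"
  have w: "w \<in> carrier_vec d" "x \<bullet> w = 0" "w \<bullet> w = (sin a)\<^sup>2"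
    using x y a dims sp_comm[of y x]
    by (auto simp: w_def sp_simps unit_sphereD sin_squared_eq power2_eq_square[of "cos a"])
  \<comment> \<open>\<open>w\<close> is the part of \<open>y\<close> orthogonal to \<open>x\<close>
    and has length \<open>sin a\<close>. For \<open>a = 0\<close> the factor is
    \<open>0 / 0 = 0\<close>, as it should be.\<close>
  define v where "v = (a / sin a) \<cdot>\<^sub>v w"
  have wn: "vnorm w = sin a" using a w(3) by (simp add: vnorm_def sin_ge_zero)
  have vn: "vnorm v = a"
  proof (cases "a = 0")
    case False
    then have "sin a > 0" using a by (intro sin_gt_zero) auto
    then show ?thesis using a by (simp add: v_def vnorm_smult wn)
  qed (simp add: v_def vnorm_smult)
  have "sph_exp x v = y"
  proof (cases "a = 0")
    case True
    then have "w = 0\<^sub>v d" using w by (simp add: sp_self_eq_0)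
    then have "y $ i = x $ i" if "i < d" for i
    proof -
      have "w $ i = y $ i - x $ i" using that dims True by (simp add: w_def)
      then show ?thesis using \<open>w = 0\<^sub>v d\<close> that by simp
    qed
    then show ?thesis using True dims w(1)
      by (intro eq_vecI) (auto simp: sph_exp_def vn, auto simp: v_def)
  next
    case False
    then have "sin a > 0" using a by (intro sin_gt_zero) auto
    then show ?thesis using False dims
      by (intro eq_vecI) (auto simp: sph_exp_def vn, auto simp: v_def w_def)
  qed
  moreover have "x \<bullet> v = 0" using w dims by (simp add: v_def sp_simps)
  ultimately show thesis using that[of v] vn w by (auto simp: a_def v_def)
qed

section \<open>Parallel transport\<close>

text \<open>A closed form of \<open>parallel_transport\<close>, see \<open>parallel_transport_eq\<close>; it requires \<open>y \<noteq> - x\<close>.\<close>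

definition sph_transport :: "real vec \<Rightarrow> real vec \<Rightarrow> real vec \<Rightarrow> real vec" where
  "sph_transport x y u = u - ((y \<bullet> u) / (1 + x \<bullet> y)) \<cdot>\<^sub>v (x + y)"

lemma sph_transport_carrier:
  "x \<in> carrier_vec d \<Longrightarrow> y \<in> carrier_vec d \<Longrightarrow> u \<in> carrier_vec d \<Longrightarrow> sph_transport x y u \<in> carrier_vec d"
  by (simp add: sph_transport_def)

text \<open>The squared distance \<open>h\<close> of the two fields is constant: the difference of
  their derivatives is a multiple of \<open>c s\<close>, while both fields are orthogonal to
  \<open>c s\<close>.\<close>

lemma parallel_along_unique:
  assumes V: "parallel_along d c V" and V': "parallel_along d c V'" and eq: "V 0 = V' 0"
    and c: "\<And>s. s \<in> {0..1} \<Longrightarrow> c s \<in> carrier_vec d"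
  shows "V 1 = V' 1"
proof -
  define h where "h s = (\<Sum>k<d. (V s $ k - V' s $ k)\<^sup>2)" for s
  have Vc: "V s \<in> carrier_vec d" "V' s \<in> carrier_vec d" if "s \<in> {0..1}" for s
    using V V' that by (auto simp: parallel_along_def)
  have der: "(h has_real_derivative 0) (at s within {0..1})" if s: "s \<in> {0..1}" for s
  proof -
    obtain W where W: "W \<in> carrier_vec d" "tangent_proj (c s) W = 0\<^sub>v d"
      "\<And>k. k < d \<Longrightarrow> ((\<lambda>u. V u $ k) has_real_derivative W $ k) (at s within {0..1})"
      using V s unfolding parallel_along_def by meson
    obtain W' where W': "W' \<in> carrier_vec d" "tangent_proj (c s) W' = 0\<^sub>v d"
      "\<And>k. k < d \<Longrightarrow> ((\<lambda>u. V' u $ k) has_real_derivative W' $ k) (at s within {0..1})"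
      using V' s unfolding parallel_along_def by meson
    have cs: "c s \<bullet> V s = 0" "c s \<bullet> V' s = 0" using V V' s by (auto simp: parallel_along_def)
    define a where "a = c s \<bullet> W - c s \<bullet> W'"
    have comp: "W $ k - W' $ k = a * (c s $ k)" if k: "k < d" for k
    proof -
      have "tangent_proj (c s) W $ k = 0" "tangent_proj (c s) W' $ k = 0" using W W' k by auto
      then show ?thesis using W W' c[OF s] k by (simp add: tangent_proj_def a_def algebra_simps)
    qed
    have "(h has_real_derivative (\<Sum>k<d. 2 * (V s $ k - V' s $ k) * (W $ k - W' $ k))) (at s within {0..1})"
      unfolding h_def by (rule DERIV_sum) (use W(3) W'(3) in \<open>auto intro!: derivative_eq_intros\<close>)
    moreover have "(\<Sum>k<d. 2 * (V s $ k - V' s $ k) * (W $ k - W' $ k)) =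
        2 * a * (\<Sum>k<d. c s $ k * (V s $ k - V' s $ k))"
      unfolding sum_distrib_left by (rule sum.cong) (simp_all add: comp)
    moreover have "(\<Sum>k<d. c s $ k * (V s $ k - V' s $ k)) = c s \<bullet> V s - c s \<bullet> V' s"
      using Vc[OF s] by (simp add: scalar_prod_def right_diff_distrib sum_subtractf lessThan_atLeast0)
    ultimately show ?thesis using cs by simp
  qed
  have "h 1 = h 0"
  proof (rule DERIV_isconst_end[where f = h])
    show "continuous_on {0..1} h"
      using der DERIV_continuous by (metis continuous_on_eq_continuous_within)
    show "(h has_real_derivative 0) (at s)" if "0 < s" "s < 1" for s
      using der[of s] that by (simp add: at_within_Icc_at)
  qed simp
  also have "h 0 = 0" by (simp add: h_def eq)
  finally have "\<And>k. k < d \<Longrightarrow> V 1 $ k = V' 1 $ k"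
    by (simp add: h_def sum_nonneg_eq_0_iff)
  then show ?thesis using Vc[of 1] by (intro eq_vecI) auto
qed

text \<open>Along the great circle with unit direction \<open>e\<close> the component of
  \<open>u\<close> in direction \<open>e\<close> turns with the velocity
  \<open>cos (s * l) e - sin (s * l) x\<close>, and the rest of \<open>u\<close> stays fixed. This
  is the field \<open>V\<close>; its derivative is a multiple of the position, hence normal.\<close>

lemma sph_transport_parallel_field:
  assumes x: "x \<in> unit_sphere d" and v: "v \<in> carrier_vec d" "x \<bullet> v = 0" "vnorm v < pi"
    and u: "u \<in> carrier_vec d" "x \<bullet> u = 0"
  obtains V where "parallel_along d (\<lambda>s. sph_exp x (s \<cdot>\<^sub>v v)) V" "V 0 = u" "V 1 = sph_transport x (sph_exp x v) u"
proof -
  define l where "l = vnorm v"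
  define e where "e = (1 / l) \<cdot>\<^sub>v v"
  have xc: "x \<in> carrier_vec d" and xx: "x \<bullet> x = 1" and ec: "e \<in> carrier_vec d"
    using x v by (auto simp: e_def unit_sphereD)
  note dims = xc[THEN carrier_vecD] ec[THEN carrier_vecD] u(1)[THEN carrier_vecD] v(1)[THEN carrier_vecD]
  have xe: "x \<bullet> e = 0" "e \<bullet> x = 0" using v dims sp_comm[of e x] by (simp_all add: e_def sp_simps)
  have l0: "0 \<le> l" by (simp add: l_def)
  have ee: "e \<bullet> e = 1" if "l \<noteq> 0"
  proof -
    have "e \<bullet> e = (1 / l) * ((1 / l) * (v \<bullet> v))" using dims by (simp add: e_def sp_simps)
    also have "v \<bullet> v = l * l" by (simp add: l_def vnorm_sq[symmetric] power2_eq_square)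
    finally show ?thesis using that by simp
  qed
  have e0: "e = 0\<^sub>v d" if "l = 0" using that dims by (intro eq_vecI) (auto simp: e_def)
  have c: "sph_exp x (s \<cdot>\<^sub>v v) = cos (s * l) \<cdot>\<^sub>v x + sin (s * l) \<cdot>\<^sub>v e" if "0 \<le> s" for s
  proof (cases "l = 0 \<or> s = 0")
    case True
    then show ?thesis using that dims e0 by (intro eq_vecI) (auto simp: sph_exp_def vnorm_smult l_def[symmetric])
  next
    case False
    then show ?thesis using that dims by (intro eq_vecI) (auto simp: sph_exp_def vnorm_smult l_def[symmetric] e_def)
  qed
  define V where "V s = u - (e \<bullet> u) \<cdot>\<^sub>v (sin (s * l) \<cdot>\<^sub>v x + (1 - cos (s * l)) \<cdot>\<^sub>v e)" for s
  have "parallel_along d (\<lambda>s. sph_exp x (s \<cdot>\<^sub>v v)) V"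
    unfolding parallel_along_def
  proof (intro ballI conjI)
    fix s :: real assume "s \<in> {0..1}"
    then have s: "0 \<le> s" by simp
    show "V s \<in> carrier_vec d" using u xc ec by (simp add: V_def)
    show "sph_exp x (s \<cdot>\<^sub>v v) \<bullet> V s = 0"
    proof (cases "l = 0")
      case True
      then show ?thesis using dims u e0 xx by (simp add: c[OF s] V_def sp_simps)
    next
      case False
      then show ?thesis using dims u xe xx ee by (simp add: c[OF s] V_def sp_simps algebra_simps)
    qed
    define W where "W = (- (e \<bullet> u) * l) \<cdot>\<^sub>v sph_exp x (s \<cdot>\<^sub>v v)"
    have cu: "sph_exp x (s \<cdot>\<^sub>v v) \<in> unit_sphere d"
      using x v dims by (intro sph_exp_unit_sphere) (auto simp: sp_simps)
    have Wc: "W \<in> carrier_vec d" using cu by (simp add: W_def unit_sphereD)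
    have "((\<lambda>u. V u $ k) has_real_derivative W $ k) (at s within {0..1})" if k: "k < d" for k
    proof -
      have 1: "V t $ k = u $ k - (e \<bullet> u) * (sin (t * l) * x $ k + (1 - cos (t * l)) * e $ k)" for t
        using k dims by (simp add: V_def)
      have 2: "W $ k = - (e \<bullet> u) * l * (cos (s * l) * x $ k + sin (s * l) * e $ k)"
        using k dims by (simp add: W_def c[OF s])
      show ?thesis unfolding 1 2 by (auto intro!: derivative_eq_intros simp: algebra_simps)
    qed
    moreover have "tangent_proj (sph_exp x (s \<cdot>\<^sub>v v)) W = 0\<^sub>v d"
      using unit_sphereD(2,3)[OF cu] by (intro eq_vecI) (auto simp: tangent_proj_def W_def sp_simps)
    ultimately show "\<exists>W\<in>carrier_vec d.
       (\<forall>k<d. ((\<lambda>u. V u $ k) has_real_derivative W $ k) (at s within {0..1})) \<and>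
       tangent_proj (sph_exp x (s \<cdot>\<^sub>v v)) W = 0\<^sub>v d" using Wc by blast
  qed
  moreover have "V 0 = u" using dims by (intro eq_vecI) (auto simp: V_def)
  moreover have "V 1 = sph_transport x (sph_exp x v) u"
  proof -
    have "1 \<cdot>\<^sub>v v = v" by (intro eq_vecI) auto
    then have y: "sph_exp x v = cos l \<cdot>\<^sub>v x + sin l \<cdot>\<^sub>v e" using c[of 1] by simp
    have yu: "sph_exp x v \<bullet> u = sin l * (e \<bullet> u)" and xy: "x \<bullet> sph_exp x v = cos l"
      using dims u xx xe by (simp_all add: y sp_simps)
    have pos: "1 + cos l > 0"
    proof -
      have "cos pi < cos l" using l0 v(3) by (intro cos_monotone_0_pi) (auto simp: l_def)
      then show ?thesis by simp
    qed
    \<comment> \<open>This identity removes the denominator \<open>1 + cos l\<close> of the closed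
      form, turning it into the trigonometric field at time 1.\<close>
    have "sin l * sin l = (1 - cos l) * (1 + cos l)"
      using sin_cos_squared_add3[of l] by (simp add: algebra_simps)
    then have q: "sin l * sin l / (1 + cos l) = 1 - cos l" using pos by (simp add: field_simps)
    show ?thesis
    proof (rule eq_vecI)
      fix k assume "k < dim_vec (sph_transport x (sph_exp x v) u)"
      then have k: "k < d" using dims by (simp add: sph_transport_def y)
      have "sph_transport x (sph_exp x v) u $ k =
          u $ k - (e \<bullet> u) * (sin l / (1 + cos l) * ((1 + cos l) * x $ k) + sin l * sin l / (1 + cos l) * e $ k)"
        unfolding sph_transport_def yu xy using k dims by (simp add: y distrib_left distrib_right add_divide_distrib mult_ac)
      also have "\<dots> = V 1 $ k" unfolding q using k dims pos by (simp add: V_def)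
      finally show "V 1 $ k = sph_transport x (sph_exp x v) u $ k" by simp
    qed (use dims in \<open>simp add: V_def sph_transport_def y\<close>)
  qed
  ultimately show thesis by (rule that)
qed

text \<open>The description is unique in two stages: the velocity by \<open>sph_log_unique\<close>,
  and then the parallel field along the geodesic by \<open>parallel_along_unique\<close>.\<close>

lemma parallel_transport_eq:
  assumes x: "x \<in> unit_sphere d" and y: "y \<in> unit_sphere d" and ne: "sph_dist x y < pi"
    and u: "u \<in> carrier_vec d" "x \<bullet> u = 0"
  shows "parallel_transport d x y u = sph_transport x y u"
  unfolding parallel_transport_def
proof (rule the_equality)
  obtain v where v: "v \<in> carrier_vec d" "x \<bullet> v = 0" "vnorm v = sph_dist x y" "sph_exp x v = y"
    using sph_log_exists[OF x y ne] by blast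
  have vpi: "vnorm v < pi" using v ne by simp
  obtain V where V: "parallel_along d (\<lambda>s. sph_exp x (s \<cdot>\<^sub>v v)) V" "V 0 = u"
      "V 1 = sph_transport x (sph_exp x v) u"
    using sph_transport_parallel_field[OF x v(1,2) vpi u] by blast
  show "\<exists>v V. v \<in> carrier_vec d \<and> x \<bullet> v = 0 \<and> vnorm v = sph_dist x y \<and> sph_exp x v = y \<and>
      parallel_along d (\<lambda>s. sph_exp x (s \<cdot>\<^sub>v v)) V \<and> V 0 = u \<and> V 1 = sph_transport x y u"
    using v V by (intro exI[of _ v] exI[of _ V]) simp
  fix w
  assume "\<exists>v V. v \<in> carrier_vec d \<and> x \<bullet> v = 0 \<and> vnorm v = sph_dist x y \<and> sph_exp x v = y \<and>
      parallel_along d (\<lambda>s. sph_exp x (s \<cdot>\<^sub>v v)) V \<and> V 0 = u \<and> V 1 = w"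
  then obtain v' V' where v': "v' \<in> carrier_vec d" "vnorm v' = sph_dist x y" "sph_exp x v' = y"
      "parallel_along d (\<lambda>s. sph_exp x (s \<cdot>\<^sub>v v')) V'" "V' 0 = u" "V' 1 = w" by blast
  have "v' = v"
    using sph_log_unique[OF x v(1) vpi] sph_log_unique[OF x v'(1)] ne v v' by simp
  then have "V' 1 = V 1"
    using parallel_along_unique[OF v'(4), of V] V v' v(1) x
    by (simp add: sph_exp_carrier unit_sphereD)
  then show "w = sph_transport x y u" using V v v' by simp
qed

lemma sph_transport_tangent:
  assumes x: "x \<in> unit_sphere d" and y: "y \<in> unit_sphere d" and u: "u \<in> carrier_vec d" "x \<bullet> u = 0"
    and ne: "1 + x \<bullet> y \<noteq> 0"
  shows "y \<bullet> sph_transport x y u = 0"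
  using unit_sphereD[OF x] unit_sphereD[OF y] u u(1)[THEN carrier_vecD] ne sp_comm[of y x]
  by (simp add: sph_transport_def sp_simps field_simps)

lemma sph_transport_diff:
  assumes "x \<in> unit_sphere d" "y \<in> unit_sphere d" "u \<in> carrier_vec d" "v \<in> carrier_vec d"
  shows "sph_transport x y u - sph_transport x y v = sph_transport x y (u - v)"
  using assms unit_sphereD(2)[OF assms(1)] unit_sphereD(2)[OF assms(2)] assms(3,4)[THEN carrier_vecD]
  by (intro eq_vecI) (auto simp: sph_transport_def sp_simps diff_divide_distrib algebra_simps)

text \<open>With \<open>b = 1 + x \<bullet> y\<close> the vector \<open>x + y\<close> has squared
  length \<open>2 * b\<close>, and its inner product with the tangent vector \<open>u\<close> is
  \<open>y \<bullet> u\<close>. For \<open>t = a / b\<close> the linear and the quadratic term in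
  \<open>t\<close> cancel.\<close>

lemma vnorm_sph_transport:
  assumes x: "x \<in> unit_sphere d" and y: "y \<in> unit_sphere d" and u: "u \<in> carrier_vec d" "x \<bullet> u = 0"
    and ne: "1 + x \<bullet> y \<noteq> 0"
  shows "vnorm (sph_transport x y u) = vnorm u"
proof -
  define b where "b = 1 + x \<bullet> y"
  define a where "a = y \<bullet> u"
  define t where "t = a / b"
  have "sph_transport x y u = u - t \<cdot>\<^sub>v (x + y)" by (simp add: sph_transport_def t_def a_def b_def)
  then have "sph_transport x y u \<bullet> sph_transport x y u = u \<bullet> u - 2 * t * a + t * t * (2 * b)"
    using unit_sphereD[OF x] unit_sphereD[OF y] u u(1)[THEN carrier_vecD] sp_comm[of y x]
      sp_comm[of u x] sp_comm[of u y]
    by (simp add: sp_simps a_def b_def algebra_simps)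
  also have "\<dots> = u \<bullet> u" using ne by (simp add: t_def b_def[symmetric])
  finally show ?thesis by (simp add: vnorm_def)
qed

section \<open>The gradient of the cost\<close>

text \<open>Closed form of \<open>riem_grad d (pca_cost B)\<close> for symmetric \<open>B\<close>,
  used from here on in place of the derivative.\<close>

definition sph_grad :: "real mat \<Rightarrow> real vec \<Rightarrow> real vec" where
  "sph_grad B x = (- 2) \<cdot>\<^sub>v (B *\<^sub>v x - (x \<bullet> (B *\<^sub>v x)) \<cdot>\<^sub>v x)"

lemma sph_grad_carrier:
  "B \<in> carrier_mat d d \<Longrightarrow> x \<in> carrier_vec d \<Longrightarrow> sph_grad B x \<in> carrier_vec d"
  by (simp add: sph_grad_def)

lemma riem_grad_pca_cost:
  assumes B: "B \<in> carrier_mat d d" "B\<^sup>T = B" and x: "x \<in> carrier_vec d"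
  shows "riem_grad d (pca_cost B) x = sph_grad B x"
proof -
  have Bx: "B *\<^sub>v x \<in> carrier_vec d" using B x by simp
  have "euclid_grad d (pca_cost B) x = (- 2) \<cdot>\<^sub>v (B *\<^sub>v x)"
    unfolding euclid_grad_def
  proof (rule eq_vecI)
    fix k assume "k < dim_vec ((- 2) \<cdot>\<^sub>v (B *\<^sub>v x))"
    then have k: "k < d" using B by simp
    define e :: "real vec" where "e = unit_vec d k"
    have e: "e \<in> carrier_vec d" by (simp add: e_def)
    note dims = e[THEN carrier_vecD] x[THEN carrier_vecD] carrier_matD[OF B(1)]
    have ek: "e \<bullet> (B *\<^sub>v x) = (B *\<^sub>v x) $ k" unfolding e_def by (rule scalar_prod_left_unit[OF Bx k])
    have exp: "pca_cost B (x + s \<cdot>\<^sub>v e) =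
      - (x \<bullet> (B *\<^sub>v x) + 2 * s * (B *\<^sub>v x) $ k + s\<^sup>2 * (e \<bullet> (B *\<^sub>v e)))" for s
      using B x e dims symmetric_mat_adjoint[OF B e x] ek
      by (simp add: pca_cost_def mat_vec_add[of _ d d] mat_vec_smult[of _ d d] sp_simps
          algebra_simps power2_eq_square)
    have der: "((\<lambda>s. pca_cost B (x + s \<cdot>\<^sub>v e)) has_real_derivative - 2 * (B *\<^sub>v x) $ k) (at 0)"
      unfolding exp by (auto intro!: derivative_eq_intros)
    have "(THE D. ((\<lambda>s. pca_cost B (x + s \<cdot>\<^sub>v e)) has_real_derivative D) (at 0)) = - 2 * (B *\<^sub>v x) $ k"
      by (rule the_equality, rule der, erule DERIV_unique, rule der)
    then show "vec d (\<lambda>k. THE D. ((\<lambda>s. pca_cost B (x + s \<cdot>\<^sub>v unit_vec d k)) has_real_derivative D) (at 0)) $ k =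
        ((- 2) \<cdot>\<^sub>v (B *\<^sub>v x)) $ k"
      using k Bx B by (simp add: e_def)
  qed (use B in simp)
  then show ?thesis
    using Bx x B by (intro eq_vecI) (auto simp: riem_grad_def tangent_proj_def sph_grad_def sp_simps algebra_simps)
qed

lemma sph_grad_tangent:
  assumes "B \<in> carrier_mat d d" "x \<in> unit_sphere d"
  shows "x \<bullet> sph_grad B x = 0"
  using assms unit_sphereD[OF assms(2)] by (simp add: sph_grad_def sp_simps)

lemma sph_grad_sq:
  assumes B: "B \<in> carrier_mat d d" and x: "x \<in> unit_sphere d"
  shows "sph_grad B x \<bullet> sph_grad B x = 4 * ((B *\<^sub>v x) \<bullet> (B *\<^sub>v x) - (x \<bullet> (B *\<^sub>v x))\<^sup>2)"
  using assms unit_sphereD[OF x] carrier_matD[OF B] sp_comm[of "B *\<^sub>v x" x]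
  by (simp add: sph_grad_def sp_simps power2_eq_square algebra_simps)

lemma vnorm_sph_grad_le:
  assumes B: "psd d B" and L: "\<And>y. y \<in> carrier_vec d \<Longrightarrow> y \<bullet> (B *\<^sub>v y) \<le> c * (y \<bullet> y)" "0 \<le> c"
    and x: "x \<in> unit_sphere d"
  shows "vnorm (sph_grad B x) \<le> 2 * c"
proof -
  have Bc: "B \<in> carrier_mat d d" using B by (simp add: psd_def)
  have "(B *\<^sub>v x) \<bullet> (B *\<^sub>v x) \<le> c * (x \<bullet> (B *\<^sub>v x))"
    using psd_mat_vec_sq_le[OF B L(1)] x L(2) by (simp add: unit_sphereD)
  also have "\<dots> \<le> c * (c * 1)"
    using L(1)[of x] L(2) x by (intro mult_left_mono) (auto simp: unit_sphereD)
  finally have "(B *\<^sub>v x) \<bullet> (B *\<^sub>v x) \<le> c\<^sup>2" by (simp add: power2_eq_square)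
  then have "(B *\<^sub>v x) \<bullet> (B *\<^sub>v x) - (x \<bullet> (B *\<^sub>v x))\<^sup>2 \<le> c\<^sup>2"
    by (rule order_trans[rotated]) simp
  then show ?thesis using L(2) by (subst vnorm_le_iff) (auto simp: sph_grad_sq[OF Bc x] power_mult_distrib)
qed

text \<open>
  With \<open>m\<close>, \<open>m'\<close> the normalized vectors \<open>x + y\<close> and \<open>y - x\<close>, that is the position and the velocity
  of the connecting geodesic at its midpoint, the difference of the gradients becomes an explicit
  combination of \<open>B m'\<close>, \<open>m\<close> and \<open>m'\<close>.
\<close>

lemma sph_grad_lipschitz:
  assumes B: "psd d B" and L: "\<And>y. y \<in> carrier_vec d \<Longrightarrow> y \<bullet> (B *\<^sub>v y) \<le> c * (y \<bullet> y)" "0 \<le> c"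
    and x: "x \<in> unit_sphere d" and y: "y \<in> unit_sphere d" and ne: "sph_dist x y < pi"
  shows "vnorm (sph_grad B y - sph_transport x y (sph_grad B x)) \<le> 2 * c * sph_dist x y"
proof -
  have Bc: "B \<in> carrier_mat d d" and Bs: "B\<^sup>T = B" using B by (auto simp: psd_def)
  define r where "r = sph_dist x y"
  have r: "0 \<le> r" "r < pi" "x \<bullet> y = cos r" using sph_dist_bounds[OF x y] ne by (auto simp: r_def)
  define C S where "C = cos (r / 2)" and "S = sin (r / 2)"
  have C0: "C > 0" unfolding C_def using r by (intro cos_gt_zero_pi) auto
  have S0: "0 \<le> S" unfolding S_def using r by (intro sin_ge_zero) auto
  have CS: "C * C + S * S = 1" unfolding C_def S_def by (rule sin_cos_squared_add3)
  have cr: "x \<bullet> y = C * C - S * S"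
    using cos_double[of "r / 2"] r by (simp add: C_def S_def power2_eq_square)
  note dx = unit_sphereD[OF x] and dy = unit_sphereD[OF y]
  note yx = sp_comm[of y x, unfolded dx(2) dy(2), OF refl]
  show ?thesis
  proof (cases "S = 0")
    \<comment> \<open>Here \<open>y = x\<close> and transport is the identity on tangent vectors.
      The case stands apart because \<open>m'\<close> is obtained by dividing by
      \<open>S\<close>.\<close>
    case True
    have "(y - x) \<bullet> (y - x) = 0" using dx dy yx cr CS True by (simp add: sp_simps)
    then have "y - x = 0\<^sub>v d" using dx dy sp_self_eq_0[of "y - x" d] by simp
    then have "(y - x) $ i = 0\<^sub>v d $ i" for i by (rule arg_cong)
    then have "y $ i = x $ i" if "i < d" for i
      using that dx dy by (metis eq_iff_diff_eq_0 index_minus_vec(1) index_zero_vec(1))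
    then have xy: "y = x" using dx dy by (intro eq_vecI) auto
    have "sph_grad B x - sph_transport x x (sph_grad B x) = 0\<^sub>v d"
      using sph_grad_tangent[OF Bc x] dx sph_grad_carrier[OF Bc dx(1)]
      by (intro eq_vecI) (auto simp: sph_transport_def)
    then show ?thesis unfolding xy using L(2) sph_dist_bounds(1)[OF x x] by (simp add: vnorm_def)
  next
    case False
    define m m' where "m = (1 / (2 * C)) \<cdot>\<^sub>v (x + y)" and "m' = (1 / (2 * S)) \<cdot>\<^sub>v (y - x)"
    have mc: "m \<in> carrier_vec d" "m' \<in> carrier_vec d" using dx dy by (simp_all add: m_def m'_def)
    note dm = mc[THEN carrier_vecD] dx(2) dy(2) carrier_matD[OF Bc]
    have xm: "x = C \<cdot>\<^sub>v m - S \<cdot>\<^sub>v m'" and ym: "y = C \<cdot>\<^sub>v m + S \<cdot>\<^sub>v m'"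
      using dx dy C0 False by (auto intro!: eq_vecI simp: m_def m'_def field_simps)
    have mm: "m \<bullet> m = 1"
    proof -
      have "(t \<cdot>\<^sub>v (x + y)) \<bullet> (t \<cdot>\<^sub>v (x + y)) = t * (t * (2 + 2 * (x \<bullet> y)))" for t
        using dx dy yx by (simp add: sp_simps algebra_simps)
      then have "m \<bullet> m = (1 / (2 * C)) * ((1 / (2 * C)) * (2 + 2 * (x \<bullet> y)))"
        unfolding m_def .
      also have "2 + 2 * (x \<bullet> y) = 4 * C * C" using cr CS by simp
      finally show ?thesis using C0 by simp
    qed
    have m'm': "m' \<bullet> m' = 1"
    proof -
      have "(t \<cdot>\<^sub>v (y - x)) \<bullet> (t \<cdot>\<^sub>v (y - x)) = t * (t * (2 - 2 * (x \<bullet> y)))" for t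
        using dx dy yx by (simp add: sp_simps algebra_simps)
      then have "m' \<bullet> m' = (1 / (2 * S)) * ((1 / (2 * S)) * (2 - 2 * (x \<bullet> y)))"
        unfolding m'_def .
      also have "2 - 2 * (x \<bullet> y) = 4 * S * S" using cr CS by simp
      finally show ?thesis using False by simp
    qed
    have "(t \<cdot>\<^sub>v (x + y)) \<bullet> (u \<cdot>\<^sub>v (y - x)) = 0" for t u
      using dx dy yx by (simp add: sp_simps algebra_simps)
    then have mm': "m \<bullet> m' = 0" unfolding m_def m'_def .
    then have mm'': "m' \<bullet> m = 0" using dm sp_comm[of m m'] by simp
    define \<alpha> \<beta> \<kappa> where "\<alpha> = m' \<bullet> (B *\<^sub>v m')" and "\<beta> = m \<bullet> (B *\<^sub>v m)" and "\<kappa> = m \<bullet> (B *\<^sub>v m')"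
    have \<kappa>': "m' \<bullet> (B *\<^sub>v m) = \<kappa>" unfolding \<kappa>_def by (rule symmetric_mat_adjoint[OF Bc Bs mc])
    have \<alpha>b: "0 \<le> \<alpha>" "\<alpha> \<le> c" and \<beta>b: "0 \<le> \<beta>" "\<beta> \<le> c"
      using B L(1)[OF mc(1)] L(1)[OF mc(2)] mc by (simp_all add: \<alpha>_def \<beta>_def psd_def mm m'm')
    have Bx: "B *\<^sub>v x = C \<cdot>\<^sub>v (B *\<^sub>v m) - S \<cdot>\<^sub>v (B *\<^sub>v m')"
      unfolding xm using mc Bc by (simp add: mat_vec_diff[of _ d d] mat_vec_smult[of _ d d])
    have By: "B *\<^sub>v y = C \<cdot>\<^sub>v (B *\<^sub>v m) + S \<cdot>\<^sub>v (B *\<^sub>v m')"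
      unfolding ym using mc Bc by (simp add: mat_vec_add[of _ d d] mat_vec_smult[of _ d d])
    \<comment> \<open>The even and the odd part of the form about the midpoint: exchanging
      \<open>x\<close> and \<open>y\<close> only flips the sign of \<open>m'\<close>.\<close>
    define a b where "a = C * C * \<beta> + S * S * \<alpha>" and "b = 2 * (C * S * \<kappa>)"
    have xBx: "x \<bullet> (B *\<^sub>v x) = a - b"
      unfolding Bx using dm
      by (subst xm) (simp add: sp_simps \<alpha>_def[symmetric] \<beta>_def[symmetric]
          \<kappa>_def[symmetric] \<kappa>' a_def b_def algebra_simps)
    have yBy: "y \<bullet> (B *\<^sub>v y) = a + b"
      unfolding By using dm
      by (subst ym) (simp add: sp_simps \<alpha>_def[symmetric] \<beta>_def[symmetric]
          \<kappa>_def[symmetric] \<kappa>' a_def b_def algebra_simps)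
    have yBx: "y \<bullet> (B *\<^sub>v x) = C * C * \<beta> - S * S * \<alpha>"
      unfolding Bx using dm
      by (subst ym) (simp add: sp_simps \<alpha>_def[symmetric] \<beta>_def[symmetric]
          \<kappa>_def[symmetric] \<kappa>' algebra_simps)
    define P where "P = S * C * (\<beta> - \<alpha>) - \<kappa>"
    define \<tau> where "\<tau> = C * S * (\<beta> - \<alpha>) + \<kappa> * (C * C - S * S)"
    have "y \<bullet> sph_grad B x = - 2 * (C * C * \<beta> - S * S * \<alpha> - (a - b) * (C * C - S * S))"
      using dm dx dy by (simp add: sph_grad_def sp_simps xBx yBx yx cr)
    also have "\<dots> = - 4 * C * S * \<tau>"
    proof -
      \<comment> \<open>Multiplying by \<open>C * C + S * S = 1\<close> makes the claim homogeneous
        of degree four in \<open>C\<close> and \<open>S\<close>, hence a polynomial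
        identity.\<close>
      have "C * C * \<beta> - S * S * \<alpha> = (C * C * \<beta> - S * S * \<alpha>) * (C * C + S * S)" by (simp add: CS)
      then show ?thesis by (simp add: a_def b_def \<tau>_def algebra_simps)
    qed
    finally have "y \<bullet> sph_grad B x = - 4 * C * S * \<tau>" .
    moreover have "1 + x \<bullet> y = 2 * (C * C)" using CS cr by simp
    ultimately have "(y \<bullet> sph_grad B x) / (1 + x \<bullet> y) = - 4 * C * S * \<tau> / (2 * (C * C))"
      by (simp only:)
    also have "\<dots> = - (2 * S * \<tau>) / C" using C0 by (simp add: field_simps)
    finally have tr: "(y \<bullet> sph_grad B x) / (1 + x \<bullet> y) = - (2 * S * \<tau>) / C" .
    define w where "w = sph_grad B y - sph_transport x y (sph_grad B x)"
    have w: "w = (- 4 * S) \<cdot>\<^sub>v (B *\<^sub>v m' + P \<cdot>\<^sub>v m - a \<cdot>\<^sub>v m')"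
    proof (rule eq_vecI)
      fix k assume "k < dim_vec ((- 4 * S) \<cdot>\<^sub>v (B *\<^sub>v m' + P \<cdot>\<^sub>v m - a \<cdot>\<^sub>v m'))"
      then have k: "k < d" using dm by simp
      define p q u v where "p = (B *\<^sub>v m) $ k" and "q = (B *\<^sub>v m') $ k" and "u = m $ k" and "v = m' $ k"
      have xk: "x $ k = C * u - S * v" and yk: "y $ k = C * u + S * v"
        using k dm xm ym by (metis index_add_vec(1) index_minus_vec(1) index_smult_vec u_def v_def)+
      have Bxk: "(B *\<^sub>v x) $ k = C * p - S * q" and Byk: "(B *\<^sub>v y) $ k = C * p + S * q"
        unfolding Bx By p_def q_def using k dm by simp_all
      have "w $ k = sph_grad B y $ k - (sph_grad B x $ k - (- (2 * S * \<tau>) / C) * (x $ k + y $ k))"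
        unfolding w_def sph_transport_def tr using k dm by (simp add: sph_grad_def)
      also have "sph_grad B y $ k = - 2 * ((C * p + S * q) - (a + b) * (C * u + S * v))"
        using k dm by (simp add: sph_grad_def yBy Byk yk del: index_mult_mat_vec)
      also have "sph_grad B x $ k = - 2 * ((C * p - S * q) - (a - b) * (C * u - S * v))"
        using k dm by (simp add: sph_grad_def xBx Bxk xk del: index_mult_mat_vec)
      also have "- (2 * S * \<tau>) / C * (x $ k + y $ k) = - 4 * S * \<tau> * u"
        using C0 by (simp add: xk yk)
      also have "- 2 * ((C * p + S * q) - (a + b) * (C * u + S * v)) -
          (- 2 * ((C * p - S * q) - (a - b) * (C * u - S * v)) - - 4 * S * \<tau> * u) =
          - 4 * S * (q + (\<tau> - 2 * C * C * \<kappa>) * u - a * v)"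
        by (simp add: b_def algebra_simps)
      also have "\<tau> - 2 * C * C * \<kappa> = P"
      proof -
        have "\<kappa> = \<kappa> * (C * C + S * S)" by (simp add: CS)
        then show ?thesis by (simp add: \<tau>_def P_def algebra_simps)
      qed
      finally show "w $ k = ((- 4 * S) \<cdot>\<^sub>v (B *\<^sub>v m' + P \<cdot>\<^sub>v m - a \<cdot>\<^sub>v m')) $ k"
        using k dm by (simp add: p_def q_def u_def v_def del: index_mult_mat_vec)
    qed (use dm in \<open>simp add: w_def sph_transport_def sph_grad_def\<close>)
    define z where "z = B *\<^sub>v m' + P \<cdot>\<^sub>v m - a \<cdot>\<^sub>v m'"
    have zz: "z \<bullet> z = (B *\<^sub>v m') \<bullet> (B *\<^sub>v m') + P * P + a * a + 2 * P * \<kappa> - 2 * a * \<alpha>"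
      unfolding z_def using dm mm m'm' mm' mm'' sp_comm[of "B *\<^sub>v m'" m] sp_comm[of "B *\<^sub>v m'" m']
      by (simp add: sp_simps \<alpha>_def \<kappa>_def algebra_simps)
    have aa: "a - \<alpha> = C * C * (\<beta> - \<alpha>)"
    proof -
      have "\<alpha> = \<alpha> * (C * C + S * S)" by (simp add: CS)
      then show ?thesis by (simp add: a_def algebra_simps)
    qed
    \<comment> \<open>Completing the squares: \<open>P + \<kappa>\<close> and
      \<open>a - \<alpha>\<close> are both multiples of \<open>\<beta> - \<alpha>\<close>, and the
      sum of their squares collapses by \<open>C * C + S * S = 1\<close>.\<close>
    have "z \<bullet> z = (B *\<^sub>v m') \<bullet> (B *\<^sub>v m') + (P + \<kappa>) * (P + \<kappa>) - \<kappa> * \<kappa> + (a - \<alpha>) * (a - \<alpha>) - \<alpha> * \<alpha>"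
      by (simp add: zz algebra_simps)
    also have "(P + \<kappa>) * (P + \<kappa>) = (S * S) * (C * C) * ((\<beta> - \<alpha>) * (\<beta> - \<alpha>))"
      by (simp add: P_def mult_ac)
    also have "(a - \<alpha>) * (a - \<alpha>) = (C * C) * (C * C) * ((\<beta> - \<alpha>) * (\<beta> - \<alpha>))"
      by (simp add: aa mult_ac)
    finally have "z \<bullet> z = (B *\<^sub>v m') \<bullet> (B *\<^sub>v m') - \<kappa> * \<kappa> - \<alpha> * \<alpha> +
        (C * C + S * S) * (C * C) * ((\<beta> - \<alpha>) * (\<beta> - \<alpha>))"
      by (simp add: algebra_simps)
    also have "\<dots> \<le> c * \<alpha> - \<alpha> * \<alpha> + (\<beta> - \<alpha>) * (\<beta> - \<alpha>)"
    proof -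
      have "C * C \<le> 1" using CS zero_le_square[of S] by linarith
      then have "C * C * ((\<beta> - \<alpha>) * (\<beta> - \<alpha>)) \<le> 1 * ((\<beta> - \<alpha>) * (\<beta> - \<alpha>))"
        by (intro mult_right_mono) auto
      moreover have "(B *\<^sub>v m') \<bullet> (B *\<^sub>v m') \<le> c * \<alpha>"
        unfolding \<alpha>_def by (rule psd_mat_vec_sq_le[OF B L(1) mc(2) L(2)])
      moreover have "0 \<le> \<kappa> * \<kappa>" by (rule zero_le_square)
      ultimately show ?thesis unfolding CS mult_1_left by linarith
    qed
    also have "\<dots> = c * \<alpha> + \<beta> * (\<beta> - 2 * \<alpha>)" by (simp add: algebra_simps)
    \<comment> \<open>Only \<open>0 \<le> \<alpha>, \<beta> \<le> c\<close> is left to use. For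
      \<open>\<beta> \<ge> 2 * \<alpha>\<close> the product increases with \<open>\<beta>\<close>,
      so \<open>\<beta> = c\<close> is the worst case; otherwise it is nonpositive.\<close>
    also have "\<dots> \<le> c * c"
    proof (cases "2 * \<alpha> \<le> \<beta>")
      case True
      then have "\<beta> * (\<beta> - 2 * \<alpha>) \<le> c * (c - 2 * \<alpha>)"
        using \<beta>b by (intro mult_mono) auto
      moreover have "0 \<le> c * \<alpha>" using L(2) \<alpha>b by simp
      ultimately show ?thesis by (simp add: algebra_simps)
    next
      case False
      then have "\<beta> * (\<beta> - 2 * \<alpha>) \<le> 0" using \<beta>b by (intro mult_nonneg_nonpos) auto
      moreover have "c * \<alpha> \<le> c * c" using L(2) \<alpha>b by (intro mult_left_mono)
      ultimately show ?thesis by simp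
    qed
    finally have "vnorm z \<le> c" using L(2) by (simp add: vnorm_le_iff power2_eq_square)
    then have "vnorm w \<le> 4 * S * c"
      unfolding w z_def[symmetric] vnorm_smult using S0 by (simp add: mult_left_mono)
    also have "4 * S * c \<le> 4 * (r / 2) * c"
      unfolding S_def using r L(2) by (intro mult_right_mono mult_left_mono sin_x_le_x) auto
    finally show ?thesis by (simp add: w_def r_def mult_ac)
  qed
qed

section \<open>Distributed data and the spectral gap\<close>

lemma gram_carrier: "M \<in> carrier_mat m d \<Longrightarrow> gram M \<in> carrier_mat d d"
  by (simp add: gram_def)

lemma gram_symmetric: "M \<in> carrier_mat m d \<Longrightarrow> (gram M)\<^sup>T = gram M"
  by (simp add: gram_def transpose_mult[of _ d m])

lemma gram_quadratic_form:
  assumes M: "M \<in> carrier_mat m d" and x: "x \<in> carrier_vec d"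
  shows "x \<bullet> (gram M *\<^sub>v x) = (M *\<^sub>v x) \<bullet> (M *\<^sub>v x)"
proof -
  have Mx: "M *\<^sub>v x \<in> carrier_vec m" using M x by simp
  have "gram M *\<^sub>v x = M\<^sup>T *\<^sub>v (M *\<^sub>v x)"
    unfolding gram_def by (rule assoc_mult_mat_vec) (use M x in auto)
  then have "x \<bullet> (gram M *\<^sub>v x) = (M\<^sup>T *\<^sub>v (M *\<^sub>v x)) \<bullet> x"
    using M x by (subst sp_comm) auto
  also have "\<dots> = (M *\<^sub>v x) \<bullet> (M *\<^sub>v x)" by (rule transpose_vec_mult_scalar[OF M x Mx])
  finally show ?thesis .
qed

lemma gram_psd: "M \<in> carrier_mat m d \<Longrightarrow> psd d (gram M)"
  by (auto simp: psd_def gram_carrier gram_symmetric gram_quadratic_form sp_self_nonneg)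

lemma gram_index:
  assumes "M \<in> carrier_mat m d" "j < d" "k < d"
  shows "gram M $$ (j, k) = (\<Sum>r<m. M $$ (r, j) * M $$ (r, k))"
  using assms by (auto simp: gram_def scalar_prod_def lessThan_atLeast0 intro!: sum.cong)

lemma local_data_carrier:
  assumes "M \<in> carrier_mat m d"
  shows "local_data M part i \<in> carrier_mat (card {r. r < m \<and> part r = i}) d"
  using assms dim_submatrix[of M "{r. part r = i}" UNIV] by (intro carrier_matI) (auto simp: local_data_def)

text \<open>\<open>submatrix\<close> numbers the selected rows by rank. So \<open>f\<close>, the
  rank of a row among those of machine \<open>i\<close>, is a bijection from the old row indices
  onto the new ones and reindexes the sum.\<close>

lemma gram_local_data_index:
  assumes M: "M \<in> carrier_mat m d" and jk: "j < d" "k < d"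
  shows "gram (local_data M part i) $$ (j, k) = (\<Sum>r | r < m \<and> part r = i. M $$ (r, j) * M $$ (r, k))"
proof -
  define I where "I = {r. part r = i}"
  define J where "J = {r. r < m \<and> r \<in> I}"
  define f where "f r = card {a \<in> I. a < r}" for r
  define N where "N = local_data M part i"
  have mono: "f r < f s" if "r \<in> I" "r < s" for r s
    unfolding f_def by (rule psubset_card_mono) (use that in auto)
  have inj: "inj_on f J"
  proof (rule inj_onI)
    fix r s assume "r \<in> J" "s \<in> J" "f r = f s"
    then show "r = s" using mono[of r s] mono[of s r] by (cases r s rule: linorder_cases) (auto simp: J_def)
  qed
  have lt: "f r < card J" if "r \<in> J" for r
    unfolding f_def J_def by (rule psubset_card_mono) (use that in \<open>auto simp: J_def\<close>)
  have img: "f ` J = {..<card J}"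
    by (rule card_subset_eq) (use lt inj in \<open>auto simp: card_image\<close>)
  have ent: "N $$ (f r, l) = M $$ (r, l)" if "r \<in> J" "l < d" for r l
  proof -
    have "submatrix M I UNIV $$ (card {a\<in>I. a < r}, card {a\<in>UNIV. a < l}) = M $$ (r, l)"
      by (rule submatrix_index_card) (use that M in \<open>auto simp: J_def\<close>)
    then show ?thesis by (simp add: N_def local_data_def I_def f_def)
  qed
  have "gram N $$ (j, k) = (\<Sum>r<card J. N $$ (r, j) * N $$ (r, k))"
    using gram_index[OF local_data_carrier[OF M] jk] by (simp add: N_def J_def I_def)
  also have "\<dots> = (\<Sum>r\<in>J. N $$ (f r, j) * N $$ (f r, k))"
    by (subst img[symmetric]) (simp add: sum.reindex[OF inj])
  also have "\<dots> = (\<Sum>r\<in>J. M $$ (r, j) * M $$ (r, k))"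
    using ent jk by (intro sum.cong) auto
  finally show ?thesis by (simp add: N_def J_def I_def)
qed

text \<open>Every row of \<open>M\<close> is held by exactly one machine, so grouping the sum over
  the rows by \<open>part\<close> splits each entry of the Gram matrix.\<close>

lemma gram_eq_sum_local:
  assumes M: "M \<in> carrier_mat m d" and part: "\<forall>k<m. part k < n" and x: "x \<in> carrier_vec d"
  shows "gram M *\<^sub>v x = vec_sum d n (\<lambda>i. gram (local_data M part i) *\<^sub>v x)"
proof (rule eq_vecI)
  let ?G = "\<lambda>i. gram (local_data M part i)"
  have Gc: "?G i \<in> carrier_mat d d" for i using gram_carrier[OF local_data_carrier[OF M]] .
  fix j assume "j < dim_vec (vec_sum d n (\<lambda>i. ?G i *\<^sub>v x))"
  then have j: "j < d" by simp
  have ent: "gram M $$ (j, k) = (\<Sum>i<n. ?G i $$ (j, k))" if k: "k < d" for k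
  proof -
    have "(\<Sum>i<n. ?G i $$ (j, k)) = (\<Sum>i<n. \<Sum>r | r \<in> {..<m} \<and> part r = i. M $$ (r, j) * M $$ (r, k))"
      using gram_local_data_index[OF M j k] by simp
    also have "\<dots> = (\<Sum>r<m. M $$ (r, j) * M $$ (r, k))"
      by (rule sum.group) (use part in auto)
    finally show ?thesis using gram_index[OF M j k] by simp
  qed
  have mv: "(B *\<^sub>v x) $ j = (\<Sum>k<d. B $$ (j, k) * x $ k)" if "B \<in> carrier_mat d d" for B
    using that j x by (simp add: scalar_prod_def lessThan_atLeast0)
  have "(gram M *\<^sub>v x) $ j = (\<Sum>k<d. \<Sum>i<n. ?G i $$ (j, k) * x $ k)"
    unfolding mv[OF gram_carrier[OF M]] by (intro sum.cong) (auto simp: ent sum_distrib_right)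
  also have "\<dots> = (\<Sum>i<n. (?G i *\<^sub>v x) $ j)"
    unfolding mv[OF Gc] by (rule sum.swap)
  finally show "(gram M *\<^sub>v x) $ j = vec_sum d n (\<lambda>i. ?G i *\<^sub>v x) $ j"
    using j by (simp add: vec_sum_def)
qed (use gram_carrier[OF M] in simp)

lemma smoothness_bound:
  assumes M: "M \<in> carrier_mat m d" and d: "0 < d" and i: "i < n" and y: "y \<in> carrier_vec d"
  shows "y \<bullet> (gram (local_data M part i) *\<^sub>v y) \<le> smoothness M part n / (2 * real n) * (y \<bullet> y)"
proof -
  let ?l = "\<lambda>i. lambda_max (gram (local_data M part i))"
  note c = local_data_carrier[OF M]
  have "2 * ?l i \<le> Max ((\<lambda>i. 2 * ?l i) ` {..<n})" using i by (intro Max_ge) auto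
  also have "\<dots> = smoothness M part n / real n" using i by (simp add: smoothness_def)
  finally have "?l i \<le> smoothness M part n / (2 * real n)" by (simp add: field_simps)
  then have "?l i * (y \<bullet> y) \<le> smoothness M part n / (2 * real n) * (y \<bullet> y)"
    by (intro mult_right_mono sp_self_nonneg)
  then show ?thesis
    using rayleigh_le_lambda_max[OF gram_carrier[OF c] gram_symmetric[OF c] d y] by (meson order_trans)
qed

text \<open>The frame at a single point. It serves twice: at the iterates, for the quantizer, and at
  the leading eigenvector, for the spectral gap.\<close>

locale tangent_frame =
  fixes d :: nat and U :: "real mat" and x :: "real vec"
  assumes x: "x \<in> unit_sphere d" and d: "0 < d" and U: "U \<in> carrier_mat d (d - 1)"
    and UU: "U\<^sup>T * U = 1\<^sub>m (d - 1)" and Ux: "U\<^sup>T *\<^sub>v x = 0\<^sub>v (d - 1)"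
begin

lemma isometry:
  assumes "z \<in> carrier_vec (d - 1)"
  shows "U *\<^sub>v z \<in> carrier_vec d" "x \<bullet> (U *\<^sub>v z) = 0" "(U *\<^sub>v z) \<bullet> (U *\<^sub>v z) = z \<bullet> z"
proof -
  show c: "U *\<^sub>v z \<in> carrier_vec d" using U assms by simp
  have ad: "y \<bullet> (U *\<^sub>v z) = (U\<^sup>T *\<^sub>v y) \<bullet> z" if "y \<in> carrier_vec d" for y
    using transpose_vec_mult_scalar[OF U assms that] by simp
  show "x \<bullet> (U *\<^sub>v z) = 0" using ad[of x] x assms by (simp add: Ux unit_sphereD)
  have "U\<^sup>T *\<^sub>v (U *\<^sub>v z) = (U\<^sup>T * U) *\<^sub>v z"
    by (rule assoc_mult_mat_vec[symmetric]) (use U assms in auto)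
  then show "(U *\<^sub>v z) \<bullet> (U *\<^sub>v z) = z \<bullet> z" using ad[OF c] assms by (simp add: UU)
qed

text \<open>Extends the frame to an orthonormal basis of the whole space. The matrix becomes square,
  so its transpose is a two-sided inverse and similarity arguments apply.\<close>

definition completion :: "real mat" where
  "completion = mat d d (\<lambda>(i, j). if j = 0 then x $ i else U $$ (i, j - 1))"

lemma completion_carrier [simp]: "completion \<in> carrier_mat d d"
  by (simp add: completion_def)

lemma col_completion_0: "col completion 0 = x"
  using x d by (intro eq_vecI) (auto simp: completion_def unit_sphereD)

lemma col_completion_Suc: "j < d - 1 \<Longrightarrow> col completion (Suc j) = col U j"
  using U by (intro eq_vecI) (auto simp: completion_def)

lemma col_U_x: "j < d - 1 \<Longrightarrow> col U j \<bullet> x = 0"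
  using arg_cong[OF Ux, of "\<lambda>v. v $ j"] U by simp

lemma col_U_col_U: "i < d - 1 \<Longrightarrow> j < d - 1 \<Longrightarrow> col U i \<bullet> col U j = (if i = j then 1 else 0)"
  using arg_cong[OF UU, of "\<lambda>A. A $$ (i, j)"] U by simp

lemma completion_orthogonal: "completion\<^sup>T * completion = 1\<^sub>m d" "completion * completion\<^sup>T = 1\<^sub>m d"
proof -
  show *: "completion\<^sup>T * completion = 1\<^sub>m d"
  proof (rule eq_matI)
    fix i j assume "i < dim_row (1\<^sub>m d :: real mat)" "j < dim_col (1\<^sub>m d :: real mat)"
    then have ij: "i < d" "j < d" by auto
    have xc: "x \<bullet> col U k = 0" if "k < d - 1" for k
      using col_U_x[OF that] sp_comm[of x "col U k"] x U by (simp add: unit_sphereD)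
    have "(completion\<^sup>T * completion) $$ (i, j) = col completion i \<bullet> col completion j"
      using ij completion_carrier by (simp del: completion_carrier)
    also have "\<dots> = (if i = j then 1 else 0)"
      using ij x by (cases i; cases j)
        (auto simp: col_completion_0 col_completion_Suc col_U_x col_U_col_U xc unit_sphereD)
    finally show "(completion\<^sup>T * completion) $$ (i, j) = 1\<^sub>m d $$ (i, j)" using ij by simp
  qed (simp_all add: completion_def)
  show "completion * completion\<^sup>T = 1\<^sub>m d"
    by (rule mat_mult_left_right_inverse[OF _ _ *]) simp_all
qed

text \<open>In the expansion of \<open>w\<close> in the basis \<open>completion\<close> the
  coefficient of \<open>x\<close> is \<open>x \<bullet> w = 0\<close>; the remaining terms are those
  of the frame.\<close>

lemma frame_projection:
  assumes w: "w \<in> carrier_vec d" "x \<bullet> w = 0"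
  shows "U *\<^sub>v (U\<^sup>T *\<^sub>v w) = w"
proof -
  define z where "z = completion\<^sup>T *\<^sub>v w"
  have zc: "z \<in> carrier_vec d" unfolding z_def by (rule mult_mat_vec_carrier[of _ d d]) (use w in simp_all)
  have z0: "z $ 0 = 0" using w d col_completion_0 completion_carrier by (simp add: z_def del: completion_carrier)
  have zS: "z $ Suc j = (U\<^sup>T *\<^sub>v w) $ j" if "j < d - 1" for j
    using that w U col_completion_Suc[OF that] completion_carrier by (simp add: z_def del: completion_carrier)
  have "w = completion *\<^sub>v z"
  proof -
    have "completion *\<^sub>v z = (completion * completion\<^sup>T) *\<^sub>v w"
      unfolding z_def by (rule assoc_mult_mat_vec[of _ d d _ d, symmetric]) (use w in auto)
    then show ?thesis using w by (simp add: completion_orthogonal)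
  qed
  also have "\<dots> = U *\<^sub>v (U\<^sup>T *\<^sub>v w)"
  proof (rule eq_vecI)
    fix i assume "i < dim_vec (U *\<^sub>v (U\<^sup>T *\<^sub>v w))"
    then have i: "i < d" using U by simp
    obtain k where k: "d = Suc k" using d by (cases d) auto
    have "(completion *\<^sub>v z) $ i = (\<Sum>j<d. completion $$ (i, j) * z $ j)"
      using i zc by (simp add: scalar_prod_def lessThan_atLeast0 completion_def)
    also have "\<dots> = (\<Sum>j<Suc k. completion $$ (i, j) * z $ j)" by (simp only: k)
    also have "\<dots> = (\<Sum>j<k. U $$ (i, j) * (U\<^sup>T *\<^sub>v w) $ j)"
    proof -
      have "completion $$ (i, Suc j) * z $ Suc j = U $$ (i, j) * (U\<^sup>T *\<^sub>v w) $ j" if "j < k" for j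
      proof -
        have "Suc j < d" "j < d - 1" using that k by auto
        then show ?thesis using i zS[of j] by (simp add: completion_def)
      qed
      then show ?thesis using z0 by (subst sum.lessThan_Suc_shift) simp
    qed
    also have "\<dots> = (U *\<^sub>v (U\<^sup>T *\<^sub>v w)) $ i"
      using i U k by (simp add: scalar_prod_def lessThan_atLeast0)
    finally show "(completion *\<^sub>v z) $ i = (U *\<^sub>v (U\<^sup>T *\<^sub>v w)) $ i" .
  qed (use U in \<open>simp add: completion_def\<close>)
  finally show ?thesis by simp
qed

text \<open>
  In the orthonormal basis given by an eigenvector \<open>x\<close> and the frame, \<open>A\<close> is block diagonal, so the
  eigenvalues of its restriction to the orthogonal complement of \<open>x\<close> are those of \<open>A\<close> with one copy
  of \<open>l\<close> removed.
\<close>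

lemma char_poly_deflation:
  assumes A: "A \<in> carrier_mat d d" "A\<^sup>T = A" and eig: "A *\<^sub>v x = l \<cdot>\<^sub>v x"
  shows "char_poly A = [:- l, 1:] * char_poly (U\<^sup>T * A * U)"
proof -
  obtain k where k: "d = Suc k" using d by (cases d) auto
  define W where "W = completion"
  have Wc: "W \<in> carrier_mat d d" by (simp add: W_def)
  define A2 where "A2 = U\<^sup>T * A * U"
  have A2c: "A2 \<in> carrier_mat k k" using U A k by (simp add: A2_def)
  define A1 :: "real mat" where "A1 = mat 1 1 (\<lambda>_. l)"
  have ent: "(W\<^sup>T * A * W) $$ (i, j) = col W i \<bullet> (A *\<^sub>v col W j)" if "i < d" "j < d" for i j
  proof -
    have "W\<^sup>T * A * W = W\<^sup>T * (A * W)" by (rule assoc_mult_mat) (use A Wc in auto)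
    moreover have "(W\<^sup>T * (A * W)) $$ (i, j) = col W i \<bullet> col (A * W) j"
      using that A Wc by (subst index_mult_mat) auto
    ultimately show ?thesis using col_mult2[OF A(1) Wc that(2)] by simp
  qed
  have ent2: "A2 $$ (i, j) = col U i \<bullet> (A *\<^sub>v col U j)" if "i < k" "j < k" for i j
  proof -
    have "A2 = U\<^sup>T * (A * U)" unfolding A2_def by (rule assoc_mult_mat) (use A U in auto)
    moreover have "(U\<^sup>T * (A * U)) $$ (i, j) = col U i \<bullet> col (A * U) j"
      using that A U k by (subst index_mult_mat) auto
    moreover have "j < d - 1" using that k by simp
    ultimately show ?thesis using col_mult2[OF A(1) U] by simp
  qed
  have xc: "x \<in> carrier_vec d" "x \<bullet> x = 1" using x by (auto simp: unit_sphereD)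
  have Uc: "col U j \<in> carrier_vec d" if "j < k" for j using U by (intro carrier_vecI) simp
  have W0: "col W 0 = x" and WS: "\<And>j. j < k \<Longrightarrow> col W (Suc j) = col U j"
    using col_completion_0 col_completion_Suc k by (simp_all add: W_def)
  have "W\<^sup>T * A * W = four_block_mat A1 (0\<^sub>m 1 k) (0\<^sub>m k 1) A2"
  proof (rule eq_matI)
    fix i j assume "i < dim_row (four_block_mat A1 (0\<^sub>m 1 k) (0\<^sub>m k 1) A2)"
      "j < dim_col (four_block_mat A1 (0\<^sub>m 1 k) (0\<^sub>m k 1) A2)"
    then have ij: "i < Suc k" "j < Suc k" using A2c by (auto simp: A1_def)
    then have ij': "i < d" "j < d" using k by auto
    have Ax: "col U i \<bullet> (A *\<^sub>v x) = 0" if "i < k" for i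
      using eig col_U_x[of i] that k xc Uc[OF that] by (simp add: sp_simps)
    have xA: "x \<bullet> (A *\<^sub>v col U i) = 0" if "i < k" for i
      using symmetric_mat_adjoint[OF A Uc[OF that] xc(1)] Ax[OF that] by simp
    have xx: "x \<bullet> (A *\<^sub>v x) = l" using eig xc by (simp add: sp_simps)
    show "(W\<^sup>T * A * W) $$ (i, j) = four_block_mat A1 (0\<^sub>m 1 k) (0\<^sub>m k 1) A2 $$ (i, j)"
      using ij A2c ent[OF ij'] ent2 Ax xA xx W0 WS
      by (cases i; cases j) (auto simp: A1_def)
  qed (use A A2c Wc k in \<open>auto simp: A1_def\<close>)
  then have "char_poly (W\<^sup>T * A * W) = char_poly A1 * char_poly A2"
    using char_poly_four_block_zeros_col[of A1 "0\<^sub>m 1 k" k A2] A2c by (simp add: A1_def)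
  moreover have "similar_mat (W\<^sup>T * A * W) A"
  proof (rule similar_matI)
    show "{W\<^sup>T * A * W, A, W\<^sup>T, W} \<subseteq> carrier_mat d d"
      using mult_carrier_mat[OF mult_carrier_mat[of "W\<^sup>T" d d A d] Wc] A Wc by simp
  qed (use completion_orthogonal in \<open>simp_all add: W_def\<close>)
  moreover have "char_poly A1 = [:- l, 1:]"
    by (simp add: char_poly_defs A1_def det_single)
  ultimately show ?thesis using char_poly_similar A2_def by metis
qed

text \<open>The form of the compression of \<open>A\<close> is bounded by its top eigenvalue
  \<open>e\<close>. This is a root of the characteristic polynomial of \<open>A\<close> after one
  factor for \<open>es ! 0\<close> is cancelled, so it occurs in the tail of the sorted list, with
  repetitions accounted for.\<close>

lemma rayleigh_orthogonal_complement:
  assumes A: "A \<in> carrier_mat d d" "A\<^sup>T = A" and d2: "2 \<le> d"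
    and es: "eigenvalues_desc A es" and eig: "A *\<^sub>v x = (es ! 0) \<cdot>\<^sub>v x"
    and w: "w \<in> carrier_vec d" "x \<bullet> w = 0"
  shows "w \<bullet> (A *\<^sub>v w) \<le> es ! 1 * (w \<bullet> w)"
proof -
  have len: "length es = d"
    using degree_monic_char_poly[OF A(1)] es degree_linear_factors[of uminus es]
    by (simp add: eigenvalues_desc_def)
  obtain e0 e1 es' where es': "es = e0 # e1 # es'"
    using len d2 by (metis Suc_le_length_iff numeral_2_eq_2)
  define A2 where "A2 = U\<^sup>T * A * U"
  have A2c: "A2 \<in> carrier_mat (d - 1) (d - 1)" using U A by (simp add: A2_def)
  have A2s: "A2\<^sup>T = A2"
  proof -
    have "A2\<^sup>T = U\<^sup>T * (U\<^sup>T * A)\<^sup>T" unfolding A2_def by (rule transpose_mult) (use U A in auto)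
    also have "(U\<^sup>T * A)\<^sup>T = A * U" using U A by (subst transpose_mult[of _ "d - 1" d _ d]) auto
    also have "U\<^sup>T * (A * U) = A2" unfolding A2_def by (rule assoc_mult_mat[symmetric]) (use U A in auto)
    finally show ?thesis .
  qed
  obtain e where e: "eigenvalue A2 e"
      "\<And>y. y \<in> carrier_vec (d - 1) \<Longrightarrow> y \<bullet> (A2 *\<^sub>v y) \<le> e * (y \<bullet> y)"
    using rayleigh_max_eigenvalue[OF A2c A2s] d2 by auto
  have "[:- e0, 1:] * (\<Prod>e\<leftarrow>e1 # es'. [:- e, 1:]) = [:- e0, 1:] * char_poly A2"
    using char_poly_deflation[OF A, of e0] eig es by (simp add: es' eigenvalues_desc_def A2_def)
  then have "char_poly A2 = (\<Prod>e\<leftarrow>e1 # es'. [:- e, 1:])"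
    by (subst (asm) mult_left_cancel) auto
  then have "poly (\<Prod>e\<leftarrow>e1 # es'. [:- e, 1:]) e = 0"
    using e(1) eigenvalue_root_char_poly[OF A2c] by simp
  then have "e \<in> set (e1 # es')"
    by (subst (asm) poly_prod_list) (auto simp: prod_list_zero_iff)
  then have "e \<le> e1" using es by (auto simp: es' eigenvalues_desc_def)
  define y where "y = U\<^sup>T *\<^sub>v w"
  have y: "y \<in> carrier_vec (d - 1)" using U w by (simp add: y_def)
  have Uy: "U *\<^sub>v y = w" using frame_projection[OF w] by (simp add: y_def)
  have yy: "y \<bullet> y = w \<bullet> w" using isometry(3)[OF y] Uy by simp
  have "A2 *\<^sub>v y = U\<^sup>T *\<^sub>v (A *\<^sub>v w)"
  proof -
    have "A2 *\<^sub>v y = (U\<^sup>T * A) *\<^sub>v (U *\<^sub>v y)" unfolding A2_def by (rule assoc_mult_mat_vec) (use U A y in auto)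
    also have "\<dots> = U\<^sup>T *\<^sub>v (A *\<^sub>v w)" unfolding Uy by (rule assoc_mult_mat_vec) (use U A w in auto)
    finally show ?thesis .
  qed
  then have "y \<bullet> (A2 *\<^sub>v y) = (U\<^sup>T *\<^sub>v (A *\<^sub>v w)) \<bullet> y" using U y A by (subst sp_comm) auto
  also have "\<dots> = (A *\<^sub>v w) \<bullet> (U *\<^sub>v y)" by (rule transpose_vec_mult_scalar[OF U y]) (use A w in simp)
  also have "\<dots> = w \<bullet> (A *\<^sub>v w)" unfolding Uy using A w by (intro sp_comm) auto
  finally have "w \<bullet> (A *\<^sub>v w) \<le> e * (w \<bullet> w)" using e(2)[OF y] yy by simp
  also have "\<dots> \<le> e1 * (w \<bullet> w)" by (intro mult_right_mono sp_self_nonneg \<open>e \<le> e1\<close>)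
  finally show ?thesis by (simp add: es')
qed

end

section \<open>Gradient descent with an inexact gradient\<close>

lemma sph_dist_less_pi_not_antipodal:
  assumes "x \<in> unit_sphere d" "y \<in> unit_sphere d" "sph_dist x y < pi"
  shows "1 + x \<bullet> y \<noteq> 0"
  using sph_dist_bounds[OF assms(1,2)] cos_monotone_0_pi[of "sph_dist x y" pi] assms(3) by auto

text \<open>By \<open>frame_projection\<close> the map \<open>(U x)\<^sup>T\<close> preserves norms
  on the tangent space, so the guarantees of the quantizer carry over. The last claim is the
  agreement of decoders with different references: the result is the lattice point \<open>N\<close>,
  which does not see the reference.\<close>

lemma tangent_quant_bounds:
  assumes Q: "lattice_quantizer d c Q enc dec bits" and U: "tangent_frames d U" and d: "2 \<le> d"
    and x: "x \<in> unit_sphere d" and v: "v \<in> carrier_vec d" "x \<bullet> v = 0"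
    and v': "v' \<in> carrier_vec d" "x \<bullet> v' = 0" and le: "vnorm (v - v') \<le> y" and yw: "0 < y" "0 < w"
  shows "tangent_quant U Q x v v' y w \<in> carrier_vec d"
    and "x \<bullet> tangent_quant U Q x v v' y w = 0"
    and "vnorm (tangent_quant U Q x v v' y w - v) \<le> w"
    and "v'' \<in> carrier_vec d \<Longrightarrow> x \<bullet> v'' = 0 \<Longrightarrow> vnorm (v - v'') \<le> y \<Longrightarrow>
      tangent_quant U Q x v v'' y w = tangent_quant U Q x v v' y w"
proof -
  interpret tangent_frame d "U x" x
    by unfold_locales (use U x d in \<open>auto simp: tangent_frames_def\<close>)
  have Ux: "U x \<in> carrier_mat d (d - 1)" using U x by (simp add: tangent_frames_def)
  have iso: "vnorm ((U x)\<^sup>T *\<^sub>v z) = vnorm z" if "z \<in> carrier_vec d" "x \<bullet> z = 0" for z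
  proof -
    have "(U x)\<^sup>T *\<^sub>v z \<in> carrier_vec (d - 1)" using that Ux by simp
    then show ?thesis using isometry(3)[of "(U x)\<^sup>T *\<^sub>v z"] frame_projection[OF that] by (simp add: vnorm_def)
  qed
  have Utc: "(U x)\<^sup>T \<in> carrier_mat (d - 1) d" using Ux by simp
  have tc: "(U x)\<^sup>T *\<^sub>v z \<in> carrier_vec (d - 1)" if "z \<in> carrier_vec d" for z using that Ux by simp
  have adm: "vnorm ((U x)\<^sup>T *\<^sub>v v - (U x)\<^sup>T *\<^sub>v z) \<le> y"
    if z: "z \<in> carrier_vec d" "x \<bullet> z = 0" "vnorm (v - z) \<le> y" for z
  proof -
    have "(U x)\<^sup>T *\<^sub>v v - (U x)\<^sup>T *\<^sub>v z = (U x)\<^sup>T *\<^sub>v (v - z)"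
      using mat_vec_diff[OF Utc v(1) z(1)] by simp
    moreover have "x \<bullet> (v - z) = 0" using v z x by (simp add: sp_simps unit_sphereD)
    ultimately show ?thesis using z v iso[of "v - z"] by simp
  qed
  obtain L N where L: "full_lattice (d - 1) L"
    and N: "\<And>z z'. z \<in> carrier_vec (d - 1) \<Longrightarrow> N z \<in> L"
      "\<And>z z'. z \<in> carrier_vec (d - 1) \<Longrightarrow> z' \<in> carrier_vec (d - 1) \<Longrightarrow> vnorm (z - z') \<le> y \<Longrightarrow> Q z z' y w = N z"
    using Q yw unfolding lattice_quantizer_def by metis
  have Lc: "L \<subseteq> carrier_vec (d - 1)" using L by (auto simp: full_lattice_def)
  define z where "z = Q ((U x)\<^sup>T *\<^sub>v v) ((U x)\<^sup>T *\<^sub>v v') y w"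
  have z: "z = N ((U x)\<^sup>T *\<^sub>v v)"
    unfolding z_def by (rule N(2)[OF tc[OF v(1)] tc[OF v'(1)] adm[OF v' le]])
  then have zc: "z \<in> carrier_vec (d - 1)" using N(1)[OF tc[OF v(1)]] Lc by auto
  have tq: "tangent_quant U Q x v v' y w = U x *\<^sub>v z" by (simp add: tangent_quant_def z_def)
  show "tangent_quant U Q x v v' y w \<in> carrier_vec d" "x \<bullet> tangent_quant U Q x v v' y w = 0"
    unfolding tq using isometry[OF zc] by auto
  have "vnorm (z - (U x)\<^sup>T *\<^sub>v v) \<le> w"
    using Q yw tc[OF v(1)] tc[OF v'(1)] adm[OF v' le] unfolding lattice_quantizer_def z_def by blast
  moreover have "U x *\<^sub>v z - v = U x *\<^sub>v (z - (U x)\<^sup>T *\<^sub>v v)"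
    unfolding mat_vec_diff[OF Ux zc tc[OF v(1)]] frame_projection[OF v] ..
  ultimately show "vnorm (tangent_quant U Q x v v' y w - v) \<le> w"
    unfolding tq using isometry(3)[of "z - (U x)\<^sup>T *\<^sub>v v"] zc tc[OF v(1)] by (simp add: vnorm_def)
  show "tangent_quant U Q x v v'' y w = tangent_quant U Q x v v' y w"
    if "v'' \<in> carrier_vec d" "x \<bullet> v'' = 0" "vnorm (v - v'') \<le> y"
    unfolding tq using N(2)[OF tc[OF v(1)] tc[OF that(1)] adm[OF that]] by (simp add: tangent_quant_def z)
qed

text \<open>All that the descent needs from the data: the local Gram matrices \<open>B i\<close>,
  their sum \<open>A\<close>, and in \<open>orth\<close> the eigenvalue gap as a bound on the
  complement of the eigenvector. \<open>\<delta> \<le> l\<close> expresses that the second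
  eigenvalue is nonnegative.\<close>

locale pca_descent =
  fixes d n i0 :: nat and B :: "nat \<Rightarrow> real mat" and A :: "real mat" and xs :: "real vec"
    and l \<delta> \<gamma> D \<eta> :: real
  assumes d2: "2 \<le> d" and i0: "i0 < n"
    and B: "\<And>i. i < n \<Longrightarrow> psd d (B i)"
    and B_le: "\<And>i y. i < n \<Longrightarrow> y \<in> carrier_vec d \<Longrightarrow> y \<bullet> (B i *\<^sub>v y) \<le> \<gamma> / (2 * real n) * (y \<bullet> y)"
    and A: "psd d A" and A_sum: "\<And>y. y \<in> carrier_vec d \<Longrightarrow> A *\<^sub>v y = vec_sum d n (\<lambda>i. B i *\<^sub>v y)"
    and xs: "xs \<in> unit_sphere d" and eig: "A *\<^sub>v xs = l \<cdot>\<^sub>v xs"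
    and orth: "\<And>w. w \<in> carrier_vec d \<Longrightarrow> xs \<bullet> w = 0 \<Longrightarrow> w \<bullet> (A *\<^sub>v w) \<le> (l - \<delta>) * (w \<bullet> w)"
    and \<delta>: "0 < \<delta>" "\<delta> \<le> l" and D: "0 < D" "D < pi / 2" and \<eta>: "0 < \<eta>" "\<eta> \<le> cos D / \<gamma>"
begin

lemma Ac: "A \<in> carrier_mat d d" and Bc: "i < n \<Longrightarrow> B i \<in> carrier_mat d d"
  and A_sym: "A\<^sup>T = A"
  using A B by (auto simp: psd_def)

lemma n0: "0 < n" using i0 by simp

text \<open>When \<open>y\<close> is split along \<open>xs\<close>, the mixed terms vanish since
  \<open>A\<close> is symmetric and \<open>xs\<close> an eigenvector; \<open>orth\<close> bounds
  what remains.\<close>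

lemma quadratic_gap:
  assumes y: "y \<in> carrier_vec d"
  shows "y \<bullet> (A *\<^sub>v y) \<le> l * (y \<bullet> y) - \<delta> * (y \<bullet> y - (xs \<bullet> y)\<^sup>2)"
proof -
  note xd = unit_sphereD[OF xs]
  define a where "a = xs \<bullet> y"
  define w where "w = y - a \<cdot>\<^sub>v xs"
  have w: "w \<in> carrier_vec d" "xs \<bullet> w = 0" using y xd by (auto simp: w_def sp_simps a_def)
  note dims = xd(2) w(1)[THEN carrier_vecD] carrier_matD[OF Ac]
  have wx: "w \<bullet> xs = 0" using w dims sp_comm[of w xs] by simp
  have yw: "y = a \<cdot>\<^sub>v xs + w" using y xd by (intro eq_vecI) (auto simp: w_def)
  have Ay: "A *\<^sub>v y = (a * l) \<cdot>\<^sub>v xs + A *\<^sub>v w"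
    unfolding yw using Ac xd w by (simp add: mat_vec_add[of _ d d] mat_vec_smult[of _ d d] eig smult_smult_assoc)
  have xAw: "xs \<bullet> (A *\<^sub>v w) = 0"
    using symmetric_mat_adjoint[OF Ac A_sym w(1) xd(1)] wx dims by (simp add: eig sp_simps)
  have 1: "y \<bullet> (A *\<^sub>v y) = l * a\<^sup>2 + w \<bullet> (A *\<^sub>v w)"
    unfolding Ay using dims xd w wx xAw by (subst yw) (simp add: sp_simps power2_eq_square)
  have 2: "y \<bullet> y = a\<^sup>2 + w \<bullet> w"
    unfolding yw using dims xd w wx by (simp add: sp_simps power2_eq_square)
  show ?thesis
    using orth[OF w] unfolding 1 2 a_def[symmetric] by (simp add: algebra_simps)
qed

lemma A_le: "y \<in> carrier_vec d \<Longrightarrow> y \<bullet> (A *\<^sub>v y) \<le> l * (y \<bullet> y)"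
proof -
  assume y: "y \<in> carrier_vec d"
  have "(xs \<bullet> y)\<^sup>2 \<le> (xs \<bullet> xs) * (y \<bullet> y)" by (rule cauchy_schwarz_sq) (use y xs in \<open>simp add: unit_sphereD\<close>)
  then have "0 \<le> \<delta> * (y \<bullet> y - (xs \<bullet> y)\<^sup>2)" using \<delta> xs by (simp add: unit_sphereD)
  then show ?thesis using quadratic_gap[OF y] by simp
qed

lemma l_pos: "0 < l" using \<delta> by simp

text \<open>The form of \<open>A\<close> at the unit vector \<open>xs\<close> is a sum of
  \<open>n\<close> local forms, each at most \<open>\<gamma> / (2 * n)\<close>.\<close>

lemma l_le: "2 * l \<le> \<gamma>"
proof -
  note xd = unit_sphereD[OF xs]
  have "l = xs \<bullet> (A *\<^sub>v xs)" using xd by (simp add: eig sp_simps)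
  also have "\<dots> = (\<Sum>i<n. xs \<bullet> (B i *\<^sub>v xs))"
    unfolding A_sum[OF xd(1)] using mult_mat_vec_carrier[OF Bc xd(1)] xd by (intro sp_vec_sum) auto
  also have "\<dots> \<le> (\<Sum>i<n. \<gamma> / (2 * real n))"
    using B_le[OF _ xd(1)] xd by (intro sum_mono) auto
  also have "\<dots> = \<gamma> / 2" using n0 by simp
  finally show ?thesis by simp
qed

lemma \<gamma>_pos: "0 < \<gamma>" using l_le l_pos by simp

lemma cos_D: "0 < cos D" "cos D \<le> 1"
  using D by (auto intro: cos_gt_zero_pi)

lemma \<eta>\<gamma>: "\<eta> * \<gamma> \<le> cos D" "\<eta> * \<gamma> \<le> 1"
proof -
  show *: "\<eta> * \<gamma> \<le> cos D" using \<eta> \<gamma>_pos by (simp add: pos_le_divide_eq)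
  show "\<eta> * \<gamma> \<le> 1" by (rule order_trans[OF * cos_D(2)])
qed

section \<open>Contraction factor and quantization schedule\<close>

definition p :: real where "p = cos D * \<delta> * \<eta>"

text \<open>From \<open>\<delta> \<le> l \<le> \<gamma> / 2\<close> and
  \<open>\<eta> * \<gamma> \<le> 1\<close>. The quantity tested in \<open>sigma_par\<close> is
  \<open>p / 2\<close>, so its first branch applies and \<open>s\<close> stays above 1/2.\<close>

lemma p_bounds: "0 < p" "p \<le> 1 / 2"
proof -
  show "0 < p" using cos_D \<delta> \<eta> by (simp add: p_def)
  have "p \<le> 1 * (\<gamma> / 2) * \<eta>"
    unfolding p_def using cos_D \<delta> \<eta> l_le \<gamma>_pos by (intro mult_right_mono mult_mono) auto
  also have "\<dots> \<le> 1 / 2" using \<eta>\<gamma>(2) by (simp add: mult.commute)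
  finally show "p \<le> 1 / 2" .
qed

definition \<sigma> :: real where "\<sigma> = sigma_par D (\<delta> / 2) \<eta>"
definition s :: real where "s = sqrt \<sigma>"
definition \<theta> :: real where "\<theta> = theta_par \<sigma>"
definition R :: "nat \<Rightarrow> real" where "R = R_par \<gamma> \<sigma> D"
text \<open>This is \<open>sqrt_xi_par \<sigma>\<close>, the square root of the paper's \<open>\<xi>\<close>.\<close>

definition \<xi> :: real where "\<xi> = (1 + s) / 2"

lemma \<sigma>_eq: "\<sigma> = 1 - p / 2"
  using p_bounds by (simp add: \<sigma>_def sigma_par_def p_def mult_ac)

lemma s_bounds: "1 / 2 \<le> s" "s < 1" "s * s = \<sigma>"
proof -
  have "sqrt ((1 / 2)\<^sup>2) \<le> s" unfolding s_def \<sigma>_eq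
    by (rule real_sqrt_le_mono) (use p_bounds in \<open>simp add: power2_eq_square\<close>)
  then show "1 / 2 \<le> s" by simp
  show "s < 1" unfolding s_def \<sigma>_eq using p_bounds by simp
  show "s * s = \<sigma>" unfolding s_def using p_bounds by (simp add: \<sigma>_eq)
qed

text \<open>Factor \<open>1 - \<sigma> = (1 - s) * (1 + s)\<close> and use
  \<open>1 + s \<le> 2\<close>. This converts the contraction rate into the \<open>p\<close> of the
  communication bound.\<close>

lemma p_le: "p / 4 \<le> 1 - s"
proof -
  have "p / 2 = (1 - s) * (1 + s)" using s_bounds(3) by (simp add: \<sigma>_eq algebra_simps)
  also have "\<dots> \<le> (1 - s) * 2" using s_bounds by (intro mult_left_mono) auto
  finally show ?thesis by simp
qed

lemma \<theta>_eq: "\<theta> = s * (1 - s) / 4"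
  by (simp add: \<theta>_def theta_par_def s_def)

lemma \<theta>_pos: "0 < \<theta>" using s_bounds by (simp add: \<theta>_eq)

lemma K_eq: "K_par \<sigma> = 2 / s"
  by (simp add: K_par_def s_def)

lemma \<theta>K: "\<theta> * K_par \<sigma> = (1 - s) / 2"
  using s_bounds by (simp add: \<theta>_eq K_eq)

lemma R_eq: "R t = \<gamma> * K_par \<sigma> * \<xi> ^ t * D"
proof -
  have "sqrt_xi_par \<sigma> = \<xi>"
    unfolding sqrt_xi_par_def \<theta>_def[symmetric] \<theta>K s_def[symmetric] \<xi>_def by (simp add: field_simps)
  then show ?thesis by (simp add: R_def R_par_def)
qed

text \<open>The third bound is the slack of the schedule: \<open>\<xi> - s\<close> equals
  \<open>(1 - s) / 2\<close>, and \<open>\<theta>\<close> is at most half of that.\<close>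

lemma \<xi>_bounds: "0 < \<xi>" "\<xi> < 1" "\<theta> + s \<le> \<xi>"
proof -
  show "0 < \<xi>" "\<xi> < 1" using s_bounds by (auto simp: \<xi>_def)
  have "s * (1 - s) \<le> 1 * (1 - s)" using s_bounds by (intro mult_right_mono) auto
  then have "\<theta> \<le> (1 - s) / 4" by (simp add: \<theta>_eq)
  then show "\<theta> + s \<le> \<xi>" using s_bounds(2) by (simp add: \<xi>_def)
qed

lemma R_pos: "0 < R t"
  using \<gamma>_pos \<xi>_bounds D s_bounds by (simp add: R_eq K_eq)

lemma R_Suc: "R (Suc t) = \<xi> * R t"
  by (simp add: R_eq)

lemma R_s: "\<gamma> * (2 * (\<xi> ^ t * D)) = R t * s"
  using s_bounds by (simp add: R_eq K_eq)

text \<open>The first bound fits the effect of the gradient error into the gap between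
  \<open>s\<close> and \<open>\<xi>\<close>; the second keeps the step short enough for
  \<open>sph_exp_nonexpansive\<close>.\<close>

lemma \<eta>R: "\<eta> * (\<theta> * R t) \<le> (\<xi> - s) * (\<xi> ^ t * D)" "\<eta> * (\<theta> * R t) \<le> 1 / 2"
proof -
  have "\<eta> * (\<theta> * R t) = (\<eta> * \<gamma>) * ((\<theta> * K_par \<sigma>) * (\<xi> ^ t * D))" by (simp add: R_eq mult_ac)
  also have "\<dots> \<le> 1 * ((\<theta> * K_par \<sigma>) * (\<xi> ^ t * D))"
    using \<eta>\<gamma> s_bounds \<xi>_bounds D unfolding \<theta>K by (intro mult_right_mono) auto
  also have "\<theta> * K_par \<sigma> = \<xi> - s" unfolding \<theta>K \<xi>_def by (simp add: field_simps)
  finally show 1: "\<eta> * (\<theta> * R t) \<le> (\<xi> - s) * (\<xi> ^ t * D)" by simp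
  have "\<xi> ^ t * D \<le> 1 * 2"
    using \<xi>_bounds D pi_less_4 by (intro mult_mono power_le_one) auto
  then have "(\<xi> - s) * (\<xi> ^ t * D) \<le> (1 / 4) * 2"
    using s_bounds \<xi>_bounds D by (intro mult_mono) (auto simp: \<xi>_def field_simps)
  then show "\<eta> * (\<theta> * R t) \<le> 1 / 2" using 1 by simp
qed

section \<open>Local and global gradients\<close>

abbreviation g where "g \<equiv> sph_grad A"
abbreviation gi where "gi i \<equiv> sph_grad (B i)"

lemma riem_grad_gi: "i < n \<Longrightarrow> x \<in> unit_sphere d \<Longrightarrow> riem_grad d (pca_cost (B i)) x = gi i x"
  using riem_grad_pca_cost[of "B i" d x] B by (simp add: psd_def unit_sphereD)

lemma gi_tangent: "i < n \<Longrightarrow> x \<in> unit_sphere d \<Longrightarrow> gi i x \<in> carrier_vec d \<and> x \<bullet> gi i x = 0"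
  using sph_grad_tangent[OF Bc] sph_grad_carrier[OF Bc] by (simp add: unit_sphereD)

lemma g_tangent: "x \<in> unit_sphere d \<Longrightarrow> g x \<in> carrier_vec d \<and> x \<bullet> g x = 0"
  using sph_grad_tangent[OF Ac] sph_grad_carrier[OF Ac] by (simp add: unit_sphereD)

lemma g_sum:
  assumes x: "x \<in> unit_sphere d"
  shows "g x = vec_sum d n (\<lambda>i. gi i x)"
proof (rule eq_vecI)
  note xd = unit_sphereD[OF x]
  have Bx: "B i *\<^sub>v x \<in> carrier_vec d" if "i < n" for i by (rule mult_mat_vec_carrier[OF Bc[OF that] xd(1)])
  fix k assume "k < dim_vec (vec_sum d n (\<lambda>i. gi i x))"
  then have k: "k < d" by simp
  have q: "x \<bullet> (A *\<^sub>v x) = (\<Sum>i<n. x \<bullet> (B i *\<^sub>v x))"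
    unfolding A_sum[OF xd(1)] using Bx xd by (intro sp_vec_sum) auto
  have v: "(A *\<^sub>v x) $ k = (\<Sum>i<n. (B i *\<^sub>v x) $ k)"
    unfolding A_sum[OF xd(1)] using k by (simp add: vec_sum_def)
  have "g x $ k = - 2 * ((A *\<^sub>v x) $ k - (x \<bullet> (A *\<^sub>v x)) * x $ k)"
    using k xd carrier_matD[OF Ac] by (simp add: sph_grad_def del: index_mult_mat_vec)
  also have "\<dots> = (\<Sum>i<n. - 2 * ((B i *\<^sub>v x) $ k - (x \<bullet> (B i *\<^sub>v x)) * x $ k))"
    unfolding q v sum_distrib_right sum_subtractf[symmetric] sum_distrib_left ..
  also have "\<dots> = (\<Sum>i<n. gi i x $ k)"
    using k xd Bx[THEN carrier_vecD] by (intro sum.cong) (auto simp: sph_grad_def simp del: index_mult_mat_vec)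
  finally show "g x $ k = vec_sum d n (\<lambda>i. gi i x) $ k" using k by (simp add: vec_sum_def)
qed (use g_tangent[OF x] in simp)

lemma gi_le: "i < n \<Longrightarrow> x \<in> unit_sphere d \<Longrightarrow> vnorm (gi i x) \<le> \<gamma>"
proof -
  assume i: "i < n" and x: "x \<in> unit_sphere d"
  have "vnorm (gi i x) \<le> 2 * (\<gamma> / (2 * real n))"
    by (rule vnorm_sph_grad_le[OF B[OF i] B_le[OF i] _ x]) (use \<gamma>_pos in auto)
  also have "\<dots> \<le> \<gamma>" using \<gamma>_pos i by (simp add: field_simps)
  finally show ?thesis .
qed

lemma g_sq_le:
  assumes x: "x \<in> unit_sphere d"
  shows "g x \<bullet> g x \<le> 4 * (x \<bullet> (A *\<^sub>v x)) * (l - x \<bullet> (A *\<^sub>v x))"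
proof -
  have "g x \<bullet> g x \<le> 4 * (l * (x \<bullet> (A *\<^sub>v x)) - (x \<bullet> (A *\<^sub>v x))\<^sup>2)"
    using sph_grad_sq[OF Ac x] psd_mat_vec_sq_le[OF A A_le unit_sphereD(1)[OF x]] l_pos by simp
  also have "\<dots> = 4 * (x \<bullet> (A *\<^sub>v x)) * (l - x \<bullet> (A *\<^sub>v x))"
    by (simp add: power2_eq_square algebra_simps)
  finally show ?thesis .
qed

lemma g_le:
  assumes x: "x \<in> unit_sphere d"
  shows "vnorm (g x) \<le> \<gamma> / 2"
proof -
  have "0 \<le> (l - 2 * (x \<bullet> (A *\<^sub>v x)))\<^sup>2" by simp
  then have "4 * (x \<bullet> (A *\<^sub>v x)) * (l - x \<bullet> (A *\<^sub>v x)) \<le> l\<^sup>2"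
    by (simp add: power2_eq_square algebra_simps)
  then have "g x \<bullet> g x \<le> l\<^sup>2" using g_sq_le[OF x] by simp
  then have "vnorm (g x) \<le> l" using l_pos by (simp add: vnorm_le_iff)
  then show ?thesis using l_le by simp
qed

text \<open>
  Weak quasi-convexity \<open>\<langle>g x, v\<rangle> \<le> - 2 cos D (l - \<langle>x, A x\<rangle>)\<close>, with \<open>v\<close> pointing from \<open>x\<close> to \<open>xs\<close>,
  and quadratic growth \<open>l - \<langle>x, A x\<rangle> \<ge> \<delta> dist\<^sup>2 / 4\<close> make the exact step a contraction by \<open>s\<close>.
\<close>

lemma descent_step:
  assumes x: "x \<in> unit_sphere d" and dist: "sph_dist x xs \<le> D"
    and q: "q \<in> carrier_vec d" "x \<bullet> q = 0" and err: "vnorm (q - g x) \<le> \<tau>" and \<tau>: "\<eta> * \<tau> \<le> 1 / 2"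
  shows "sph_exp x ((- \<eta>) \<cdot>\<^sub>v q) \<in> unit_sphere d"
    and "sph_dist (sph_exp x ((- \<eta>) \<cdot>\<^sub>v q)) xs \<le> s * sph_dist x xs + \<eta> * \<tau>"
proof -
  note xd = unit_sphereD[OF x] and xsd = unit_sphereD[OF xs] and gt = g_tangent[OF x]
  define r where "r = sph_dist x xs"
  have r: "0 \<le> r" "r \<le> D" "cos r = x \<bullet> xs" "r < pi" "r \<le> pi / 2"
    using sph_dist_bounds[OF x xs] dist D by (auto simp: r_def)
  obtain v where v: "v \<in> carrier_vec d" "x \<bullet> v = 0" "vnorm v = r" "sph_exp x v = xs"
    using sph_log_exists[OF x xs] r by (auto simp: r_def)
  note dims = xd(2) xsd(2) q(1)[THEN carrier_vecD] v(1)[THEN carrier_vecD] gt[THEN conjunct1, THEN carrier_vecD]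
    carrier_matD[OF Ac]
  define \<beta> where "\<beta> = x \<bullet> (A *\<^sub>v x)"
  have \<beta>: "0 \<le> \<beta>" "\<beta> \<le> l" using A A_le[OF xd(1)] xd by (auto simp: \<beta>_def psd_def)
  have growth: "\<delta> * (r\<^sup>2 / 4) \<le> l - \<beta>"
  proof -
    have "xs \<bullet> x = cos r" using r dims by (simp add: sp_comm[of xs x])
    then have "\<beta> \<le> l - \<delta> * (sin r)\<^sup>2"
      using quadratic_gap[OF xd(1)] xd by (simp add: \<beta>_def sin_squared_eq)
    moreover have "(r / 2)\<^sup>2 \<le> (sin r)\<^sup>2"
      using half_le_sin[of r] r by (intro power_mono) auto
    then have "\<delta> * (r\<^sup>2 / 4) \<le> \<delta> * (sin r)\<^sup>2" using \<delta> by (simp add: power_divide)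
    ultimately show ?thesis by linarith
  qed
  \<comment> \<open>Because \<open>xs\<close> is an eigenvector, both \<open>A x\<close> and
    \<open>x\<close> have inner products with it proportional to \<open>cos r\<close>, and the gap
    \<open>l - \<beta>\<close> factors out.\<close>
  have gxs: "g x \<bullet> xs = - 2 * cos r * (l - \<beta>)"
  proof -
    have "(A *\<^sub>v x) \<bullet> xs = l * cos r"
      using symmetric_mat_adjoint[OF Ac A_sym xd(1) xsd(1)] dims sp_comm[of "A *\<^sub>v x" xs] r
      by (simp add: eig sp_simps)
    then show ?thesis using dims r by (simp add: sph_grad_def sp_simps \<beta>_def[symmetric] algebra_simps)
  qed
  have quasi: "g x \<bullet> v \<le> - 2 * cos D * (l - \<beta>)"
  proof (cases "r = 0")
    case True
    then have "v = 0\<^sub>v d" using v vnorm_eq_0 by blast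
    then have "xs = x" using v(4) dims by (intro eq_vecI) (auto simp: sph_exp_def vnorm_def)
    then have "\<beta> = l" using xd by (simp add: \<beta>_def eig[unfolded \<open>xs = x\<close>] sp_simps)
    then show ?thesis using \<open>v = 0\<^sub>v d\<close> gt by simp
  next
    case False
    then have sr: "0 < sin r" "sin r \<le> r" using r by (auto intro: sin_gt_zero sin_x_le_x)
    have gd: "dim_vec (g x) = d" using gt by simp
    have "g x \<bullet> xs = sin r / r * (g x \<bullet> v)"
      using gt gd dims(1-4) sp_comm[of "g x" x] by (subst v(4)[symmetric]) (simp add: sph_exp_def sp_simps v(3) del: carrier_vecD)
    then have "g x \<bullet> v = - (r / sin r) * (2 * cos r * (l - \<beta>))"
      using gxs sr False by (simp add: field_simps)
    moreover have "1 * (2 * cos D * (l - \<beta>)) \<le> (r / sin r) * (2 * cos r * (l - \<beta>))"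
      using sr r \<beta> cos_D D by (intro mult_mono mult_right_mono mult_left_mono cos_monotone_0_pi_le) auto
    ultimately show ?thesis by simp
  qed
  have gg: "g x \<bullet> g x \<le> 2 * \<gamma> * (l - \<beta>)"
  proof -
    have "g x \<bullet> g x \<le> 4 * \<beta> * (l - \<beta>)" using g_sq_le[OF x] by (simp add: \<beta>_def)
    also have "\<dots> \<le> 2 * \<gamma> * (l - \<beta>)" using \<beta> l_le by (intro mult_right_mono) auto
    finally show ?thesis .
  qed
  define u where "u = (- \<eta>) \<cdot>\<^sub>v g x - v"
  have uc: "u \<in> carrier_vec d" using gt v by (simp add: u_def)
  have "u \<bullet> u = \<eta> * \<eta> * (g x \<bullet> g x) + 2 * \<eta> * (g x \<bullet> v) + r\<^sup>2"
    using gt[THEN conjunct1] dims sp_comm[of v "g x"] v(3) vnorm_sq[of v] by (simp add: u_def sp_simps algebra_simps)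
  \<comment> \<open>The step size rule \<open>\<eta> * \<gamma> \<le> cos D\<close> keeps the
    quadratic term within half of the guaranteed linear decrease.\<close>
  also have "\<dots> \<le> \<eta> * (2 * cos D * (l - \<beta>)) + 2 * \<eta> * (- 2 * cos D * (l - \<beta>)) + r\<^sup>2"
  proof -
    have "\<eta> * \<eta> * (g x \<bullet> g x) \<le> \<eta> * \<eta> * (2 * \<gamma> * (l - \<beta>))" using gg \<eta> by (intro mult_left_mono) auto
    also have "\<dots> = \<eta> * (2 * (\<eta> * \<gamma>) * (l - \<beta>))" by (simp add: mult_ac)
    also have "\<dots> \<le> \<eta> * (2 * cos D * (l - \<beta>))"
      using \<eta>\<gamma>(1) \<eta> \<beta> by (intro mult_left_mono mult_right_mono) auto
    finally have "\<eta> * \<eta> * (g x \<bullet> g x) \<le> \<eta> * (2 * cos D * (l - \<beta>))" .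
    moreover have "2 * \<eta> * (g x \<bullet> v) \<le> 2 * \<eta> * (- 2 * cos D * (l - \<beta>))"
      using quasi \<eta> by (intro mult_left_mono) auto
    ultimately show ?thesis by simp
  qed
  also have "\<dots> = r\<^sup>2 - 2 * \<eta> * cos D * (l - \<beta>)" by (simp add: algebra_simps)
  also have "\<dots> \<le> r\<^sup>2 - 2 * \<eta> * cos D * (\<delta> * (r\<^sup>2 / 4))"
    using growth \<eta> cos_D by (intro diff_left_mono mult_left_mono) auto
  also have "\<dots> = (s * r)\<^sup>2"
  proof -
    have ss: "s\<^sup>2 = 1 - cos D * \<delta> * \<eta> / 2"
      using s_bounds(3) by (simp only: power2_eq_square \<sigma>_eq p_def)
    show ?thesis unfolding power_mult_distrib ss by (simp add: algebra_simps)
  qed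
  finally have un: "vnorm u \<le> s * r" using s_bounds r by (subst vnorm_le_iff) auto
  have qn: "vnorm ((- \<eta>) \<cdot>\<^sub>v q - v) \<le> s * r + \<eta> * \<tau>"
  proof -
    have "(- \<eta>) \<cdot>\<^sub>v q - (- \<eta>) \<cdot>\<^sub>v g x = (- \<eta>) \<cdot>\<^sub>v (q - g x)"
      using gt dims by (intro eq_vecI) (auto simp: algebra_simps)
    then have "vnorm ((- \<eta>) \<cdot>\<^sub>v q - (- \<eta>) \<cdot>\<^sub>v g x) \<le> \<eta> * \<tau>"
      using err \<eta> by (simp add: vnorm_smult)
    moreover have "vnorm ((- \<eta>) \<cdot>\<^sub>v q - v) \<le> vnorm ((- \<eta>) \<cdot>\<^sub>v q - (- \<eta>) \<cdot>\<^sub>v g x) + vnorm u"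
      unfolding u_def by (rule vnorm_triangle_diff) (use gt dims in auto)
    ultimately show ?thesis using un by linarith
  qed
  have qc: "(- \<eta>) \<cdot>\<^sub>v q \<in> carrier_vec d" "x \<bullet> ((- \<eta>) \<cdot>\<^sub>v q) = 0" using q dims by (auto simp: sp_simps)
  show "sph_exp x ((- \<eta>) \<cdot>\<^sub>v q) \<in> unit_sphere d" by (rule sph_exp_unit_sphere[OF x qc])
  \<comment> \<open>The exact gradient and its error may each use 1/2. Then
    \<open>1 + r \<le> 1 + pi / 2 \<le> pi\<close>, as \<open>sph_exp_nonexpansive\<close>
    demands.\<close>
  have "vnorm ((- \<eta>) \<cdot>\<^sub>v q) \<le> 1"
  proof -
    have "vnorm (q - 0\<^sub>v d) \<le> vnorm (q - g x) + vnorm (g x - 0\<^sub>v d)"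
      by (rule vnorm_triangle_diff) (use gt dims in auto)
    then have "vnorm q \<le> \<tau> + \<gamma> / 2" using err g_le[OF x] gt q by simp
    then have "\<eta> * vnorm q \<le> \<eta> * (\<tau> + \<gamma> / 2)" using \<eta> by (intro mult_left_mono) auto
    then show ?thesis using \<tau> \<eta>\<gamma>(2) \<eta> by (simp add: vnorm_smult distrib_left)
  qed
  then have "vnorm ((- \<eta>) \<cdot>\<^sub>v q) + vnorm v \<le> pi"
    using v(3) r pi_ge_two by linarith
  then have "sph_dist (sph_exp x ((- \<eta>) \<cdot>\<^sub>v q)) (sph_exp x v) \<le> vnorm ((- \<eta>) \<cdot>\<^sub>v q - v)"
    by (intro sph_exp_nonexpansive[OF x qc v(1,2)])
  then show "sph_dist (sph_exp x ((- \<eta>) \<cdot>\<^sub>v q)) xs \<le> s * sph_dist x xs + \<eta> * \<tau>"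
    using qn v(4) by (simp add: r_def)
qed

end

section \<open>The quantized run\<close>

locale quantized_pca = pca_descent +
  fixes c :: real and Q enc dec bits and U :: "real vec \<Rightarrow> real mat" and x0 :: "real vec"
  assumes Q: "lattice_quantizer d c Q enc dec bits" and U: "tangent_frames d U"
    and x0: "x0 \<in> unit_sphere d" and x0_dist: "sph_dist x0 xs \<le> D"
begin

abbreviation QT where "QT \<equiv> tangent_quant U Q"

lemmas QT_bounds = tangent_quant_bounds[OF Q U d2]

abbreviation run where
  "run \<equiv> qrgd_run d n i0 (\<lambda>i. pca_cost (B i)) QT \<gamma> \<eta> \<theta> R x0"

lemma radii_pos: "0 < y_up n \<gamma> R t" "0 < w_up n \<theta> R t" "0 < y_down \<gamma> \<theta> R t" "0 < w_down \<theta> R t"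
  using R_pos[of t] \<theta>_pos \<gamma>_pos n0
  by (auto simp: y_up_def w_up_def y_down_def w_down_def intro!: add_pos_pos mult_pos_pos divide_pos_pos)

definition uploads :: "nat \<Rightarrow> real vec \<Rightarrow> (nat \<Rightarrow> real vec) \<Rightarrow> bool" where
  "uploads t x qi \<longleftrightarrow> (\<forall>i<n. qi i \<in> carrier_vec d \<and> x \<bullet> qi i = 0 \<and> vnorm (qi i - gi i x) \<le> w_up n \<theta> R t)"

text \<open>The local messages are included because they are the references of the next round. The
  error \<open>\<theta> * R t\<close> is composed of \<open>n\<close> upload accuracies
  \<open>w_up\<close> and one \<open>w_down\<close>.\<close>

definition invariant :: "nat \<Rightarrow> real vec \<Rightarrow> (nat \<Rightarrow> real vec) \<Rightarrow> real vec \<Rightarrow> bool" where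
  "invariant t x qi q \<longleftrightarrow> x \<in> unit_sphere d \<and> sph_dist x xs \<le> \<xi> ^ t * D \<and> uploads t x qi \<and>
     q \<in> carrier_vec d \<and> x \<bullet> q = 0 \<and> vnorm (q - g x) \<le> \<theta> * R t"

lemma uploads_sum:
  assumes x: "x \<in> unit_sphere d" and up: "uploads t x qi"
  shows "vec_sum d n qi \<in> carrier_vec d" "x \<bullet> vec_sum d n qi = 0"
    "vnorm (vec_sum d n qi - g x) \<le> \<theta> * R t / 2"
proof -
  have qi: "qi i \<in> carrier_vec d" "x \<bullet> qi i = 0" "vnorm (qi i - gi i x) \<le> w_up n \<theta> R t" if "i < n" for i
    using up that by (auto simp: uploads_def)
  show "vec_sum d n qi \<in> carrier_vec d" by simp
  show "x \<bullet> vec_sum d n qi = 0" using sp_vec_sum[OF qi(1)] x qi(2) by (simp add: unit_sphereD)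
  have gic: "gi i x \<in> carrier_vec d" if "i < n" for i using gi_tangent[OF that x] by simp
  have "vnorm (vec_sum d n qi - g x) \<le> (\<Sum>i<n. vnorm (qi i - gi i x))"
    unfolding g_sum[OF x] using qi(1) gic by (subst vec_sum_diff) (auto intro!: vnorm_vec_sum_le)
  also have "\<dots> \<le> (\<Sum>i<n. w_up n \<theta> R t)" using qi(3) by (intro sum_mono) auto
  also have "\<dots> = \<theta> * R t / 2" using n0 by (simp add: w_up_def)
  finally show "vnorm (vec_sum d n qi - g x) \<le> \<theta> * R t / 2" .
qed

lemma download_error:
  assumes x: "x \<in> unit_sphere d" and up: "uploads t x qi" and q: "q \<in> carrier_vec d"
    and err: "vnorm (q - vec_sum d n qi) \<le> w_down \<theta> R t"
  shows "vnorm (q - g x) \<le> \<theta> * R t"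
proof -
  have "vnorm (q - g x) \<le> vnorm (q - vec_sum d n qi) + vnorm (vec_sum d n qi - g x)"
    by (rule vnorm_triangle_diff) (use q g_tangent[OF x] in auto)
  then show ?thesis using err uploads_sum(3)[OF x up] by (simp add: w_down_def)
qed

section \<open>The initial round\<close>

lemma initial_radius_up:
  assumes "i < n"
  shows "vnorm (gi i x0 - gi i0 x0) \<le> y_up n \<gamma> R 0"
proof -
  have "vnorm (gi i x0 - gi i0 x0) \<le> vnorm (gi i x0 - 0\<^sub>v d) + vnorm (0\<^sub>v d - gi i0 x0)"
    by (rule vnorm_triangle_diff) (use gi_tangent[OF _ x0] assms i0 in auto)
  also have "\<dots> = vnorm (gi i x0) + vnorm (gi i0 x0)"
    using gi_tangent[OF assms x0] gi_tangent[OF i0 x0] by simp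
  also have "\<dots> \<le> 2 * \<gamma>" using gi_le[OF assms x0] gi_le[OF i0 x0] by simp
  also have "\<dots> \<le> 2 * \<gamma> * pi" using \<gamma>_pos pi_ge_two by simp
  finally show ?thesis by (simp add: y_up_def)
qed

lemma initial_radius_down:
  assumes i: "i < n" and up: "uploads 0 x0 qi"
  shows "vnorm (vec_sum d n qi - gi i x0) \<le> y_down \<gamma> \<theta> R 0"
proof -
  note gt = g_tangent[OF x0] and git = gi_tangent[OF i x0]
  have "vnorm (vec_sum d n qi - gi i x0) \<le> vnorm (vec_sum d n qi - g x0) + vnorm (g x0 - gi i x0)"
    by (rule vnorm_triangle_diff) (use gt git in auto)
  also have "vnorm (g x0 - gi i x0) \<le> vnorm (g x0 - 0\<^sub>v d) + vnorm (0\<^sub>v d - gi i x0)"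
    by (rule vnorm_triangle_diff) (use gt git in auto)
  also have "\<dots> = vnorm (g x0) + vnorm (gi i x0)" using gt git by simp
  also have "\<dots> \<le> 2 * \<gamma>" using g_le[OF x0] gi_le[OF i x0] \<gamma>_pos by simp
  also have "\<dots> \<le> 2 * \<gamma> * pi" using \<gamma>_pos pi_ge_two by simp
  finally show ?thesis using uploads_sum(3)[OF x0 up] by (simp add: y_down_def)
qed

lemma initial_uploads:
  assumes "\<And>i. i < n \<Longrightarrow> qi i = QT x0 (gi i x0) (gi i0 x0) (y_up n \<gamma> R 0) (w_up n \<theta> R 0)"
  shows "uploads 0 x0 qi"
  unfolding uploads_def
proof (intro allI impI)
  fix i assume i: "i < n"
  show "qi i \<in> carrier_vec d \<and> x0 \<bullet> qi i = 0 \<and> vnorm (qi i - gi i x0) \<le> w_up n \<theta> R 0"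
    unfolding assms[OF i]
    using QT_bounds(1-3)[OF x0 _ _ _ _ initial_radius_up[OF i] radii_pos(1,2)]
      gi_tangent[OF i x0] gi_tangent[OF i0 x0] by blast
qed

text \<open>The second claim makes the initialization consistent: each machine decodes with its own
  gradient as reference, and all of these are within the radius, so the same vector results.\<close>

lemma initial_download:
  assumes i: "i < n" and up: "uploads 0 x0 qi"
  defines "q \<equiv> QT x0 (vec_sum d n qi) (gi i x0) (y_down \<gamma> \<theta> R 0) (w_down \<theta> R 0)"
  shows "invariant 0 x0 qi q"
    and "j < n \<Longrightarrow> QT x0 (vec_sum d n qi) (gi j x0) (y_down \<gamma> \<theta> R 0) (w_down \<theta> R 0) = q"
proof -
  note r = uploads_sum[OF x0 up] and git = gi_tangent[OF i x0]
  note b = QT_bounds[OF x0 r(1,2) _ _ initial_radius_down[OF i up] radii_pos(3,4)]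
  have q: "q \<in> carrier_vec d" "x0 \<bullet> q = 0" "vnorm (q - vec_sum d n qi) \<le> w_down \<theta> R 0"
    unfolding q_def using b(1-3) git by blast+
  show "invariant 0 x0 qi q"
    unfolding invariant_def using x0 x0_dist up q download_error[OF x0 up q(1,3)] by simp
  show "QT x0 (vec_sum d n qi) (gi j x0) (y_down \<gamma> \<theta> R 0) (w_down \<theta> R 0) = q" if "j < n"
    unfolding q_def using b(4) git gi_tangent[OF that x0] initial_radius_down[OF that up] by blast
qed

text \<open>The distance bound is \<open>s * a + (\<xi> - s) * a = \<xi> * a\<close> with
  \<open>a = \<xi> ^ t * D\<close>. The step has length \<open>r \<le> 2 * a\<close>, so
  \<open>\<gamma> * r \<le> s * R t\<close>, and \<open>\<theta> + s \<le> \<xi>\<close> puts the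
  transported messages within the decoding radii of round \<open>Suc t\<close>.\<close>

lemma invariant_Suc:
  assumes inv: "invariant t x qi q"
  defines "x' \<equiv> sph_exp x ((- \<eta>) \<cdot>\<^sub>v q)"
  assumes qi': "\<And>i. i < n \<Longrightarrow> qi' i =
      QT x' (gi i x') (parallel_transport d x x' (qi i)) (y_up n \<gamma> R (Suc t)) (w_up n \<theta> R (Suc t))"
    and q': "q' = QT x' (vec_sum d n qi') (parallel_transport d x x' q)
      (y_down \<gamma> \<theta> R (Suc t)) (w_down \<theta> R (Suc t))"
  shows "invariant (Suc t) x' qi' q'"
proof -
  have x: "x \<in> unit_sphere d" and xd: "sph_dist x xs \<le> \<xi> ^ t * D"
    and q: "q \<in> carrier_vec d" "x \<bullet> q = 0" "vnorm (q - g x) \<le> \<theta> * R t"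
    and qi: "\<And>i. i < n \<Longrightarrow> qi i \<in> carrier_vec d \<and> x \<bullet> qi i = 0 \<and> vnorm (qi i - gi i x) \<le> w_up n \<theta> R t"
    using inv by (auto simp: invariant_def uploads_def)
  define a where "a = \<xi> ^ t * D"
  have a0: "0 < a" using \<xi>_bounds D by (simp add: a_def)
  have aD: "a \<le> D" using \<xi>_bounds D by (simp add: a_def power_le_one mult_left_le_one_le)
  have "sph_dist x xs \<le> D" using xd aD by (simp add: a_def)
  note step = descent_step[OF x this q(1,2,3) \<eta>R(2), folded x'_def]
  have x': "x' \<in> unit_sphere d" by (rule step(1))
  have "sph_dist x' xs \<le> s * a + (\<xi> - s) * a"
  proof -
    have "s * sph_dist x xs \<le> s * a" using xd s_bounds by (intro mult_left_mono) (auto simp: a_def)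
    then show ?thesis using step(2) \<eta>R(1)[of t] by (simp add: a_def)
  qed
  then have x'd: "sph_dist x' xs \<le> \<xi> * a" by (simp add: algebra_simps)
  define r where "r = sph_dist x x'"
  have "r \<le> sph_dist x xs + sph_dist xs x'" unfolding r_def by (rule sph_dist_triangle[OF x xs x'])
  also have "\<dots> \<le> a + \<xi> * a" using xd x'd sph_dist_comm[OF xs x'] by (simp add: a_def)
  also have "\<dots> \<le> 2 * a" using \<xi>_bounds a0 by (simp add: mult_left_le_one_le)
  finally have r: "r \<le> 2 * a" .
  \<comment> \<open>This is where \<open>D < pi / 2\<close> excludes antipodal consecutive iterates,
    so that transport between them is determined.\<close>
  then have rpi: "sph_dist x x' < pi" using aD D by (simp add: r_def)
  note na = sph_dist_less_pi_not_antipodal[OF x x' rpi]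
  have \<gamma>r: "\<gamma> * r \<le> R t * s"
    using mult_left_mono[OF r, of \<gamma>] \<gamma>_pos R_s[of t] by (simp add: a_def)
  \<comment> \<open>Transport is a linear isometry: the quantization error of the old message is
    carried over with its size, and only the Lipschitz error is added.\<close>
  have transport_error: "sph_transport x x' u \<in> carrier_vec d \<and> x' \<bullet> sph_transport x x' u = 0 \<and>
      vnorm (G' - sph_transport x x' u) \<le> e1 + e2"
    if u: "u \<in> carrier_vec d" "x \<bullet> u = 0" and G: "G \<in> carrier_vec d" "x \<bullet> G = 0" and G': "G' \<in> carrier_vec d"
      and e1: "vnorm (G' - sph_transport x x' G) \<le> e1" and e2: "vnorm (u - G) \<le> e2" for u G G' e1 e2
  proof -
    note xc = unit_sphereD(1)[OF x] unit_sphereD(1)[OF x']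
    note Tc = sph_transport_carrier[OF xc u(1)] sph_transport_carrier[OF xc G(1)]
    have Gu: "G - u \<in> carrier_vec d" "x \<bullet> (G - u) = 0"
      using u G xc by (auto simp: sp_simps)
    have "vnorm (G' - sph_transport x x' u) \<le> vnorm (G' - sph_transport x x' G) +
        vnorm (sph_transport x x' G - sph_transport x x' u)"
      by (rule vnorm_triangle_diff) (use G' Tc in auto)
    also have "sph_transport x x' G - sph_transport x x' u = sph_transport x x' (G - u)"
      by (rule sph_transport_diff[OF x x' G(1) u(1)])
    also have "vnorm \<dots> = vnorm (u - G)"
      using vnorm_sph_transport[OF x x' Gu na] vnorm_diff_comm[of u G] u G by simp
    finally show ?thesis using e1 e2 sph_transport_tangent[OF x x' u na] Tc by simp
  qed
  have up: "uploads (Suc t) x' qi'"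
    unfolding uploads_def
  proof (intro allI impI)
    fix i assume i: "i < n"
    note qii = qi[OF i] and g1 = gi_tangent[OF i x] and g2 = gi_tangent[OF i x']
    have PT: "parallel_transport d x x' (qi i) = sph_transport x x' (qi i)"
      using parallel_transport_eq[OF x x' rpi] qii by blast
    have "vnorm (gi i x' - sph_transport x x' (gi i x)) \<le> 2 * (\<gamma> / (2 * real n)) * r"
      unfolding r_def by (rule sph_grad_lipschitz[OF B[OF i] B_le[OF i] _ x x' rpi]) (use \<gamma>_pos in auto)
    then have "vnorm (gi i x' - sph_transport x x' (gi i x)) \<le> \<gamma> * r / real n" by simp
    from transport_error[OF _ _ _ _ _ this, of "qi i" "w_up n \<theta> R t"] qii g1 g2
    have T: "sph_transport x x' (qi i) \<in> carrier_vec d" "x' \<bullet> sph_transport x x' (qi i) = 0"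
      "vnorm (gi i x' - sph_transport x x' (qi i)) \<le> \<gamma> * r / real n + w_up n \<theta> R t" by auto
    have "\<gamma> * r / real n + w_up n \<theta> R t = (\<gamma> * r + \<theta> * R t / 2) / real n"
      using n0 by (simp add: w_up_def field_simps)
    also have "\<dots> \<le> R (Suc t) / real n"
    proof (rule divide_right_mono)
      have "\<theta> / 2 * R t + s * R t \<le> \<xi> * R t"
        unfolding distrib_right[symmetric] using \<xi>_bounds \<theta>_pos R_pos[of t] by (intro mult_right_mono) auto
      then show "\<gamma> * r + \<theta> * R t / 2 \<le> R (Suc t)" using \<gamma>r by (simp add: R_Suc mult.commute)
    qed simp
    finally have "vnorm (gi i x' - sph_transport x x' (qi i)) \<le> y_up n \<gamma> R (Suc t)"
      using T(3) by (simp add: y_up_def)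
    note b = QT_bounds(1-3)[OF x' _ _ T(1,2) this radii_pos(1,2)]
    show "qi' i \<in> carrier_vec d \<and> x' \<bullet> qi' i = 0 \<and> vnorm (qi' i - gi i x') \<le> w_up n \<theta> R (Suc t)"
      unfolding qi'[OF i] PT using b g2 by blast
  qed
  note rs = uploads_sum[OF x' up] and g1 = g_tangent[OF x] and g2 = g_tangent[OF x']
  have PT: "parallel_transport d x x' q = sph_transport x x' q"
    by (rule parallel_transport_eq[OF x x' rpi q(1,2)])
  have "vnorm (g x' - sph_transport x x' (g x)) \<le> 2 * l * r"
    unfolding r_def by (rule sph_grad_lipschitz[OF A A_le _ x x' rpi]) (use l_pos in auto)
  also have "\<dots> \<le> \<gamma> * r"
    using l_le sph_dist_bounds(1)[OF x x'] by (intro mult_right_mono) (auto simp: r_def)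
  finally have "vnorm (g x' - sph_transport x x' (g x)) \<le> \<gamma> * r" .
  from transport_error[OF q(1,2) _ _ _ this q(3)] g1 g2
  have T: "sph_transport x x' q \<in> carrier_vec d" "x' \<bullet> sph_transport x x' q = 0"
    "vnorm (g x' - sph_transport x x' q) \<le> \<gamma> * r + \<theta> * R t" by auto
  have "vnorm (vec_sum d n qi' - sph_transport x x' q) \<le>
      vnorm (vec_sum d n qi' - g x') + vnorm (g x' - sph_transport x x' q)"
    by (rule vnorm_triangle_diff) (use g2 T in auto)
  also have "\<dots> \<le> \<theta> * R (Suc t) / 2 + (R t * s + \<theta> * R t)"
    using rs(3) T(3) \<gamma>r by simp
  also have "R t * s + \<theta> * R t \<le> R (Suc t)"
    using mult_right_mono[OF \<xi>_bounds(3), of "R t"] R_pos[of t] by (simp add: R_Suc algebra_simps)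
  finally have "vnorm (vec_sum d n qi' - sph_transport x x' q) \<le> y_down \<gamma> \<theta> R (Suc t)"
    by (simp add: y_down_def algebra_simps)
  note b = QT_bounds(1-3)[OF x' rs(1,2) T(1,2) this radii_pos(3,4)]
  have q'b: "q' \<in> carrier_vec d" "x' \<bullet> q' = 0" "vnorm (q' - vec_sum d n qi') \<le> w_down \<theta> R (Suc t)"
    unfolding q' PT using b by blast+
  have "sph_dist x' xs \<le> \<xi> ^ Suc t * D" using x'd by (simp add: a_def mult_ac)
  then show ?thesis
    unfolding invariant_def using x' up q'b download_error[OF x' up q'b(1,3)] by blast
qed

lemma run_invariant:
  assumes "run x qi r q"
  shows "invariant t (x t) (qi t) (q t)"
proof (induction t)
  case 0
  have x: "x 0 = x0" using assms by (simp add: qrgd_run_def)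
  have "uploads 0 x0 (qi 0)"
    by (rule initial_uploads) (use assms riem_grad_gi[OF _ x0] i0 in \<open>auto simp: qrgd_run_def\<close>)
  moreover have "q 0 = QT x0 (vec_sum d n (qi 0)) (gi i0 x0) (y_down \<gamma> \<theta> R 0) (w_down \<theta> R 0)"
    using assms riem_grad_gi[OF i0 x0] i0 by (auto simp: qrgd_run_def vec_sum_def)
  ultimately show ?case using initial_download(1)[OF i0] x by simp
next
  case (Suc t)
  have x: "x (Suc t) = sph_exp (x t) ((- \<eta>) \<cdot>\<^sub>v q t)" using assms by (simp add: qrgd_run_def)
  \<comment> \<open>Membership in the sphere has to be known before the gradients in the run can be
    replaced by their closed forms.\<close>
  have "sph_exp (x t) ((- \<eta>) \<cdot>\<^sub>v q t) \<in> unit_sphere d"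
    using Suc unit_sphereD(2)[of "x t" d]
    by (intro sph_exp_unit_sphere) (auto simp: invariant_def sp_simps)
  note rg = riem_grad_gi[OF _ this, folded x]
  show ?case
    unfolding x
  proof (rule invariant_Suc[OF Suc]; unfold x[symmetric])
    fix i assume i: "i < n"
    show "qi (Suc t) i = QT (x (Suc t)) (gi i (x (Suc t))) (parallel_transport d (x t) (x (Suc t)) (qi t i))
        (y_up n \<gamma> R (Suc t)) (w_up n \<theta> R (Suc t))"
      using assms i rg[OF i] by (simp add: qrgd_run_def)
  next
    show "q (Suc t) = QT (x (Suc t)) (vec_sum d n (qi (Suc t))) (parallel_transport d (x t) (x (Suc t)) (q t))
        (y_down \<gamma> \<theta> R (Suc t)) (w_down \<theta> R (Suc t))"
      using assms by (simp add: qrgd_run_def vec_sum_def)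
  qed
qed

lemma run_dist: "run x qi r q \<Longrightarrow> sph_dist (x t) xs \<le> \<xi> ^ t * D"
  using run_invariant by (simp add: invariant_def)

text \<open>Primitive recursion on the triple of iterate, local messages and broadcast vector. The
  one requirement that is not a recursion equation, agreement of all machines on \<open>q 0\<close>,
  is \<open>initial_download(2)\<close>.\<close>

lemma run_exists: "\<exists>x qi r q. run x qi r q"
proof -
  define qi0 where "qi0 i = QT x0 (gi i x0) (gi i0 x0) (y_up n \<gamma> R 0) (w_up n \<theta> R 0)" for i
  define q0 where "q0 = QT x0 (vec_sum d n qi0) (gi i0 x0) (y_down \<gamma> \<theta> R 0) (w_down \<theta> R 0)"
  define step where "step = (\<lambda>t (x, qi, q).
     let x' = sph_exp x ((- \<eta>) \<cdot>\<^sub>v q);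
         qi' = (\<lambda>i. QT x' (riem_grad d (pca_cost (B i)) x') (parallel_transport d x x' (qi i))
                  (y_up n \<gamma> R (Suc t)) (w_up n \<theta> R (Suc t)))
     in (x', qi', QT x' (vec_sum d n qi') (parallel_transport d x x' q)
                  (y_down \<gamma> \<theta> R (Suc t)) (w_down \<theta> R (Suc t))))"
  define st where "st = rec_nat (x0, qi0, q0) step"
  define x where "x t = fst (st t)" for t
  define qi where "qi t = fst (snd (st t))" for t
  define q where "q t = snd (snd (st t))" for t
  have st: "st t = (x t, qi t, q t)" for t by (simp add: x_def qi_def q_def)
  have S: "st (Suc t) = step t (x t, qi t, q t)" for t using st[of t] by (simp add: st_def)
  have up: "uploads 0 x0 qi0" by (rule initial_uploads) (simp add: qi0_def)
  have z: "x 0 = x0" "qi 0 = qi0" "q 0 = q0" by (simp_all add: x_def qi_def q_def st_def)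
  have "run x qi (\<lambda>t. vec_sum d n (qi t)) q"
    unfolding qrgd_run_def
  proof (intro conjI allI impI)
    show "x 0 = x0" by (rule z)
    show "qi 0 i = QT (x 0) (riem_grad d (pca_cost (B i)) (x 0)) (riem_grad d (pca_cost (B i0)) (x 0))
        (y_up n \<gamma> R 0) (w_up n \<theta> R 0)" if "i < n" for i
      using that i0 by (simp add: z qi0_def riem_grad_gi[OF _ x0])
    show "q 0 = QT (x 0) (vec_sum d n (qi 0)) (riem_grad d (pca_cost (B i)) (x 0))
        (y_down \<gamma> \<theta> R 0) (w_down \<theta> R 0)" if "i < n" for i
      using that initial_download(2)[OF i0 up that] by (simp add: z q0_def riem_grad_gi[OF _ x0])
    show "vec_sum d n (qi t) = vec d (\<lambda>k. \<Sum>i<n. qi t i $ k)" for t by (simp add: vec_sum_def)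
    show "x (Suc t) = sph_exp (x t) ((- \<eta>) \<cdot>\<^sub>v q t)" for t
      using S[of t] st[of "Suc t"] by (simp add: step_def Let_def)
    show "qi (Suc t) i = QT (x (Suc t)) (riem_grad d (pca_cost (B i)) (x (Suc t)))
        (parallel_transport d (x t) (x (Suc t)) (qi t i)) (y_up n \<gamma> R (Suc t)) (w_up n \<theta> R (Suc t))" for t i
      using S[of t] st[of "Suc t"] by (simp add: step_def Let_def)
    show "q (Suc t) = QT (x (Suc t)) (vec_sum d n (qi (Suc t)))
        (parallel_transport d (x t) (x (Suc t)) (q t)) (y_down \<gamma> \<theta> R (Suc t)) (w_down \<theta> R (Suc t))" for t
      using S[of t] st[of "Suc t"] by (simp add: step_def Let_def)
  qed
  then show ?thesis by blast
qed

end

section \<open>The number of bits\<close>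

context quantized_pca
begin

text \<open>Since \<open>p \<le> 1 / 2\<close> and \<open>n \<ge> 1\<close>, the ratio
  \<open>n / p\<close> is at least 2; its logarithm can therefore absorb absolute constants.\<close>

lemma ln_n_p: "1 / 2 \<le> ln (2 :: real)" "ln 2 \<le> ln (real n / p)"
proof -
  have "ln (1 / 2 :: real) \<le> 1 / 2 - 1" by (rule ln_le_minus_one) simp
  then show "1 / 2 \<le> ln (2 :: real)" by (simp add: ln_div)
  have "2 * p \<le> 1 * 1" using p_bounds by simp
  also have "\<dots> \<le> real n" using n0 by simp
  finally have "2 \<le> real n / p" using p_bounds by (simp add: field_simps)
  then show "ln 2 \<le> ln (real n / p)" using p_bounds n0 by simp
qed

text \<open>As \<open>256 = 2 ^ 8\<close>, the constant costs \<open>8 * ln 2\<close>, at most eight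
  times \<open>ln (n / p)\<close>; the cut-off at 1 is below \<open>2 * ln 2\<close>. The factor
  \<open>b\<close> carries the extra \<open>1 / D\<close> of round 0.\<close>

lemma bits_le:
  assumes c: "0 \<le> c" and yw: "0 < y" "0 < w" "1 < y / w" and le: "y / w \<le> 256 * (real n / p) * b" and b: "0 < b"
  shows "real (bits y w) \<le> c * real d * (9 * ln (real n / p) + max 0 (ln b))"
proof -
  have np: "0 < real n / p" using n0 p_bounds by simp
  have "ln (y / w) \<le> ln (256 * (real n / p) * b)" using yw le by (intro ln_mono) auto
  also have "\<dots> = ln 256 + ln (real n / p) + ln b" 
  proof -
    have "ln (256 * (real n / p) * b) = ln (256 * (real n / p)) + ln b"
      by (rule ln_mult_pos) (use np b in auto)
    also have "ln (256 * (real n / p)) = ln 256 + ln (real n / p)"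
      by (rule ln_mult_pos) (use np in auto)
    finally show ?thesis .
  qed
  also have "ln (256 :: real) = 8 * ln 2" using ln_realpow[of 2 8] by simp
  finally have "max 1 (ln (y / w)) \<le> 9 * ln (real n / p) + max 0 (ln b)"
    using ln_n_p by linarith
  moreover have "real (bits y w) \<le> c * real d * max 1 (ln (y / w))"
    using Q yw by (simp add: lattice_quantizer_def)
  ultimately show ?thesis using c by (meson mult_left_mono mult_nonneg_nonneg of_nat_0_le_iff order_trans)
qed

lemma inverse_\<theta>_bounds: "8 \<le> 1 / \<theta>" "1 / \<theta> \<le> 32 / p"
proof -
  have "s * (1 - s) \<le> 1 * (1 / 2)" using s_bounds by (intro mult_mono) auto
  then show "8 \<le> 1 / \<theta>" using \<theta>_pos by (simp add: \<theta>_eq field_simps)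
  have "1 / 2 * (p / 4) \<le> s * (1 - s)" using s_bounds p_le p_bounds by (intro mult_mono) auto
  then have "p / 32 \<le> \<theta>" by (simp add: \<theta>_eq)
  then show "1 / \<theta> \<le> 32 / p" using p_bounds \<theta>_pos by (simp add: field_simps)
qed

text \<open>For \<open>t > 0\<close> the radius and the accuracy both scale with \<open>R t\<close>,
  and their ratio is \<open>2 / \<theta>\<close> or \<open>1 + 2 / \<theta>\<close>, of order
  \<open>1 / p\<close>. In round 0 the accuracy shrinks with \<open>D\<close> while the radius stays
  above \<open>2 * \<gamma> * pi\<close>.\<close>

lemma round_bits_le:
  assumes c: "0 \<le> c"
  shows "real (bits (y_up n \<gamma> R t) (w_up n \<theta> R t)) \<le>
      c * real d * (9 * ln (real n / p) + (if t = 0 then max 0 (ln (1 / D)) else 0))"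
    and "real (bits (y_down \<gamma> \<theta> R t) (w_down \<theta> R t)) \<le>
      c * real d * (9 * ln (real n / p) + (if t = 0 then max 0 (ln (1 / D)) else 0))"
proof -
  define b where "b = (if t = 0 then 1 / D else 1)"
  have b0: "0 < b" using D by (simp add: b_def)
  have max_b: "max 0 (ln b) = (if t = 0 then max 0 (ln (1 / D)) else 0)" by (simp add: b_def)
  have n1: "1 \<le> real n" using n0 by simp
  have p1: "1 \<le> 1 / p" using p_bounds by simp
  have np: "1 / p \<le> real n / p" using n1 p_bounds by (simp add: divide_right_mono)
  \<comment> \<open>The first conjunct lets the summand 1 of the last one be absorbed when 128 is
    raised to the 256 of \<open>bits_le\<close>.\<close>
  have "1 \<le> 1 / p * b \<and> 1 < y_up n \<gamma> R t / w_up n \<theta> R t \<and>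
      y_up n \<gamma> R t / w_up n \<theta> R t \<le> 128 * (real n / p) * b \<and>
      1 < y_down \<gamma> \<theta> R t / w_down \<theta> R t \<and>
      y_down \<gamma> \<theta> R t / w_down \<theta> R t \<le> 1 + 128 * (1 / p) * b"
  proof (cases "t = 0")
    case False
    define i where "i = 1 / \<theta>"
    have "y_up n \<gamma> R t / w_up n \<theta> R t = 2 * i"
      using False R_pos[of t] \<theta>_pos n0 by (simp add: y_up_def w_up_def i_def)
    moreover have "y_down \<gamma> \<theta> R t / w_down \<theta> R t = 1 + 2 * i"
      using False R_pos[of t] \<theta>_pos by (simp add: y_down_def w_down_def i_def field_simps)
    moreover have "8 \<le> i" "i \<le> 32 * (1 / p)" using inverse_\<theta>_bounds by (simp_all add: i_def)
    moreover have "b = 1" using False by (simp add: b_def)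
    ultimately show ?thesis using p1 np by simp
  next
    case True
    have D2: "D < 2" using D pi_less_4 by simp
    have \<theta>R: "\<theta> * R 0 = \<gamma> * ((1 - s) / 2 * D)" using \<theta>K by (simp add: R_eq mult_ac)
    \<comment> \<open>The radius \<open>2 * \<gamma> * pi\<close> divided by
      \<open>w_down \<theta> R 0\<close>.\<close>
    define z where "z = 8 * pi * (1 / (1 - s) * (1 / D))"
    have z: "8 \<le> z"
    proof -
      have "1 * (1 / 2) \<le> 1 / (1 - s) * (1 / D)"
        using s_bounds D D2 by (intro mult_mono) (auto simp: field_simps)
      then have "8 * pi * (1 / 2) \<le> z" unfolding z_def using pi_gt_zero by (intro mult_left_mono) auto
      then show ?thesis using pi_ge_two by linarith
    qed
    have "1 / (1 - s) \<le> 4 * (1 / p)" using p_le p_bounds s_bounds by (simp add: field_simps)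
    then have "z \<le> 8 * 4 * (4 * (1 / p) * (1 / D))"
      unfolding z_def using pi_less_4 s_bounds D p_bounds by (intro mult_mono mult_right_mono) auto
    then have z': "z \<le> 128 * (1 / p) * (1 / D)" by simp
    have "y_up n \<gamma> R t / w_up n \<theta> R t = real n * z"
      using True s_bounds D \<gamma>_pos n0 by (simp add: y_up_def w_up_def \<theta>R z_def field_simps)
    moreover have "y_down \<gamma> \<theta> R t / w_down \<theta> R t = 1 + z"
      using True s_bounds D \<gamma>_pos by (simp add: y_down_def w_down_def \<theta>R z_def field_simps)
    moreover have "1 < real n * z" using mult_mono[OF n1, of 8 z] z by simp
    moreover have "real n * z \<le> 128 * (real n / p) * (1 / D)"
      using mult_left_mono[OF z', of "real n"] by (simp add: mult_ac)
    moreover have "2 * (1 / 2) \<le> 1 / p * (1 / D)"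
      using p_bounds D D2 by (intro mult_mono) (auto simp: field_simps)
    ultimately show ?thesis using z z' True by (simp add: b_def)
  qed
  note * = this
  have nb: "1 / p * b \<le> real n / p * b" using np b0 by (intro mult_right_mono) auto
  show "real (bits (y_up n \<gamma> R t) (w_up n \<theta> R t)) \<le>
      c * real d * (9 * ln (real n / p) + (if t = 0 then max 0 (ln (1 / D)) else 0))"
    unfolding max_b[symmetric] by (rule bits_le[OF c radii_pos(1,2)]) (use * nb b0 in auto)
  show "real (bits (y_down \<gamma> \<theta> R t) (w_down \<theta> R t)) \<le>
      c * real d * (9 * ln (real n / p) + (if t = 0 then max 0 (ln (1 / D)) else 0))"
    unfolding max_b[symmetric] by (rule bits_le[OF c radii_pos(3,4)]) (use * nb b0 in auto)
qed

lemma total_bits_le: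
  assumes c: "0 \<le> c"
  shows "real (total_bits n bits \<gamma> \<theta> R T) \<le>
    c * (real n * real d * (18 * real T * ln (real n / p) + 2 * max 0 (ln (1 / D))))"
proof -
  define E where "E = max 0 (ln (1 / D))"
  define \<Lambda> where "\<Lambda> = ln (real n / p)"
  have E0: "0 \<le> E" by (simp add: E_def)
  have "real (total_bits n bits \<gamma> \<theta> R T) =
      (\<Sum>t<T. real n * real (bits (y_up n \<gamma> R t) (w_up n \<theta> R t)) +
        real n * real (bits (y_down \<gamma> \<theta> R t) (w_down \<theta> R t)))"
    by (simp add: total_bits_def)
  also have "\<dots> \<le> (\<Sum>t<T. real n * (c * real d * (9 * \<Lambda> + (if t = 0 then E else 0))) +
        real n * (c * real d * (9 * \<Lambda> + (if t = 0 then E else 0))))"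
    unfolding E_def \<Lambda>_def by (intro sum_mono add_mono mult_left_mono round_bits_le c) auto
  also have "\<dots> = (\<Sum>t<T. c * (real n * real d) * (18 * \<Lambda> + (if t = 0 then 2 * E else 0)))"
    by (intro sum.cong) (auto simp: algebra_simps)
  also have "\<dots> = c * (real n * real d) * (18 * real T * \<Lambda> + (\<Sum>t<T. if t = 0 then 2 * E else 0))"
    by (simp only: sum_distrib_left[symmetric] sum.distrib) simp
  also have "\<dots> \<le> c * (real n * real d) * (18 * real T * \<Lambda> + 2 * E)"
    using c E0 by (intro mult_left_mono add_left_mono) (auto simp: sum.delta)
  finally show ?thesis by (simp add: E_def \<Lambda>_def mult.assoc)
qed

text \<open>By \<open>p_le\<close>, \<open>\<xi> = 1 - (1 - s) / 2\<close> is at most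
  \<open>1 - p / 8\<close>, hence at most \<open>exp (- p / 8)\<close>.\<close>

lemma pow_\<xi>_le:
  assumes \<epsilon>: "0 < \<epsilon>" and T: "8 / p * ln (D / \<epsilon>) \<le> real T"
  shows "\<xi> ^ T * D \<le> \<epsilon>"
proof -
  have "\<xi> \<le> 1 + (- p / 8)" using p_le by (simp add: \<xi>_def)
  also have "\<dots> \<le> exp (- p / 8)" by (rule exp_ge_add_one_self)
  finally have "\<xi> ^ T \<le> exp (- p / 8) ^ T" using \<xi>_bounds by (intro power_mono) auto
  also have "\<dots> = exp (- (real T * (p / 8)))" by (simp flip: exp_of_nat_mult)
  also have "\<dots> \<le> exp (- ln (D / \<epsilon>))" using T p_bounds by (simp add: field_simps)
  also have "\<dots> = \<epsilon> / D" using \<epsilon> D by (simp add: exp_minus)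
  finally show ?thesis using D by (simp add: field_simps)
qed

text \<open>Each round costs \<open>18 * ln (n / p)\<close> per machine and dimension, up to the
  factor \<open>c\<close>, and \<open>8 / p * ln (D / \<epsilon>)\<close> rounds give 144. Rounding
  \<open>T\<close> up adds one round and round 0 its surcharge; with \<open>\<kappa>\<close> they
  are charged to \<open>L\<close> as \<open>18 / \<kappa>\<close> and
  \<open>2 / \<kappa>\<close>.\<close>

lemma communication_bound:
  assumes c: "0 \<le> c" and \<kappa>: "0 < \<kappa>" "\<kappa> \<le> ln (D / \<epsilon>)" and \<epsilon>: "0 < \<epsilon>"
  defines "L \<equiv> 1 / p * ln (real n / p) * ln (D / \<epsilon>)"
  assumes L: "\<kappa> * ln (1 / D) \<le> L"
  shows "\<exists>T. real (total_bits n bits \<gamma> \<theta> R T) \<le> c * (144 + 20 / \<kappa>) * (real n * real d * L) \<and>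
     \<xi> ^ T * D \<le> \<epsilon>"
proof -
  define T where "T = nat \<lceil>8 / p * ln (D / \<epsilon>)\<rceil>"
  define \<Lambda> where "\<Lambda> = ln (real n / p)"
  have \<Lambda>: "0 < \<Lambda>" using ln_n_p by (simp add: \<Lambda>_def)
  have nn: "0 \<le> 8 / p * ln (D / \<epsilon>)" using p_bounds \<kappa> by simp
  have T: "8 / p * ln (D / \<epsilon>) \<le> real T" "real T \<le> 8 / p * ln (D / \<epsilon>) + 1"
    using nn by (auto simp: T_def)
  have "1 * \<kappa> \<le> 1 / p * ln (D / \<epsilon>)" using p_bounds \<kappa> by (intro mult_mono) auto
  then have "\<Lambda> * (1 * \<kappa>) \<le> \<Lambda> * (1 / p * ln (D / \<epsilon>))" using \<Lambda> by (intro mult_left_mono) auto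
  then have "\<Lambda> * \<kappa> \<le> L" by (simp add: L_def \<Lambda>_def mult_ac)
  then have \<Lambda>L: "\<Lambda> \<le> L / \<kappa>" using \<kappa> by (simp add: pos_le_divide_eq)
  have L0: "0 \<le> L" using \<Lambda> p_bounds \<kappa> by (simp add: L_def \<Lambda>_def)
  have DL: "max 0 (ln (1 / D)) \<le> L / \<kappa>" using L L0 \<kappa> by (simp add: field_simps)
  have "18 * real T * \<Lambda> \<le> 18 * (8 / p * ln (D / \<epsilon>) + 1) * \<Lambda>"
    using T \<Lambda> by (intro mult_right_mono mult_left_mono) auto
  also have "\<dots> = 144 * L + 18 * \<Lambda>" by (simp add: L_def \<Lambda>_def algebra_simps)
  finally have "18 * real T * \<Lambda> + 2 * max 0 (ln (1 / D)) \<le> 144 * L + 20 * (L / \<kappa>)"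
    using \<Lambda>L DL by linarith
  then have "c * (real n * real d * (18 * real T * \<Lambda> + 2 * max 0 (ln (1 / D)))) \<le>
      c * (real n * real d * (144 * L + 20 * (L / \<kappa>)))"
    using c by (intro mult_left_mono) auto
  then have "real (total_bits n bits \<gamma> \<theta> R T) \<le> c * (144 + 20 / \<kappa>) * (real n * real d * L)"
    using total_bits_le[OF c, of T] by (simp add: \<Lambda>_def algebra_simps)
  then show ?thesis using pow_\<xi>_le[OF \<epsilon> T(1)] by blast
qed

end

lemma quantized_pca_gram:
  assumes d: "2 \<le> d" and i0: "i0 < n" and M: "M \<in> carrier_mat m d" and part: "\<forall>k<m. part k < n"
    and es: "eigenvalues_desc (gram M) es" and gap: "es ! 0 - es ! 1 > 0"
    and v1: "v1 \<in> unit_sphere d" and eig: "eigenvector (gram M) v1 (es ! 0)"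
    and x0: "x0 \<in> unit_sphere d" and xs: "xs \<in> {v1, - v1}"
    and D: "0 < D" "D < pi / 2" "sph_dist x0 xs \<le> D"
    and Q: "lattice_quantizer d c Q enc dec bits" and U: "tangent_frames d U"
    and \<eta>: "0 < \<eta>" "\<eta> \<le> cos D / smoothness M part n"
  shows "quantized_pca d n i0 (\<lambda>i. gram (local_data M part i)) (gram M) xs (es ! 0) (es ! 0 - es ! 1)
    (smoothness M part n) D \<eta> c Q enc dec bits U x0"
proof -
  note Ac = gram_carrier[OF M] and As = gram_symmetric[OF M]
  have v1d: "v1 \<in> carrier_vec d" "dim_vec v1 = d" "v1 \<bullet> v1 = 1" using v1 by (auto simp: unit_sphereD)
  have Av: "gram M *\<^sub>v v1 = (es ! 0) \<cdot>\<^sub>v v1" using eig by (simp add: eigenvector_def)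
  have xs': "xs \<in> unit_sphere d" using xs v1d by (auto simp: unit_sphere_iff sp_simps)
  have eigx: "gram M *\<^sub>v xs = (es ! 0) \<cdot>\<^sub>v xs"
  proof (cases "xs = v1")
    case False
    then have "xs = (- 1) \<cdot>\<^sub>v v1" using xs v1d by (intro eq_vecI) auto
    then show ?thesis using mat_vec_smult[OF Ac v1d(1), of "- 1"] Av by (simp add: smult_smult_assoc)
  qed (use Av in simp)
  interpret F: tangent_frame d "U xs" xs
    by unfold_locales (use U xs' d in \<open>auto simp: tangent_frames_def\<close>)
  note ray = F.rayleigh_orthogonal_complement[OF Ac As d es eigx]
  \<comment> \<open>The semidefinite Gram form at a unit vector orthogonal to \<open>xs\<close>,
    which exists as \<open>d \<ge> 2\<close>, lies between 0 and \<open>es ! 1\<close>. This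
    provides \<open>\<delta> \<le> l\<close>.\<close>
  have "0 \<le> es ! 1"
  proof -
    define e :: "real vec" where "e = unit_vec (d - 1) 0"
    have e: "e \<in> carrier_vec (d - 1)" "e \<bullet> e = 1" using d by (simp_all add: e_def)
    note iso = F.isometry[OF e(1)]
    have "0 \<le> (U xs *\<^sub>v e) \<bullet> (gram M *\<^sub>v (U xs *\<^sub>v e))"
      using gram_psd[OF M] iso(1) by (simp add: psd_def)
    also have "\<dots> \<le> es ! 1" using ray[OF iso(1,2)] iso(3) e by simp
    finally show ?thesis .
  qed
  then show ?thesis
    by unfold_locales
      (use d i0 gram_psd[OF local_data_carrier[OF M]] smoothness_bound[OF M] gram_psd[OF M]
        gram_eq_sum_local[OF M part] xs' eigx ray gap D \<eta> Q U x0 in auto)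
qed

text \<open>\<open>\<kappa>\<close> fixes the asymptotic regime: \<open>C\<close> depends on it and
  on \<open>cQ\<close>, but not on the dimension, the number of machines or the data. The existence
  of a run is asserted separately, so the claim about all runs is not vacuous.\<close>

theorem theorem9:
  fixes cQ \<kappa> :: real
  assumes "cQ > 0" and "\<kappa> > 0"
  shows "\<exists>C>0. \<forall>(d::nat) (m::nat) (n::nat) (i0::nat) (M::real mat) (part::nat \<Rightarrow> nat)
      (es::real list) (v1::real vec) (x0::real vec) (xstar::real vec)
      (D::real) (\<eta>::real) (\<epsilon>::real)
      (Q::real vec \<Rightarrow> real vec \<Rightarrow> real \<Rightarrow> real \<Rightarrow> real vec)
      (enc::real \<Rightarrow> real \<Rightarrow> real vec \<Rightarrow> bool list)
      (dec::real \<Rightarrow> real \<Rightarrow> bool list \<Rightarrow> real vec \<Rightarrow> real vec)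
      (bits::real \<Rightarrow> real \<Rightarrow> nat) (U::real vec \<Rightarrow> real mat).
    (let A = gram M;
         f = (\<lambda>i. pca_cost (gram (local_data M part i)));
         \<delta> = es ! 0 - es ! 1;
         \<mu> = \<delta> / 2;
         \<gamma> = smoothness M part n;
         \<sigma> = sigma_par D \<mu> \<eta>;
         \<theta> = theta_par \<sigma>;
         R = R_par \<gamma> \<sigma> D;
         QT = tangent_quant U Q;
         L = 1 / (cos D * \<delta> * \<eta>) * ln (real n / (cos D * \<delta> * \<eta>)) * ln (D / \<epsilon>)
     in 2 \<le> d \<longrightarrow> i0 < n \<longrightarrow>
        M \<in> carrier_mat m d \<longrightarrow> (\<forall>k<m. part k < n) \<longrightarrow>
        eigenvalues_desc A es \<longrightarrow> \<delta> > 0 \<longrightarrow>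
        v1 \<in> unit_sphere d \<longrightarrow> eigenvector A v1 (es ! 0) \<longrightarrow>
        x0 \<in> unit_sphere d \<longrightarrow> xstar \<in> {v1, - v1} \<longrightarrow>
        (\<forall>v\<in>{v1, - v1}. sph_dist x0 xstar \<le> sph_dist x0 v) \<longrightarrow>
        0 < D \<longrightarrow> D < pi / 2 \<longrightarrow> sph_dist x0 xstar \<le> D \<longrightarrow>
        lattice_quantizer d cQ Q enc dec bits \<longrightarrow> tangent_frames d U \<longrightarrow>
        0 < \<eta> \<longrightarrow> \<eta> \<le> cos D / \<gamma> \<longrightarrow>
        0 < \<epsilon> \<longrightarrow> \<kappa> \<le> ln (D / \<epsilon>) \<longrightarrow> \<kappa> * ln (1 / D) \<le> L \<longrightarrow>
        (\<exists>T. real (total_bits n bits \<gamma> \<theta> R T) \<le> C * (real n * real d * L) \<and>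
             (\<exists>x qi r q. qrgd_run d n i0 f QT \<gamma> \<eta> \<theta> R x0 x qi r q) \<and>
             (\<forall>x qi r q. qrgd_run d n i0 f QT \<gamma> \<eta> \<theta> R x0 x qi r q \<longrightarrow>
                sph_dist (x T) xstar \<le> \<epsilon>)))"
proof (intro exI[of _ "cQ * (144 + 20 / \<kappa>)"] conjI allI, goal_cases)
  case 1
  show ?case using assms by (simp add: add_pos_pos)
next
  case (2 d m n i0 M part es v1 x0 xstar D \<eta> \<epsilon> Q enc dec bits U)
  show ?case
    unfolding Let_def
  proof (intro impI, goal_cases)
    case 1
    interpret quantized_pca d n i0 "\<lambda>i. gram (local_data M part i)" "gram M" xstar "es ! 0"
        "es ! 0 - es ! 1" "smoothness M part n" D \<eta> cQ Q enc dec bits U x0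
      by (rule quantized_pca_gram) (use 1 in blast)+
    have "0 \<le> cQ" using assms by simp
    note bound = communication_bound[OF this assms(2) 1(20,19), unfolded p_def, OF 1(21)]
    then obtain T where T: "real (total_bits n bits (smoothness M part n) \<theta> R T) \<le> cQ * (144 + 20 / \<kappa>) *
        (real n * real d * (1 / (cos D * (es ! 0 - es ! 1) * \<eta>) *
          ln (real n / (cos D * (es ! 0 - es ! 1) * \<eta>)) * ln (D / \<epsilon>)))" "\<xi> ^ T * D \<le> \<epsilon>"
      by blast
    have "sph_dist (x T) xstar \<le> \<epsilon>" if "run x qi r q" for x qi r q
      using run_dist[OF that, of T] T(2) by linarith
    then show ?case
      using T(1) run_exists unfolding \<theta>_def R_def \<sigma>_def by blast
  qed
qed

end
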